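(* Let $G$ be a finite abelian group of order $N$, and let $p:\widetilde{X}\to X$ be a harmonic Galois cover of graphs with Galois group $G$, with $\widetilde{X}$ (hence $X$) connected. Then the number of spanning trees of $\widetilde{X}$, which equals $|\mathrm{Jac}(\widetilde{X})|$, is $$|\mathrm{Jac}(\widetilde{X})|=\frac{1}{N}\left(\prod_{v\in V(X)}|D(v)|^{N/|D(v)|}\right)|\mathrm{Jac}(X)|\prod_{\rho\in \widehat{G}'}w(\mathcal{M}^*(\widetilde{X}/X,\rho)),$$ where $D(v)\subseteq G$ is the dilation group at the vertex $v\in V(X)$, $|\mathrm{Jac}(X)|$ is the number of spanning trees of $X$, $\widehat{G}'$ is the set of nontrivial characters $\rho:G\to\mathbb{C}^*$, and $w(\mathcal{M}^*(\widetilde{X}/X,\rho))$ is the weight of the matroid $\mathcal{M}^*(\widetilde{X}/X,\rho)$.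
   Context: **Graphs.** A graph $X$ consists of a finite set $V(X)$ of vertices, a finite set $H(X)$ of half-edges, a fixed-point-free involution $h\mapsto\overline{h}$ on $H(X)$, and a root map $r:H(X)\to V(X)$. An edge is an orbit $e=\{h,\overline{h}\}$; $E(X)$ is the set of edges; loops and multiple edges are allowed. An orientation orders the two half-edges of each edge $e=(h,\overline h)$ and gives source and target maps $s(e)=r(h)$, $t(e)=r(\overline{h})$. The genus of a connected graph is $g(X)=|E(X)|-|V(X)|+1$. For $v\in V(X)$, $T_v(X)=\{h\in H(X): r(h)=v\}$ and $\mathrm{val}(v)=|T_v(X)|$. A morphism of graphs is a pair of maps on vertices and half-edges commuting with the root maps and involutions. **Jacobian.** $\mathrm{Div}_0(X)\subset\mathbb{Z}^{V(X)}$ is the subgroup of elements with coefficient sum zero; $L=Q-A$ on $\mathbb{Z}^{V(X)}$ is the Laplacian, where $Q$ is the diagonal matrix of valencies and $A_{uv}$ is the number of edges between $u$ and $v$ (each loop at $u$ contributes 2 to both $Q_{uu}$ and $A_{uu}$). $\mathrm{Jac}(X)=\mathrm{Div}_0(X)/\mathrm{Im}\,L$; for connected $X$ it is finite of order the number of spanning trees of $X$. **Harmonic covers.** A morphism $f:\widetilde{X}\to X$ is harmonic if there is a function $d_f:V(\widetilde{X})\to\mathbb{Z}_{>0}$ with $d_f(\tilde v)=|T_{\tilde v}(\widetilde X)\cap f^{-1}(h)|$ for all $\tilde v\in V(\widetilde X)$ and all $h\in T_{f(\tilde v)}(X)$. If $X$ is connected its degree is $\sum_{\tilde v\in f^{-1}(v)}d_f(\tilde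 v)$ (equal to $|f^{-1}(e)|$), independent of $v$ and $e$. A harmonic Galois cover with Galois group $G$ (harmonic $G$-cover) is a harmonic morphism $p:\widetilde X\to X$ of degree $|G|$ together with an action of $G$ on $\widetilde X$ by graph automorphisms (such that no group element exchanges the two half-edges of an edge) with $p\circ g=p$ and $d_p\circ g=d_p$ for all $g\in G$, such that $G$ acts transitively on $p^{-1}(v)$ for each $v\in V(X)$, and freely and transitively on $p^{-1}(e)$ for each $e\in E(X)$. For $G$ abelian (written additively), the dilation group $D(v)\subseteq G$ of $v\in V(X)$ is the common stabilizer of all the vertices in $p^{-1}(v)$. **Voltages.** Fix an orientation on $X$. Any harmonic $G$-cover with dilation groups $D(v)$ is, up to $G$-equivariant isomorphism over $X$, obtained from a dilated voltage assignment $\eta=(\eta_e)_{e\in E(X)}$, $\eta_e\in G/(D(s(e))+D(t(e)))$, as follows (after lifting each $\eta_e$ to $G$): $p^{-1}(v)=\{\tilde v_{[g]}:[g]\in G/D(v)\}$, $p^{-1}(e)=\{\tilde e_g:g\in G\}$, $G$ acts by translation on the indices, $s(\tilde e_g)=\widetilde{s(e)}_{[g]}$, $t(\tilde e_g)=\widetilde{t(e)}_{[g+\eta_e]}$. The assignment $\eta$ is determined by $p$ up to changing it to $\eta_e+\xi(t(e))-\xi(s(e))$ with $\xi(v)\in G/D(v)$. Set $\eta_{\overline e}=-\eta_e$ for the reversed edge. **Matroids and weights.** Let $\rho:G\to\mathbb{C}^*$ be a nontrivial character. For $F\subseteq E(X)$, $X\setminus F$ is the graph with all the vertices of $X$ and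 edge set $E(X)\setminus F$. The matroid $\mathcal{M}^*(\widetilde X/X,\rho)$ on the ground set $E(X)$ has as bases those $F\subseteq E(X)$ such that each connected component $X_i$ of $X\setminus F=X_1\sqcup\cdots\sqcup X_k$ is one of the following: (a) a graph of genus one with $\rho(D(v))=\{1\}$ for all $v\in V(X_i)$ and $\rho(\eta(X_i))\neq1$, where $\eta(X_i)$ is the oriented sum of the voltages $\eta_e$ along the unique cycle of $X_i$ (so $\rho(\eta(X_i))$ is well-defined up to inversion); (b) a tree containing exactly one vertex $v$ with $\rho(D(v))\neq\{1\}$. The weight of a basis is $w_\rho(F)=\prod_i w_\rho(X_i)$, where $w_\rho(X_i)=|1-\rho(\eta(X_i))|^2$ in case (a) and $w_\rho(X_i)=1$ in case (b). The weight of the matroid is $w(\mathcal{M}^*(\widetilde X/X,\rho))=\sum_F w_\rho(F)$, the sum being over all bases $F$. *)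

theory Defs
  imports Complex_Main "HOL-Algebra.Group_Action"
begin

section \<open>Graphs with half-edges\<close>

record ('v, 'h) hgraph =
  verts :: "'v set"
  halfs :: "'h set"
  flip :: "'h \<Rightarrow> 'h"
  rt :: "'h \<Rightarrow> 'v"

locale hgraph =
  fixes X :: "('v, 'h) hgraph"
  assumes finite_verts: "finite (verts X)"
    and finite_halfs: "finite (halfs X)"
    and flip_closed: "h \<in> halfs X \<Longrightarrow> flip X h \<in> halfs X"
    and flip_flip: "h \<in> halfs X \<Longrightarrow> flip X (flip X h) = h"
    and flip_neq: "h \<in> halfs X \<Longrightarrow> flip X h \<noteq> h"
    and rt_closed: "h \<in> halfs X \<Longrightarrow> rt X h \<in> verts X"

definition edge_of :: "('v, 'h) hgraph \<Rightarrow> 'h \<Rightarrow> 'h set" where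
  "edge_of X h = {h, flip X h}"

definition edges :: "('v, 'h) hgraph \<Rightarrow> 'h set set" where
  "edges X = edge_of X ` halfs X"

definition tangent :: "('v, 'h) hgraph \<Rightarrow> 'v \<Rightarrow> 'h set" where
  "tangent X v = {h \<in> halfs X. rt X h = v}"

definition val :: "('v, 'h) hgraph \<Rightarrow> 'v \<Rightarrow> nat" where
  "val X v = card (tangent X v)"

text \<open>An orientation selects the first half-edge of each edge.\<close>

definition orientation :: "('v, 'h) hgraph \<Rightarrow> ('h set \<Rightarrow> 'h) \<Rightarrow> bool" where
  "orientation X ori \<longleftrightarrow> (\<forall>e \<in> edges X. ori e \<in> e)"

definition source :: "('v, 'h) hgraph \<Rightarrow> ('h set \<Rightarrow> 'h) \<Rightarrow> 'h set \<Rightarrow> 'v" where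
  "source X ori e = rt X (ori e)"

definition target :: "('v, 'h) hgraph \<Rightarrow> ('h set \<Rightarrow> 'h) \<Rightarrow> 'h set \<Rightarrow> 'v" where
  "target X ori e = rt X (flip X (ori e))"

definition adj_rel :: "('v, 'h) hgraph \<Rightarrow> ('v \<times> 'v) set" where
  "adj_rel X = {(rt X h, rt X (flip X h)) | h. h \<in> halfs X}"

text \<open>The empty graph does not count as connected.\<close>

definition connected_hgraph :: "('v, 'h) hgraph \<Rightarrow> bool" where
  "connected_hgraph X \<longleftrightarrow>
     verts X \<noteq> {} \<and> (\<forall>u \<in> verts X. \<forall>v \<in> verts X. (u, v) \<in> (adj_rel X)\<^sup>*)"

definition genus :: "('v, 'h) hgraph \<Rightarrow> int" where
  "genus X = int (card (edges X)) - int (card (verts X)) + 1"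

text \<open>
  A cycle is a closed walk, listed by the half-edges at which its edges are entered, without
  repeated vertices or edges.  A loop is a cycle of length 1 (listed by either half-edge) and two
  parallel edges form a cycle of length 2; distinctness of edges excludes \<open>[h, flip X h]\<close>.
\<close>

definition is_cycle :: "('v, 'h) hgraph \<Rightarrow> 'h list \<Rightarrow> bool" where
  "is_cycle X c \<longleftrightarrow>
     c \<noteq> [] \<and> set c \<subseteq> halfs X \<and>
     (\<forall>i < length c. rt X (flip X (c ! i)) = rt X (c ! (Suc i mod length c))) \<and>
     distinct (map (rt X) c) \<and> distinct (map (edge_of X) c)"

definition is_tree :: "('v, 'h) hgraph \<Rightarrow> bool" where
  "is_tree X \<longleftrightarrow> connected_hgraph X \<and> (\<nexists>c. is_cycle X c)"

definition delete_edges :: "('v, 'h) hgraph \<Rightarrow> 'h set set \<Rightarrow> ('v, 'h) hgraph" where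
  "delete_edges X F = X\<lparr>halfs := halfs X - \<Union>F\<rparr>"

definition component_of :: "('v, 'h) hgraph \<Rightarrow> 'v \<Rightarrow> ('v, 'h) hgraph" where
  "component_of X v =
     (let W = {u \<in> verts X. (v, u) \<in> (adj_rel X)\<^sup>*}
      in X\<lparr>verts := W, halfs := {h \<in> halfs X. rt X h \<in> W}\<rparr>)"

definition components :: "('v, 'h) hgraph \<Rightarrow> ('v, 'h) hgraph set" where
  "components X = component_of X ` verts X"

definition spanning_trees :: "('v, 'h) hgraph \<Rightarrow> 'h set set set" where
  "spanning_trees X = {T. T \<subseteq> edges X \<and> is_tree (delete_edges X (edges X - T))}"


section \<open>The Jacobian\<close>

text \<open>
  \<open>\<int>\<^sup>V\<close> is realised by the integer functions vanishing off the vertex set.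
\<close>

definition Divs :: "('v, 'h) hgraph \<Rightarrow> ('v \<Rightarrow> int) set" where
  "Divs X = {a. \<forall>v. v \<notin> verts X \<longrightarrow> a v = 0}"

definition Div0 :: "('v, 'h) hgraph \<Rightarrow> ('v \<Rightarrow> int) monoid" where
  "Div0 X = \<lparr>carrier = {a \<in> Divs X. (\<Sum>v \<in> verts X. a v) = 0},
             mult = (\<lambda>a b v. a v + b v), one = (\<lambda>_. 0)\<rparr>"

text \<open>
  Counting half-edges at \<open>u\<close> whose opposite half-edge is at \<open>v\<close> counts each non-loop edge between
  \<open>u\<close> and \<open>v\<close> once and each loop at \<open>u = v\<close> twice.
\<close>

definition adjacency :: "('v, 'h) hgraph \<Rightarrow> 'v \<Rightarrow> 'v \<Rightarrow> int" where
  "adjacency X u v = int (card {h \<in> halfs X. rt X h = u \<and> rt X (flip X h) = v})"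

definition laplacian_entry :: "('v, 'h) hgraph \<Rightarrow> 'v \<Rightarrow> 'v \<Rightarrow> int" where
  "laplacian_entry X u v = (if u = v then int (val X u) else 0) - adjacency X u v"

definition laplacian :: "('v, 'h) hgraph \<Rightarrow> ('v \<Rightarrow> int) \<Rightarrow> ('v \<Rightarrow> int)" where
  "laplacian X a =
     (\<lambda>u. if u \<in> verts X then \<Sum>v \<in> verts X. laplacian_entry X u v * a v else 0)"

definition Jac :: "('v, 'h) hgraph \<Rightarrow> ('v \<Rightarrow> int) set monoid" where
  "Jac X = Div0 X Mod (laplacian X ` Divs X)"


section \<open>Harmonic Galois covers\<close>

locale hgraph_morphism = dom: hgraph Y + cod: hgraph X
  for Y :: "('w, 'k) hgraph" and X :: "('v, 'h) hgraph" +
  fixes fV :: "'w \<Rightarrow> 'v" and fH :: "'k \<Rightarrow> 'h"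
  assumes vert_closed: "w \<in> verts Y \<Longrightarrow> fV w \<in> verts X"
    and half_closed: "k \<in> halfs Y \<Longrightarrow> fH k \<in> halfs X"
    and rt_commute: "k \<in> halfs Y \<Longrightarrow> rt X (fH k) = fV (rt Y k)"
    and flip_commute: "k \<in> halfs Y \<Longrightarrow> flip X (fH k) = fH (flip Y k)"

text \<open>
  The local degree function \<open>d\<close> is a parameter since the morphism does not determine it at vertices
  over an isolated vertex.
\<close>

locale harmonic_morphism = hgraph_morphism Y X fV fH
  for Y :: "('w, 'k) hgraph" and X :: "('v, 'h) hgraph" and fV fH +
  fixes d :: "'w \<Rightarrow> nat"
  assumes d_pos: "w \<in> verts Y \<Longrightarrow> d w > 0"
    and d_eq: "\<lbrakk>w \<in> verts Y; h \<in> tangent X (fV w)\<rbrakk> \<Longrightarrow>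
                 d w = card (tangent Y w \<inter> {k. fH k = h})"

definition vert_fiber :: "('w, 'k) hgraph \<Rightarrow> ('w \<Rightarrow> 'v) \<Rightarrow> 'v \<Rightarrow> 'w set" where
  "vert_fiber Y fV v = {w \<in> verts Y. fV w = v}"

definition edge_fiber :: "('w, 'k) hgraph \<Rightarrow> ('k \<Rightarrow> 'h) \<Rightarrow> 'h set \<Rightarrow> 'k set set" where
  "edge_fiber Y fH e = {e' \<in> edges Y. fH ` e' = e}"

locale harmonic_galois_cover =
  comm_group G + harmonic_morphism Y X pV pH d +
  vert_action: group_action G "verts Y" \<phi>V + half_action: group_action G "halfs Y" \<phi>H
  for G :: "('g, 'b) monoid_scheme" (structure)
    and Y :: "('w, 'k) hgraph" and X :: "('v, 'h) hgraph"
    and pV pH d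
    and \<phi>V :: "'g \<Rightarrow> 'w \<Rightarrow> 'w" and \<phi>H :: "'g \<Rightarrow> 'k \<Rightarrow> 'k" +
  assumes degree: "v \<in> verts X \<Longrightarrow> (\<Sum>w \<in> vert_fiber Y pV v. d w) = order G"
    and act_rt: "\<lbrakk>g \<in> carrier G; k \<in> halfs Y\<rbrakk> \<Longrightarrow> rt Y (\<phi>H g k) = \<phi>V g (rt Y k)"
    and act_flip: "\<lbrakk>g \<in> carrier G; k \<in> halfs Y\<rbrakk> \<Longrightarrow> flip Y (\<phi>H g k) = \<phi>H g (flip Y k)"
    and no_inversion: "\<lbrakk>g \<in> carrier G; k \<in> halfs Y\<rbrakk> \<Longrightarrow> \<phi>H g k \<noteq> flip Y k"
    and pV_invariant: "\<lbrakk>g \<in> carrier G; w \<in> verts Y\<rbrakk> \<Longrightarrow> pV (\<phi>V g w) = pV w"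
    and pH_invariant: "\<lbrakk>g \<in> carrier G; k \<in> halfs Y\<rbrakk> \<Longrightarrow> pH (\<phi>H g k) = pH k"
    and d_invariant: "\<lbrakk>g \<in> carrier G; w \<in> verts Y\<rbrakk> \<Longrightarrow> d (\<phi>V g w) = d w"
    and vert_transitive:
      "\<lbrakk>v \<in> verts X; w \<in> vert_fiber Y pV v; w' \<in> vert_fiber Y pV v\<rbrakk>
         \<Longrightarrow> \<exists>g \<in> carrier G. \<phi>V g w = w'"
    and edge_transitive:
      "\<lbrakk>e \<in> edges X; e' \<in> edge_fiber Y pH e; e'' \<in> edge_fiber Y pH e\<rbrakk>
         \<Longrightarrow> \<exists>g \<in> carrier G. \<phi>H g ` e' = e''"
    and edge_free:
      "\<lbrakk>e \<in> edges X; e' \<in> edge_fiber Y pH e; g \<in> carrier G; \<phi>H g ` e' = e'\<rbrakk> \<Longrightarrow> g = \<one>"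

definition dilation_group ::
  "('g, 'b) monoid_scheme \<Rightarrow> ('w, 'k) hgraph \<Rightarrow> ('w \<Rightarrow> 'v) \<Rightarrow> ('g \<Rightarrow> 'w \<Rightarrow> 'w) \<Rightarrow> 'v \<Rightarrow> 'g set" where
  "dilation_group G Y pV \<phi>V v =
     {g \<in> carrier G. \<forall>w \<in> vert_fiber Y pV v. g \<in> stabilizer G \<phi>V w}"


section \<open>Voltages\<close>

text \<open>
  The group is written multiplicatively, as in HOL-Algebra.  A dilated voltage \<open>\<eta> e\<close> is an element
  of \<open>G/(D(s(e)) + D(t(e)))\<close>, hence a coset.
\<close>

definition voltage_assignment ::
  "('g, 'b) monoid_scheme \<Rightarrow> ('v, 'h) hgraph \<Rightarrow> ('h set \<Rightarrow> 'h) \<Rightarrow> ('v \<Rightarrow> 'g set)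
     \<Rightarrow> ('h set \<Rightarrow> 'g set) \<Rightarrow> bool" where
  "voltage_assignment G X ori D \<eta> \<longleftrightarrow>
     (\<forall>e \<in> edges X. \<eta> e \<in> carrier (G Mod (D (source X ori e) <#>\<^bsub>G\<^esub> D (target X ori e))))"

text \<open>
  The cover built from lifts \<open>l e \<in> G\<close> of the voltages.  The vertex \<open>(v, C)\<close> is the vertex over \<open>v\<close>
  indexed by the coset \<open>C \<in> G/D(v)\<close>; the edge over \<open>e\<close> indexed by \<open>g\<close> consists of the half-edges
  \<open>(h, g)\<close> with \<open>h \<in> e\<close>.
\<close>

definition voltage_cover ::
  "('g, 'b) monoid_scheme \<Rightarrow> ('v, 'h) hgraph \<Rightarrow> ('h set \<Rightarrow> 'h) \<Rightarrow> ('v \<Rightarrow> 'g set)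
     \<Rightarrow> ('h set \<Rightarrow> 'g) \<Rightarrow> ('v \<times> 'g set, 'h \<times> 'g) hgraph" where
  "voltage_cover G X ori D l =
     \<lparr>verts = (SIGMA v : verts X. carrier (G Mod D v)),
      halfs = halfs X \<times> carrier G,
      flip = (\<lambda>(h, g). (flip X h, g)),
      rt = (\<lambda>(h, g). (rt X h,
              if h = ori (edge_of X h) then D (rt X h) #>\<^bsub>G\<^esub> g
              else D (rt X h) #>\<^bsub>G\<^esub> (g \<otimes>\<^bsub>G\<^esub> l (edge_of X h))))\<rparr>"

text \<open>
  \<open>\<eta>\<close> is a voltage assignment of the cover: after lifting, there is a \<open>G\<close>-equivariant isomorphism
  \<open>(iV, iH)\<close> over \<open>X\<close> onto the cover constructed above, on which \<open>G\<close> acts by translation on the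
  second components and which projects to \<open>X\<close> by the first components.
\<close>

definition voltage_of_cover ::
  "('g, 'b) monoid_scheme \<Rightarrow> ('w, 'k) hgraph \<Rightarrow> ('v, 'h) hgraph \<Rightarrow> ('w \<Rightarrow> 'v) \<Rightarrow> ('k \<Rightarrow> 'h)
     \<Rightarrow> ('g \<Rightarrow> 'w \<Rightarrow> 'w) \<Rightarrow> ('g \<Rightarrow> 'k \<Rightarrow> 'k) \<Rightarrow> ('h set \<Rightarrow> 'h) \<Rightarrow> ('h set \<Rightarrow> 'g set) \<Rightarrow> bool" where
  "voltage_of_cover G Y X pV pH \<phi>V \<phi>H ori \<eta> \<longleftrightarrow>
     (let D = dilation_group G Y pV \<phi>V in
      voltage_assignment G X ori D \<eta> \<and>
      (\<exists>l iV iH.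
         (\<forall>e \<in> edges X. l e \<in> \<eta> e) \<and>
         hgraph_morphism Y (voltage_cover G X ori D l) iV iH \<and>
         bij_betw iV (verts Y) (verts (voltage_cover G X ori D l)) \<and>
         bij_betw iH (halfs Y) (halfs (voltage_cover G X ori D l)) \<and>
         (\<forall>w \<in> verts Y. fst (iV w) = pV w) \<and>
         (\<forall>k \<in> halfs Y. fst (iH k) = pH k) \<and>
         (\<forall>g \<in> carrier G. \<forall>w \<in> verts Y. snd (iV (\<phi>V g w)) = g <#\<^bsub>G\<^esub> snd (iV w)) \<and>
         (\<forall>g \<in> carrier G. \<forall>k \<in> halfs Y. snd (iH (\<phi>H g k)) = g \<otimes>\<^bsub>G\<^esub> snd (iH k))))"


lemma (in hgraph) edge_of_flip: "h \<in> halfs X \<Longrightarrow> edge_of X (flip X h) = edge_of X h"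
  by (auto simp: edge_of_def flip_flip)

text \<open>Every harmonic Galois cover with finite group has a voltage assignment.\<close>

lemma voltage_of_cover_exists:
  assumes cover: "harmonic_galois_cover G Y X pV pH d \<phi>V \<phi>H"
    and fin: "finite (carrier G)" and ori: "orientation X ori"
  shows "\<exists>\<eta>. voltage_of_cover G Y X pV pH \<phi>V \<phi>H ori \<eta>"
proof -
  interpret harmonic_galois_cover G Y X pV pH d \<phi>V \<phi>H by (rule cover)
  define D where "D = dilation_group G Y pV \<phi>V"
  have V_comp: "\<phi>V (g \<otimes>\<^bsub>G\<^esub> g') w = \<phi>V g (\<phi>V g' w)"
    if "g \<in> carrier G" "g' \<in> carrier G" "w \<in> verts Y" for g g' w
    using vert_action.composition_rule that by blast
  have H_comp: "\<phi>H (g \<otimes>\<^bsub>G\<^esub> g') k = \<phi>H g (\<phi>H g' k)"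
    if "g \<in> carrier G" "g' \<in> carrier G" "k \<in> halfs Y" for g g' k
    using half_action.composition_rule that by blast
  have V_cl: "\<phi>V g w \<in> verts Y" if "g \<in> carrier G" "w \<in> verts Y" for g w
    using vert_action.element_image that by blast
  have H_cl: "\<phi>H g k \<in> halfs Y" if "g \<in> carrier G" "k \<in> halfs Y" for g k
    using half_action.element_image that by blast
  have V_one: "\<phi>V \<one>\<^bsub>G\<^esub> w = w" if "w \<in> verts Y" for w
    using vert_action.id_eq_one that by (metis restrict_apply')
  have H_one: "\<phi>H \<one>\<^bsub>G\<^esub> k = k" if "k \<in> halfs Y" for k
    using half_action.id_eq_one that by (metis restrict_apply')
  have ord_pos: "order G > 0"
    using fin order_gt_0_iff_finite by blast
  have V_ex: "\<exists>w. w \<in> verts Y \<and> pV w = v" if "v \<in> verts X" for v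
  proof (rule ccontr)
    assume "\<not> ?thesis"
    hence "vert_fiber Y pV v = {}" by (auto simp: vert_fiber_def)
    thus False using degree[OF that] ord_pos by simp
  qed
  have V_trans: "\<exists>g \<in> carrier G. \<phi>V g w = w'"
    if "w \<in> verts Y" "w' \<in> verts Y" "pV w = pV w'" for w w'
    using vert_transitive[of "pV w" w w'] that vert_closed by (auto simp: vert_fiber_def)
  have stab_D: "D (pV w) = stabilizer G \<phi>V w" if w: "w \<in> verts Y" for w
  proof
    show "D (pV w) \<subseteq> stabilizer G \<phi>V w"
      using w by (auto simp: D_def dilation_group_def vert_fiber_def)
    show "stabilizer G \<phi>V w \<subseteq> D (pV w)"
    proof
      fix g assume "g \<in> stabilizer G \<phi>V w"
      hence g: "g \<in> carrier G" "\<phi>V g w = w" by (auto simp: stabilizer_def)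
      have "\<phi>V g w' = w'" if w': "w' \<in> verts Y" "pV w' = pV w" for w'
      proof -
        obtain x where x: "x \<in> carrier G" "\<phi>V x w = w'" using V_trans[of w w'] w w' by auto
        have "\<phi>V g w' = \<phi>V (x \<otimes>\<^bsub>G\<^esub> g) w"
          using x g w V_comp m_comm by metis
        also have "\<dots> = w'" using x g w V_comp by metis
        finally show ?thesis .
      qed
      thus "g \<in> D (pV w)" using g
        by (auto simp: D_def dilation_group_def vert_fiber_def stabilizer_def)
    qed
  qed
  have sub_D: "subgroup (D v) G" if "v \<in> verts X" for v
    using V_ex[OF that] stab_D vert_action.stabilizer_subgroup by metis
  have coset: "{g \<in> carrier G. \<phi>V g w = \<phi>V x w} = D (pV w) #>\<^bsub>G\<^esub> x"
    if w: "w \<in> verts Y" and x: "x \<in> carrier G" for w x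
  proof -
    have sg: "subgroup (D (pV w)) G" using sub_D w vert_closed by blast
    have *: "\<phi>V g w = \<phi>V x w \<longleftrightarrow> g \<otimes>\<^bsub>G\<^esub> inv\<^bsub>G\<^esub> x \<in> D (pV w)" if g: "g \<in> carrier G" for g
    proof -
      let ?y = "g \<otimes>\<^bsub>G\<^esub> inv\<^bsub>G\<^esub> x"
      have yc: "?y \<in> carrier G" using g x by simp
      have gy: "g = x \<otimes>\<^bsub>G\<^esub> ?y" using g x by (simp add: m_comm m_assoc m_lcomm)
      have e: "\<phi>V g w = \<phi>V x (\<phi>V ?y w)" using V_comp[OF x yc w] gy by simp
      have "\<phi>V x (\<phi>V ?y w) = \<phi>V x w \<longleftrightarrow> \<phi>V ?y w = w"
        using vert_action.inj_prop[OF x] V_cl[OF yc w] w by (auto dest: inj_onD)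
      thus ?thesis using e stab_D[OF w] yc by (simp add: stabilizer_def)
    qed
    show ?thesis
    proof (intro Set.set_eqI iffI)
      fix g assume "g \<in> {g \<in> carrier G. \<phi>V g w = \<phi>V x w}"
      hence g: "g \<in> carrier G" "g \<otimes>\<^bsub>G\<^esub> inv\<^bsub>G\<^esub> x \<in> D (pV w)" using * by auto
      moreover have "g = (g \<otimes>\<^bsub>G\<^esub> inv\<^bsub>G\<^esub> x) \<otimes>\<^bsub>G\<^esub> x" using g x by (simp add: m_assoc)
      ultimately show "g \<in> D (pV w) #>\<^bsub>G\<^esub> x" unfolding r_coset_def by blast
    next
      fix g assume "g \<in> D (pV w) #>\<^bsub>G\<^esub> x"
      then obtain a where a: "a \<in> D (pV w)" "g = a \<otimes>\<^bsub>G\<^esub> x" by (auto simp: r_coset_def)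
      have ac: "a \<in> carrier G" using a sg subgroup.mem_carrier by metis
      hence "g \<in> carrier G" "g \<otimes>\<^bsub>G\<^esub> inv\<^bsub>G\<^esub> x = a" using a x by (simp_all add: m_assoc)
      thus "g \<in> {g \<in> carrier G. \<phi>V g w = \<phi>V x w}" using * a by auto
    qed
  qed
  have H_ex: "\<exists>k. k \<in> halfs Y \<and> pH k = h" if h: "h \<in> halfs X" for h
  proof -
    obtain w where w: "w \<in> verts Y" "pV w = rt X h" using V_ex cod.rt_closed[OF h] by blast
    have "card (tangent Y w \<inter> {k. pH k = h}) > 0"
      using d_eq[of w h] d_pos[of w] w h by (simp add: tangent_def)
    hence "tangent Y w \<inter> {k. pH k = h} \<noteq> {}" by (metis card.empty less_irrefl)
    thus ?thesis by (auto simp: tangent_def)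
  qed
  have ed: "edge_of Y k \<in> edge_fiber Y pH (edge_of X (pH k))" if "k \<in> halfs Y" for k
    using that by (auto simp: edge_fiber_def edges_def edge_of_def flip_commute)
  have edX: "edge_of X h \<in> edges X" if "h \<in> halfs X" for h
    using that by (auto simp: edges_def)
  have H_trans: "\<exists>g \<in> carrier G. \<phi>H g k = k'"
    if k: "k \<in> halfs Y" "k' \<in> halfs Y" "pH k = pH k'" for k k'
  proof -
    obtain g where g: "g \<in> carrier G" "\<phi>H g ` edge_of Y k = edge_of Y k'"
      using edge_transitive[OF edX[OF half_closed[OF k(1)]] ed[OF k(1)], of "edge_of Y k'"] ed[OF k(2)] k
      by auto
    hence "\<phi>H g k \<in> {k', flip Y k'}" by (auto simp: edge_of_def)
    moreover have "\<phi>H g k \<noteq> flip Y k'"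
    proof
      assume "\<phi>H g k = flip Y k'"
      hence "pH k = flip X (pH k')" using pH_invariant[OF g(1) k(1)] flip_commute[OF k(2)] by simp
      thus False using k cod.flip_neq half_closed by metis
    qed
    ultimately show ?thesis using g by blast
  qed
  have H_free: "g = \<one>\<^bsub>G\<^esub>" if "g \<in> carrier G" "k \<in> halfs Y" "\<phi>H g k = k" for g k
  proof -
    have "\<phi>H g ` edge_of Y k = edge_of Y k" using that act_flip[OF that(1,2)] by (simp add: edge_of_def)
    thus ?thesis using edge_free[OF edX[OF half_closed] ed] that by blast
  qed
  have H_free': "g = g'" if g: "g \<in> carrier G" "g' \<in> carrier G" and k: "k \<in> halfs Y" "\<phi>H g k = \<phi>H g' k" for g g' k
  proof -
    have "\<phi>H (inv\<^bsub>G\<^esub> g' \<otimes>\<^bsub>G\<^esub> g) k = \<phi>H (inv\<^bsub>G\<^esub> g' \<otimes>\<^bsub>G\<^esub> g') k" using g k H_comp inv_closed by metis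
    hence "inv\<^bsub>G\<^esub> g' \<otimes>\<^bsub>G\<^esub> g = \<one>\<^bsub>G\<^esub>" using H_free[of "inv\<^bsub>G\<^esub> g' \<otimes>\<^bsub>G\<^esub> g" k] g k H_one by simp
    thus ?thesis using g by (metis inv_closed inv_equality inv_inv)
  qed
  define b where "b v = (SOME w. w \<in> verts Y \<and> pV w = v)" for v
  have b: "b v \<in> verts Y" "pV (b v) = v" if "v \<in> verts X" for v
    using someI_ex[OF V_ex[OF that]] by (auto simp: b_def)
  have K_ex: "\<exists>k. k \<in> halfs Y \<and> pH k = h \<and> rt Y k = b (rt X h)" if h: "h \<in> halfs X" for h
  proof -
    obtain k where k: "k \<in> halfs Y" "pH k = h" using H_ex[OF h] by blast
    obtain g where g: "g \<in> carrier G" "\<phi>V g (rt Y k) = b (rt X h)"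
      using V_trans[of "rt Y k" "b (rt X h)"] b[OF cod.rt_closed[OF h]] k dom.rt_closed rt_commute by auto
    show ?thesis using k g H_cl act_rt pH_invariant by (intro exI[of _ "\<phi>H g k"]) auto
  qed
  define K where "K h = (SOME k. k \<in> halfs Y \<and> pH k = h \<and> rt Y k = b (rt X h))" for h
  have K: "K h \<in> halfs Y" "pH (K h) = h" "rt Y (K h) = b (rt X h)" if "h \<in> halfs X" for h
    using someI_ex[OF K_ex[OF that]] by (auto simp: K_def)
  have ori_h: "ori e \<in> halfs X" if "e \<in> edges X" for e
    using that ori cod.flip_closed by (auto simp: orientation_def edges_def edge_of_def)
  have l_ex: "\<exists>g. g \<in> carrier G \<and> \<phi>V g (b (target X ori e)) = rt Y (flip Y (K (ori e)))"
    if e: "e \<in> edges X" for e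
  proof -
    have h: "ori e \<in> halfs X" by (rule ori_h[OF e])
    show ?thesis
      using V_trans[of "b (target X ori e)" "rt Y (flip Y (K (ori e)))"]
        b[OF cod.rt_closed[OF cod.flip_closed[OF h]]] K[OF h]
        dom.rt_closed dom.flip_closed rt_commute flip_commute
      by (metis target_def)
  qed
  define l where "l e = (SOME g. g \<in> carrier G \<and> \<phi>V g (b (target X ori e)) = rt Y (flip Y (K (ori e))))" for e
  have l: "l e \<in> carrier G" "\<phi>V (l e) (b (target X ori e)) = rt Y (flip Y (K (ori e)))"
    if "e \<in> edges X" for e
    using someI_ex[OF l_ex[OF that]] by (auto simp: l_def)
  define M where "M h = (if h = ori (edge_of X h) then K h else flip Y (K (flip X h)))" for h
  have ori2: "flip X h = ori (edge_of X h)" if "h \<in> halfs X" "h \<noteq> ori (edge_of X h)" for h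
    using ori edX[OF that(1)] that by (auto simp: orientation_def edge_of_def)
  have M: "M h \<in> halfs Y" "pH (M h) = h" if h: "h \<in> halfs X" for h
    using K[OF h] K[OF cod.flip_closed[OF h]] dom.flip_closed flip_commute cod.flip_flip[OF h]
    by (auto simp: M_def) metis
  have M_flip: "flip Y (M h) = M (flip X h)" if h: "h \<in> halfs X" for h
  proof (cases "h = ori (edge_of X h)")
    case True
    moreover have "flip X h \<noteq> ori (edge_of X (flip X h))"
      using True cod.flip_neq[OF h] cod.edge_of_flip[OF h] by simp
    ultimately show ?thesis using cod.flip_flip[OF h] by (simp add: M_def)
  next
    case False
    thus ?thesis using ori2[OF h False] cod.edge_of_flip[OF h] dom.flip_flip[OF K(1)[OF cod.flip_closed[OF h]]]
      by (simp add: M_def)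
  qed
  have M_rt: "rt Y (M h) = (if h = ori (edge_of X h) then b (rt X h) else \<phi>V (l (edge_of X h)) (b (rt X h)))"
    if h: "h \<in> halfs X" for h
  proof (cases "h = ori (edge_of X h)")
    case True thus ?thesis using K[OF h] by (simp add: M_def)
  next
    case False
    have "target X ori (edge_of X h) = rt X h"
      using ori2[OF h False] cod.flip_flip[OF h] by (metis target_def)
    thus ?thesis using False l(2)[OF edX[OF h]] ori2[OF h False] by (simp add: M_def)
  qed
  define \<gamma> where "\<gamma> k = (SOME g. g \<in> carrier G \<and> \<phi>H g (M (pH k)) = k)" for k
  have \<gamma>: "\<gamma> k \<in> carrier G" "\<phi>H (\<gamma> k) (M (pH k)) = k" if k: "k \<in> halfs Y" for k
  proof -
    have "\<exists>g. g \<in> carrier G \<and> \<phi>H g (M (pH k)) = k"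
      using H_trans[of "M (pH k)" k] M[OF half_closed[OF k]] k by auto
    from someI_ex[OF this] show "\<gamma> k \<in> carrier G" "\<phi>H (\<gamma> k) (M (pH k)) = k" by (auto simp: \<gamma>_def)
  qed
  have \<gamma>_eq: "\<gamma> (\<phi>H g (M h)) = g" if g: "g \<in> carrier G" and h: "h \<in> halfs X" for g h
  proof -
    have "pH (\<phi>H g (M h)) = h" using pH_invariant[OF g M(1)[OF h]] M(2)[OF h] by simp
    thus ?thesis using \<gamma>[OF H_cl[OF g M(1)[OF h]]] H_free'[OF _ g M(1)[OF h]] by simp
  qed
  define iV where "iV w = (pV w, {g \<in> carrier G. \<phi>V g (b (pV w)) = w})" for w
  define iH where "iH k = (pH k, \<gamma> k)" for k
  have iV_eq: "iV (\<phi>V g (b v)) = (v, D v #>\<^bsub>G\<^esub> g)" if g: "g \<in> carrier G" and v: "v \<in> verts X" for g v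
    using coset[OF b(1)[OF v] g] b[OF v] pV_invariant[OF g b(1)[OF v]] by (simp add: iV_def)
  have Y_rep: "\<exists>g \<in> carrier G. w = \<phi>V g (b (pV w))" if w: "w \<in> verts Y" for w
    using V_trans[of "b (pV w)" w] b[OF vert_closed[OF w]] w by metis
  let ?C = "voltage_cover G X ori D l"
  define \<eta> where "\<eta> e = (D (source X ori e) <#>\<^bsub>G\<^esub> D (target X ori e)) #>\<^bsub>G\<^esub> l e" for e
  have sm: "subgroup (D (source X ori e) <#>\<^bsub>G\<^esub> D (target X ori e)) G" if e: "e \<in> edges X" for e
  proof -
    have "source X ori e \<in> verts X" "target X ori e \<in> verts X"
      using ori_h[OF e] cod.rt_closed cod.flip_closed by (auto simp: source_def target_def)
    thus ?thesis using sub_D mult_subgroups by blast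
  qed
  have "voltage_assignment G X ori D \<eta>"
    using l(1) by (auto simp: voltage_assignment_def FactGroup_def RCOSETS_def \<eta>_def)
  moreover have "\<forall>e \<in> edges X. l e \<in> \<eta> e"
    using sm l(1) rcos_self by (auto simp: \<eta>_def)
  moreover have "hgraph ?C"
  proof
    have "finite (carrier (G Mod D v))" for v
      using fin by (auto simp: FactGroup_def RCOSETS_def)
    thus "finite (verts ?C)" using cod.finite_verts by (auto simp: voltage_cover_def)
    show "finite (halfs ?C)" using fin cod.finite_halfs by (auto simp: voltage_cover_def)
    fix h assume h: "h \<in> halfs ?C"
    show "flip ?C h \<in> halfs ?C" "flip ?C (flip ?C h) = h" "flip ?C h \<noteq> h"
      using h cod.flip_closed cod.flip_flip cod.flip_neq by (auto simp: voltage_cover_def)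
    show "rt ?C h \<in> verts ?C"
      using h cod.rt_closed m_closed[OF _ l(1)[OF edX]]
      by (auto simp: voltage_cover_def FactGroup_def RCOSETS_def) blast+
  qed
  moreover have bV: "bij_betw iV (verts Y) (verts ?C)"
  proof (rule bij_betw_imageI)
    show "inj_on iV (verts Y)"
    proof (rule inj_onI)
      fix w w' assume w: "w \<in> verts Y" "w' \<in> verts Y" "iV w = iV w'"
      obtain g where g: "g \<in> carrier G" "w = \<phi>V g (b (pV w))" using Y_rep[OF w(1)] by blast
      hence "g \<in> snd (iV w)" by (simp add: iV_def)
      hence "g \<in> snd (iV w')" using w by simp
      thus "w = w'" using g w by (simp add: iV_def)
    qed
    show "iV ` verts Y = verts ?C"
    proof
      show "iV ` verts Y \<subseteq> verts ?C"
      proof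
        fix y assume "y \<in> iV ` verts Y"
        then obtain w where w: "w \<in> verts Y" "y = iV w" by blast
        obtain g where g: "g \<in> carrier G" "w = \<phi>V g (b (pV w))" using Y_rep[OF w(1)] by blast
        have "y = (pV w, D (pV w) #>\<^bsub>G\<^esub> g)" using iV_eq[OF g(1) vert_closed[OF w(1)]] g w by simp
        thus "y \<in> verts ?C" using g vert_closed[OF w(1)]
          by (auto simp: voltage_cover_def FactGroup_def RCOSETS_def)
      qed
      show "verts ?C \<subseteq> iV ` verts Y"
      proof
        fix y assume "y \<in> verts ?C"
        then obtain v g where y: "v \<in> verts X" "g \<in> carrier G" "y = (v, D v #>\<^bsub>G\<^esub> g)"
          by (auto simp: voltage_cover_def FactGroup_def RCOSETS_def)
        thus "y \<in> iV ` verts Y" using iV_eq[OF y(2,1)] V_cl[OF y(2) b(1)[OF y(1)]] by force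
      qed
    qed
  qed
  moreover have bH: "bij_betw iH (halfs Y) (halfs ?C)"
  proof (rule bij_betw_imageI)
    show "inj_on iH (halfs Y)" using \<gamma>(2) by (auto simp: iH_def inj_on_def) metis
    show "iH ` halfs Y = halfs ?C"
    proof
      show "iH ` halfs Y \<subseteq> halfs ?C" using half_closed \<gamma>(1) by (auto simp: iH_def voltage_cover_def)
      show "halfs ?C \<subseteq> iH ` halfs Y"
      proof
        fix y assume "y \<in> halfs ?C"
        then obtain h g where y: "h \<in> halfs X" "g \<in> carrier G" "y = (h, g)"
          by (auto simp: voltage_cover_def)
        have "y = iH (\<phi>H g (M h))" using y \<gamma>_eq pH_invariant M by (simp add: iH_def)
        thus "y \<in> iH ` halfs Y" using H_cl M y by blast
      qed
    qed
  qed
  moreover have "hgraph_morphism_axioms Y ?C iV iH"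
  proof
    show "iV w \<in> verts ?C" if "w \<in> verts Y" for w using bV that by (auto simp: bij_betw_def)
    show "iH k \<in> halfs ?C" if "k \<in> halfs Y" for k using bH that by (auto simp: bij_betw_def)
    fix k assume k: "k \<in> halfs Y"
    define h where "h = pH k"
    define g where "g = \<gamma> k"
    have h: "h \<in> halfs X" using half_closed[OF k] by (simp add: h_def)
    have g: "g \<in> carrier G" "k = \<phi>H g (M h)" using \<gamma>[OF k] by (simp_all add: g_def h_def)
    have i: "iH k = (h, g)" by (simp add: iH_def h_def g_def)
    have v: "rt X h \<in> verts X" by (rule cod.rt_closed[OF h])
    have le: "l (edge_of X h) \<in> carrier G" by (rule l(1)[OF edX[OF h]])
    have r: "rt Y k = \<phi>V g (rt Y (M h))" using g act_rt M[OF h] by simp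
    show "rt ?C (iH k) = iV (rt Y k)"
      using i r M_rt[OF h] iV_eq[OF g(1) v] iV_eq[OF m_closed[OF g(1) le] v]
        V_comp[OF g(1) le b(1)[OF v]]
      by (simp add: voltage_cover_def)
    have "flip Y k = \<phi>H g (M (flip X h))" using g act_flip M[OF h] M_flip[OF h] by simp
    hence "iH (flip Y k) = (flip X h, g)"
      using \<gamma>_eq[OF g(1) cod.flip_closed[OF h]] flip_commute[OF k] by (simp add: iH_def h_def)
    thus "flip ?C (iH k) = iH (flip Y k)" using i by (simp add: voltage_cover_def)
  qed
  moreover have "\<forall>g \<in> carrier G. \<forall>w \<in> verts Y. snd (iV (\<phi>V g w)) = g <#\<^bsub>G\<^esub> snd (iV w)"
  proof (intro ballI)
    fix g w assume g: "g \<in> carrier G" and w: "w \<in> verts Y"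
    obtain x where x: "x \<in> carrier G" "w = \<phi>V x (b (pV w))" using Y_rep[OF w] by blast
    have v: "pV w \<in> verts X" by (rule vert_closed[OF w])
    have "\<phi>V g w = \<phi>V (g \<otimes>\<^bsub>G\<^esub> x) (b (pV w))" using V_comp[OF g x(1) b(1)[OF v]] x by simp
    hence "snd (iV (\<phi>V g w)) = D (pV w) #>\<^bsub>G\<^esub> (g \<otimes>\<^bsub>G\<^esub> x)"
      using iV_eq[OF m_closed[OF g x(1)] v] by simp
    also have "\<dots> = g <#\<^bsub>G\<^esub> (D (pV w) #>\<^bsub>G\<^esub> x)"
      using g x(1) subgroup.mem_carrier[OF sub_D[OF v]]
      by (auto simp: r_coset_def l_coset_def m_lcomm)
    also have "\<dots> = g <#\<^bsub>G\<^esub> snd (iV w)" using iV_eq[OF x(1) v] x(2) by simp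
    finally show "snd (iV (\<phi>V g w)) = g <#\<^bsub>G\<^esub> snd (iV w)" .
  qed
  moreover have "\<forall>g \<in> carrier G. \<forall>k \<in> halfs Y. snd (iH (\<phi>H g k)) = g \<otimes>\<^bsub>G\<^esub> snd (iH k)"
  proof (intro ballI)
    fix g k assume g: "g \<in> carrier G" and k: "k \<in> halfs Y"
    have h: "pH k \<in> halfs X" by (rule half_closed[OF k])
    have "\<phi>H g k = \<phi>H (g \<otimes>\<^bsub>G\<^esub> \<gamma> k) (M (pH k))"
      using H_comp[OF g \<gamma>(1)[OF k] M(1)[OF h]] \<gamma>(2)[OF k] by simp
    thus "snd (iH (\<phi>H g k)) = g \<otimes>\<^bsub>G\<^esub> snd (iH k)"
      using \<gamma>_eq[OF m_closed[OF g \<gamma>(1)[OF k]] h] by (simp add: iH_def)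
  qed
  moreover have "hgraph Y" by unfold_locales
  ultimately have "voltage_of_cover G Y X pV pH \<phi>V \<phi>H ori \<eta>"
    unfolding voltage_of_cover_def Let_def D_def[symmetric]
    by (intro conjI exI[of _ l] exI[of _ iV] exI[of _ iH])
       (auto simp: hgraph_morphism_def iV_def iH_def)
  thus ?thesis by blast
qed


section \<open>Characters\<close>

definition Cstar :: "complex monoid" where
  "Cstar = \<lparr>carrier = UNIV - {0}, mult = (*), one = 1\<rparr>"

text \<open>
  Characters are undefined off the carrier, so that distinct elements of this set are distinct
  characters.
\<close>

definition characters :: "('g, 'b) monoid_scheme \<Rightarrow> ('g \<Rightarrow> complex) set" where
  "characters G = hom G Cstar \<inter> extensional (carrier G)"

definition nontrivial_characters :: "('g, 'b) monoid_scheme \<Rightarrow> ('g \<Rightarrow> complex) set" where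
  "nontrivial_characters G = {\<rho> \<in> characters G. \<exists>g \<in> carrier G. \<rho> g \<noteq> 1}"


section \<open>The matroid and its weight\<close>

definition half_voltage ::
  "('g, 'b) monoid_scheme \<Rightarrow> ('v, 'h) hgraph \<Rightarrow> ('h set \<Rightarrow> 'h) \<Rightarrow> ('h set \<Rightarrow> 'g set)
     \<Rightarrow> 'h \<Rightarrow> 'g set" where
  "half_voltage G X ori \<eta> h =
     (if h = ori (edge_of X h) then \<eta> (edge_of X h) else set_inv\<^bsub>G\<^esub> (\<eta> (edge_of X h)))"

definition walk_voltage ::
  "('g, 'b) monoid_scheme \<Rightarrow> ('v, 'h) hgraph \<Rightarrow> ('h set \<Rightarrow> 'h) \<Rightarrow> ('h set \<Rightarrow> 'g set)
     \<Rightarrow> 'h list \<Rightarrow> 'g set" where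
  "walk_voltage G X ori \<eta> c =
     foldr (\<lambda>h S. half_voltage G X ori \<eta> h <#>\<^bsub>G\<^esub> S) c {\<one>\<^bsub>G\<^esub>}"

text \<open>
  The value \<open>\<rho>(\<eta>(C))\<close> for a connected graph \<open>C\<close> of genus one on all of whose dilation groups \<open>\<rho>\<close> is
  trivial: \<open>\<rho>\<close> is then constant on the coset \<open>\<eta>(C)\<close>.  The cycle of \<open>C\<close> is unique up to its starting
  point and direction, so the value is determined up to inversion.
\<close>

definition cycle_value ::
  "('g, 'b) monoid_scheme \<Rightarrow> ('h set \<Rightarrow> 'h) \<Rightarrow> ('h set \<Rightarrow> 'g set) \<Rightarrow> ('g \<Rightarrow> complex)
     \<Rightarrow> ('v, 'h) hgraph \<Rightarrow> complex" where
  "cycle_value G ori \<eta> \<rho> C = the_elem (\<rho> ` walk_voltage G C ori \<eta> (SOME c. is_cycle C c))"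

definition unicyclic_type ::
  "('g, 'b) monoid_scheme \<Rightarrow> ('h set \<Rightarrow> 'h) \<Rightarrow> ('v \<Rightarrow> 'g set) \<Rightarrow> ('h set \<Rightarrow> 'g set)
     \<Rightarrow> ('g \<Rightarrow> complex) \<Rightarrow> ('v, 'h) hgraph \<Rightarrow> bool" where
  "unicyclic_type G ori D \<eta> \<rho> C \<longleftrightarrow>
     genus C = 1 \<and> (\<forall>v \<in> verts C. \<rho> ` D v = {1}) \<and> cycle_value G ori \<eta> \<rho> C \<noteq> 1"

definition tree_type ::
  "('v \<Rightarrow> 'g set) \<Rightarrow> ('g \<Rightarrow> complex) \<Rightarrow> ('v, 'h) hgraph \<Rightarrow> bool" where
  "tree_type D \<rho> C \<longleftrightarrow> is_tree C \<and> (\<exists>!v. v \<in> verts C \<and> \<rho> ` D v \<noteq> {1})"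

definition matroid_bases ::
  "('g, 'b) monoid_scheme \<Rightarrow> ('v, 'h) hgraph \<Rightarrow> ('h set \<Rightarrow> 'h) \<Rightarrow> ('v \<Rightarrow> 'g set)
     \<Rightarrow> ('h set \<Rightarrow> 'g set) \<Rightarrow> ('g \<Rightarrow> complex) \<Rightarrow> 'h set set set" where
  "matroid_bases G X ori D \<eta> \<rho> =
     {F. F \<subseteq> edges X \<and>
         (\<forall>C \<in> components (delete_edges X F). unicyclic_type G ori D \<eta> \<rho> C \<or> tree_type D \<rho> C)}"

definition component_weight ::
  "('g, 'b) monoid_scheme \<Rightarrow> ('h set \<Rightarrow> 'h) \<Rightarrow> ('v \<Rightarrow> 'g set) \<Rightarrow> ('h set \<Rightarrow> 'g set)
     \<Rightarrow> ('g \<Rightarrow> complex) \<Rightarrow> ('v, 'h) hgraph \<Rightarrow> real" where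
  "component_weight G ori D \<eta> \<rho> C =
     (if unicyclic_type G ori D \<eta> \<rho> C then (cmod (1 - cycle_value G ori \<eta> \<rho> C))\<^sup>2 else 1)"

definition basis_weight ::
  "('g, 'b) monoid_scheme \<Rightarrow> ('v, 'h) hgraph \<Rightarrow> ('h set \<Rightarrow> 'h) \<Rightarrow> ('v \<Rightarrow> 'g set)
     \<Rightarrow> ('h set \<Rightarrow> 'g set) \<Rightarrow> ('g \<Rightarrow> complex) \<Rightarrow> 'h set set \<Rightarrow> real" where
  "basis_weight G X ori D \<eta> \<rho> F =
     (\<Prod>C \<in> components (delete_edges X F). component_weight G ori D \<eta> \<rho> C)"

definition matroid_weight ::
  "('g, 'b) monoid_scheme \<Rightarrow> ('v, 'h) hgraph \<Rightarrow> ('h set \<Rightarrow> 'h) \<Rightarrow> ('v \<Rightarrow> 'g set)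
     \<Rightarrow> ('h set \<Rightarrow> 'g set) \<Rightarrow> ('g \<Rightarrow> complex) \<Rightarrow> real" where
  "matroid_weight G X ori D \<eta> \<rho> =
     (\<Sum>F \<in> matroid_bases G X ori D \<eta> \<rho>. basis_weight G X ori D \<eta> \<rho> F)"

end

(*
  Both |Jac| and the number of spanning trees of a connected graph equal the reduced determinant of
  its Laplacian: the first because the index of the lattice spanned by the columns of an integer
  matrix is the absolute value of its determinant, the second by Cauchy-Binet.  The same Cauchy-Binet
  expansion, applied to the Laplacian twisted by the voltages rho(eta) and restricted to the vertices
  where rho is trivial on the dilation group, yields the weight of the matroid of rho.

  Let L be the Laplacian of the cover.  Perturbing L by the G-invariant rank one matrix whose row at a
  vertex over v is constantly |D(v)| makes it nonsingular: the determinant becomes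
  N |V(X)| |V(cover)| |Jac(cover)|.  In the Fourier basis the perturbed matrix is block diagonal with
  one block for each character rho, namely the twisted Laplacian of rho with the row of v scaled by
  |D(v)|; only the block of the trivial character is affected by the perturbation, and its determinant
  is |V(X)| |V(cover)| |Jac(X)| times the scaling factors.  Since exactly N / |D(v)| characters are
  trivial on D(v), the scaling factors multiply to the product of |D(v)|^(N / |D(v)|).
*)
theory Submission
  imports Defs "HOL-Algebra.Multiplicative_Group" "HOL-Combinatorics.Permutations"
begin

section \<open>Determinants indexed by finite sets\<close>

text \<open>The perturbation answers a conflict between two ways of discarding the kernel of L.
  Deleting a vertex, as in the matrix-tree theorem, destroys the G-symmetry; the full determinant
  respects it but vanishes. An invariant rank one matrix keeps the symmetry, and because rows and
  columns of L sum to zero, the determinant of L + a b^T is (sum of a)(sum of b) times the minor at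
  any vertex. Taking a = |D(v)| serves both sides. There are N/|D(v)| vertices over v, so each fibre
  contributes exactly N to the sum of a. And |D(v)| is also the number of half-edges over a given
  half-edge at v that share a root, hence the row factor of every Fourier block, so that after
  scaling the trivial block is again a Laplacian with a rank one update. Cancelling |V(X)|
  |V(cover)| leaves the single N behind the factor 1/N. Vertices (v, coset) and frequencies (v,
  \<rho>) with \<rho> trivial on D(v) are equinumerous but of different types, and the deleted
  vertices depend on \<rho>; hence determinants are indexed by arbitrary finite sets, without a
  numbering.\<close>

definition sdet :: "'a set \<Rightarrow> ('a \<Rightarrow> 'a \<Rightarrow> 'c::comm_ring_1) \<Rightarrow> 'c" where
  "sdet U A = (\<Sum>p | p permutes U. of_int (sign p) * (\<Prod>i\<in>U. A i (p i)))"

lemma sdet_cong: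
  assumes "U = W" "\<And>i j. i \<in> W \<Longrightarrow> j \<in> W \<Longrightarrow> A i j = B i j"
  shows "sdet U A = sdet W B"
  unfolding sdet_def using assms
  by (intro sum.cong arg_cong2[of _ _ _ _ "(*)"] prod.cong) (auto simp: permutes_in_image)

lemma sdet_empty [simp]: "sdet {} A = 1"
  by (simp add: sdet_def)

lemma sdet_of_int: "sdet U (\<lambda>i j. of_int (A i j)) = of_int (sdet U A)"
  by (simp add: sdet_def)

text \<open>Conjugation by \<open>f\<close> matches the permutations of \<open>U\<close> with those
  of \<open>W\<close> and keeps signs. The two index types may differ, which lets frequencies
  replace the vertices of the cover.\<close>

lemma sdet_reindex:
  assumes f: "bij_betw f U W" and fin: "finite U"
  shows "sdet W A = sdet U (\<lambda>i j. A (f i) (f j))"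
proof -
  have inj: "inj_on f U" and W: "f ` U = W" using f by (auto simp: bij_betw_def)
  define g where "g = inv_into U f"
  have g: "bij_betw g W U" unfolding g_def by (rule bij_betw_inv_into[OF f])
  have bij: "bij_betw (map_permutation U f) {p. p permutes U} {p. p permutes W}"
  proof (rule bij_betw_byWitness[where f' = "map_permutation W g"])
    show "\<forall>p\<in>{p. p permutes U}. map_permutation W g (map_permutation U f p) = p"
      using map_permutation_compose_inv[OF f] by (auto simp: g_def inj)
    show "\<forall>p\<in>{p. p permutes W}. map_permutation U f (map_permutation W g p) = p"
      using map_permutation_compose_inv[OF g] f_inv_into_f[of _ f U] W by (auto simp: g_def)
  qed (auto intro!: map_permutation_permutes f g)
  have "sdet W A = (\<Sum>p | p permutes U. of_int (sign (map_permutation U f p)) *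
          (\<Prod>i\<in>W. A i (map_permutation U f p i)))"
    unfolding sdet_def by (rule sum.reindex_bij_betw[OF bij, symmetric])
  also have "\<dots> = sdet U (\<lambda>i j. A (f i) (f j))"
    unfolding sdet_def
  proof (rule sum.cong)
    fix p assume "p \<in> {p. p permutes U}"
    hence p: "p permutes U" by simp
    have "(\<Prod>i\<in>W. A i (map_permutation U f p i)) = (\<Prod>i\<in>U. A (f i) (map_permutation U f p (f i)))"
      by (rule prod.reindex_bij_betw[OF f, symmetric])
    also have "\<dots> = (\<Prod>i\<in>U. A (f i) (f (p i)))"
      by (intro prod.cong refl) (simp add: map_permutation_apply inj)
    finally show "of_int (sign (map_permutation U f p)) * (\<Prod>i\<in>W. A i (map_permutation U f p i)) =
        of_int (sign p) * (\<Prod>i\<in>U. A (f i) (f (p i)))"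
      using sign_map_permutation[OF inj p fin] by simp
  qed simp
  finally show ?thesis .
qed

section \<open>Row and column operations\<close>

lemma sdet_permute_rows:
  assumes p: "p permutes U" and fin: "finite U"
  shows "sdet U (\<lambda>i. A (p i)) = of_int (sign p) * sdet U A"
proof -
  have pp: "permutation p" using p fin permutation_permutes by blast
  have "sdet U (\<lambda>i. A (p i)) = (\<Sum>q | q permutes U. of_int (sign (q \<circ> p)) * (\<Prod>i\<in>U. A (p i) (q (p i))))"
    unfolding sdet_def
    by (subst sum_permutations_compose_right[OF p]) (simp add: o_def)
  also have "\<dots> = (\<Sum>q | q permutes U. of_int (sign p) * (of_int (sign q) * (\<Prod>i\<in>U. A i (q i))))"
  proof (rule sum.cong)
    fix q assume "q \<in> {q. q permutes U}"
    hence q: "permutation q" using fin permutation_permutes by blast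
    have "(\<Prod>i\<in>U. A (p i) (q (p i))) = (\<Prod>i\<in>U. A i (q i))"
      by (rule prod.reindex_bij_betw[OF permutes_imp_bij[OF p]])
    thus "of_int (sign (q \<circ> p)) * (\<Prod>i\<in>U. A (p i) (q (p i))) =
        of_int (sign p) * (of_int (sign q) * (\<Prod>i\<in>U. A i (q i)))"
      using sign_compose[OF q pp] by simp
  qed simp
  finally show ?thesis by (simp add: sdet_def sum_distrib_left)
qed

lemma sdet_transpose:
  assumes fin: "finite U"
  shows "sdet U (\<lambda>i j. A j i) = sdet U A"
proof -
  have "sdet U (\<lambda>i j. A j i) = (\<Sum>p | p permutes U. of_int (sign (inv_into UNIV p)) * (\<Prod>i\<in>U. A (inv_into UNIV p i) i))"
    unfolding sdet_def by (rule sum_permutations_inverse)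
  also have "\<dots> = sdet U A"
    unfolding sdet_def
  proof (rule sum.cong)
    fix p assume "p \<in> {p. p permutes U}"
    hence p: "p permutes U" by simp
    have "(\<Prod>i\<in>U. A (inv_into UNIV p i) i) = (\<Prod>i\<in>U. A (inv_into UNIV p (p i)) (p i))"
      by (rule prod.reindex_bij_betw[OF permutes_imp_bij[OF p], symmetric])
    also have "\<dots> = (\<Prod>i\<in>U. A i (p i))" by (simp add: permutes_inverses[OF p])
    finally show "of_int (sign (inv_into UNIV p)) * (\<Prod>i\<in>U. A (inv_into UNIV p i) i) = of_int (sign p) * (\<Prod>i\<in>U. A i (p i))"
      using sign_inverse p fin permutation_permutes by metis
  qed simp
  finally show ?thesis .
qed

text \<open>Swapping rows \<open>a\<close> and \<open>b\<close> changes nothing, yet negates the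
  determinant; characteristic zero allows division by 2.\<close>

lemma sdet_equal_rows:
  fixes A :: "'a \<Rightarrow> 'a \<Rightarrow> 'c::{idom,ring_char_0}"
  assumes fin: "finite U" and ab: "a \<in> U" "b \<in> U" "a \<noteq> b" and eq: "\<And>j. j \<in> U \<Longrightarrow> A a j = A b j"
  shows "sdet U A = 0"
proof -
  let ?t = "Transposition.transpose a b"
  have "sdet U A = sdet U (\<lambda>i. A (?t i))"
    by (rule sdet_cong) (auto simp: Transposition.transpose_def eq)
  also have "\<dots> = - sdet U A"
    using sdet_permute_rows[OF permutes_swap_id[OF ab(1,2)] fin, of A] ab(3) by (simp add: sign_swap_id)
  finally have "2 * sdet U A = 0" by (metis add.right_inverse mult_2)
  thus ?thesis by simp
qed

lemma sdet_scale_rows: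
  "sdet U (\<lambda>i j. c i * A i j) = (\<Prod>i\<in>U. c i) * sdet U A"
  by (simp add: sdet_def prod.distrib sum_distrib_left mult_ac)

text \<open>By linearity in row \<open>q\<close>, the term that puts row \<open>k\<close> there has
  two equal rows unless \<open>k = q\<close>. With \<open>c q = 1\<close> this is an elementary row
  operation; other values of \<open>c q\<close> accommodate the coefficients of a gauge
  function.\<close>

lemma sdet_combine_row:
  fixes A :: "'a \<Rightarrow> 'a \<Rightarrow> 'c::{idom,ring_char_0}"
  assumes fin: "finite U" and q: "q \<in> U"
  shows "sdet U (\<lambda>i j. if i = q then \<Sum>k\<in>U. c k * A k j else A i j) = c q * sdet U A"
proof -
  have "sdet U (\<lambda>i j. if i = q then \<Sum>k\<in>U. c k * A k j else A i j) =
      (\<Sum>p | p permutes U. \<Sum>k\<in>U. c k * (of_int (sign p) * (A k (p q) * (\<Prod>i\<in>U-{q}. A i (p i)))))"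
    unfolding sdet_def
    by (intro sum.cong refl) (simp add: prod.remove[OF fin q] sum_distrib_left sum_distrib_right mult_ac)
  also have "\<dots> = (\<Sum>k\<in>U. c k * sdet U (\<lambda>i. if i = q then A k else A i))"
    by (subst sum.swap) (simp add: sdet_def prod.remove[OF fin q] sum_distrib_left)
  also have "\<dots> = (\<Sum>k\<in>U. if k = q then c q * sdet U A else 0)"
  proof (rule sum.cong)
    fix k assume k: "k \<in> U"
    show "c k * sdet U (\<lambda>i. if i = q then A k else A i) = (if k = q then c q * sdet U A else 0)"
    proof (cases "k = q")
      case True
      have "sdet U (\<lambda>i. if i = q then A k else A i) = sdet U A"
        using True by (intro sdet_cong) auto
      thus ?thesis using True by simp
    next
      case False
      have "sdet U (\<lambda>i. if i = q then A k else A i) = 0"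
        by (rule sdet_equal_rows[OF fin q k]) (use False in auto)
      thus ?thesis using False by simp
    qed
  qed simp
  also have "\<dots> = c q * sdet U A" using fin q by simp
  finally show ?thesis .
qed

lemma sdet_combine_column:
  fixes A :: "'a \<Rightarrow> 'a \<Rightarrow> 'c::{idom,ring_char_0}"
  assumes fin: "finite U" and q: "q \<in> U"
  shows "sdet U (\<lambda>i j. if j = q then \<Sum>k\<in>U. c k * A i k else A i j) = c q * sdet U A"
proof -
  have "sdet U (\<lambda>i j. if j = q then \<Sum>k\<in>U. c k * A i k else A i j) =
      sdet U (\<lambda>i j. if i = q then \<Sum>k\<in>U. c k * A j k else A j i)"
    by (rule sdet_transpose[OF fin])
  also have "\<dots> = c q * sdet U (\<lambda>i j. A j i)"
    by (rule sdet_combine_row[OF fin q, where A = "\<lambda>i j. A j i"])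
  also have "\<dots> = c q * sdet U A" by (simp only: sdet_transpose[OF fin, of A])
  finally show ?thesis .
qed

text \<open>\<open>r\<close> replaces an ordering of \<open>U\<close>. A permutation with nonzero
  product can only raise \<open>r\<close>, strictly at every moved point, yet it preserves the total
  of \<open>r\<close> over \<open>U\<close>; so it moves nothing.\<close>

lemma sdet_triangular:
  fixes r :: "'a \<Rightarrow> nat"
  assumes fin: "finite U"
    and tri: "\<And>i j. i \<in> U \<Longrightarrow> j \<in> U \<Longrightarrow> i \<noteq> j \<Longrightarrow> \<not> r i < r j \<Longrightarrow> A i j = 0"
  shows "sdet U A = (\<Prod>i\<in>U. A i i)"
proof -
  have "(\<Prod>i\<in>U. A i (p i)) = 0" if p: "p permutes U" "p \<noteq> id" for p
  proof (rule ccontr)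
    assume "\<not> ?thesis"
    hence nz: "A i (p i) \<noteq> 0" if "i \<in> U" for i
      using prod_zero[of U "\<lambda>i. A i (p i)"] fin that by blast
    have pU: "p i \<in> U" if "i \<in> U" for i using permutes_in_image[OF p(1)] that by simp
    have le: "r i \<le> r (p i)" if "i \<in> U" for i
      using nz[OF that] tri[OF that pU[OF that]] by (cases "i = p i") (auto intro: less_imp_le)
    obtain a where a: "p a \<noteq> a" using p(2) by (auto simp: fun_eq_iff)
    hence aU: "a \<in> U" using permutes_not_in[OF p(1)] by blast
    have "r a < r (p a)" using nz[OF aU] tri[OF aU pU[OF aU]] a by metis
    hence "(\<Sum>i\<in>U. r i) < (\<Sum>i\<in>U. r (p i))"
      using le aU fin by (intro sum_strict_mono_ex1) auto
    moreover have "(\<Sum>i\<in>U. r (p i)) = (\<Sum>i\<in>U. r i)"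
      by (rule sum.reindex_bij_betw[OF permutes_imp_bij[OF p(1)]])
    ultimately show False by simp
  qed
  hence "sdet U A = (\<Sum>p | p permutes U. if p = id then \<Prod>i\<in>U. A i i else 0)"
    unfolding sdet_def by (intro sum.cong) auto
  also have "\<dots> = (\<Prod>i\<in>U. A i i)"
    using finite_permutations[OF fin] by (simp add: sum.delta permutes_id)
  finally show ?thesis .
qed

text \<open>A permutation sending some point of \<open>U1\<close> into \<open>U2\<close> meets a
  zero entry. By finiteness the others preserve both blocks, and they are the composites of one
  permutation of each.\<close>

lemma sdet_block:
  assumes fin: "finite U1" "finite U2" and disj: "U1 \<inter> U2 = {}"
    and zero: "\<And>i j. i \<in> U1 \<Longrightarrow> j \<in> U2 \<Longrightarrow> A i j = 0"
  shows "sdet (U1 \<union> U2) A = sdet U1 A * sdet U2 A"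
proof -
  let ?P1 = "{p. p permutes U1}" and ?P2 = "{p. p permutes U2}"
  let ?P = "{p. p permutes (U1 \<union> U2)}" and ?Q = "{p. p permutes (U1 \<union> U2) \<and> p ` U1 \<subseteq> U1}"
  have fin': "finite (U1 \<union> U2)" using fin by simp
  have zero': "(\<Prod>i\<in>U1 \<union> U2. A i (p i)) = 0" if p: "p \<in> ?P - ?Q" for p
  proof -
    obtain i where i: "i \<in> U1" "p i \<notin> U1" using p by blast
    hence "p i \<in> U2" using p permutes_in_image[of p "U1 \<union> U2" i] by auto
    thus ?thesis using zero[OF i(1)] i(1) fin' by (intro prod_zero) auto
  qed
  have bij: "bij_betw (\<lambda>(p, q). p \<circ> q) (?P1 \<times> ?P2) ?Q"
  proof (rule bij_betw_byWitness[where f' = "\<lambda>p. (restrict_id p U1, restrict_id p U2)"])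
    have "restrict_id (p \<circ> q) U1 = p" "restrict_id (p \<circ> q) U2 = q"
      if "p permutes U1" "q permutes U2" for p q
      using that disj permutes_in_image[of q U2] permutes_not_in[of p U1] permutes_not_in[of q U2]
      by (auto simp: fun_eq_iff restrict_id_def disjoint_iff)
    thus "\<forall>x\<in>?P1 \<times> ?P2. (\<lambda>p. (restrict_id p U1, restrict_id p U2)) (case x of (p, q) \<Rightarrow> p \<circ> q) = x"
      by auto
    have stable: "p ` U1 = U1" "p ` U2 = U2" if p: "p \<in> ?Q" for p
    proof -
      have inj: "inj_on p (U1 \<union> U2)" using p permutes_inj_on by blast
      have im: "p ` (U1 \<union> U2) = U1 \<union> U2" using p permutes_image by blast
      show 1: "p ` U1 = U1"
        using p fin(1) inj_on_subset[OF inj, of U1] by (intro card_subset_eq) (auto simp: card_image)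
      have "p ` U1 \<inter> p ` U2 = {}" using inj disj by (auto simp: inj_on_def disjoint_iff)
      moreover have "p ` U1 \<union> p ` U2 = U1 \<union> U2" using im by (simp only: image_Un)
      ultimately show "p ` U2 = U2" unfolding 1 using disj by blast
    qed
    show "\<forall>p\<in>?Q. (case (restrict_id p U1, restrict_id p U2) of (p, q) \<Rightarrow> p \<circ> q) = p"
    proof
      fix p assume p: "p \<in> ?Q"
      have "restrict_id p U1 (restrict_id p U2 x) = p x" for x
        using stable[OF p] disj p permutes_not_in[of p "U1 \<union> U2" x]
        by (auto simp: restrict_id_def disjoint_iff)
      thus "(case (restrict_id p U1, restrict_id p U2) of (p, q) \<Rightarrow> p \<circ> q) = p"
        by (simp add: fun_eq_iff)
    qed
    show "(\<lambda>(p, q). p \<circ> q) ` (?P1 \<times> ?P2) \<subseteq> ?Q"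
    proof clarify
      fix p q assume pq: "p permutes U1" "q permutes U2"
      have "p \<circ> q permutes U1 \<union> U2"
        using pq by (intro permutes_compose) (auto intro: permutes_subset)
      moreover have "p (q x) \<in> U1" if "x \<in> U1" for x
        using that pq disj permutes_not_in[OF pq(2)] permutes_in_image[OF pq(1)] by (metis disjoint_iff)
      ultimately show "p \<circ> q permutes U1 \<union> U2 \<and> (p \<circ> q) ` U1 \<subseteq> U1" by auto
    qed
    show "(\<lambda>p. (restrict_id p U1, restrict_id p U2)) ` ?Q \<subseteq> ?P1 \<times> ?P2"
    proof (rule image_subsetI)
      fix p assume "p \<in> ?Q"
      hence p: "p permutes U1 \<union> U2" "p ` U1 \<subseteq> U1" by auto
      hence "inj_on p U1" "inj_on p U2" using permutes_inj_on[OF p(1)] by (auto intro: inj_on_subset)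
      thus "(restrict_id p U1, restrict_id p U2) \<in> ?P1 \<times> ?P2"
        using stable[of p] p by (simp add: permutes_restrict_id bij_betw_def)
    qed
  qed
  have "sdet (U1 \<union> U2) A = (\<Sum>p\<in>?Q. of_int (sign p) * (\<Prod>i\<in>U1 \<union> U2. A i (p i)))"
    unfolding sdet_def using zero' finite_permutations[OF fin']
    by (intro sum.mono_neutral_right) auto
  also have "\<dots> = (\<Sum>(p, q)\<in>?P1 \<times> ?P2. of_int (sign (p \<circ> q)) * (\<Prod>i\<in>U1 \<union> U2. A i ((p \<circ> q) i)))"
    by (subst sum.reindex_bij_betw[OF bij, symmetric]) (simp add: case_prod_beta)
  also have "\<dots> = (\<Sum>(p, q)\<in>?P1 \<times> ?P2. (of_int (sign p) * (\<Prod>i\<in>U1. A i (p i))) *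
      (of_int (sign q) * (\<Prod>i\<in>U2. A i (q i))))"
  proof (rule sum.cong, simp, clarify)
    fix p q assume pq: "p permutes U1" "q permutes U2"
    have "sign (p \<circ> q) = sign p * sign q"
      using pq fin permutation_permutes by (intro sign_compose) blast+
    moreover have "(\<Prod>i\<in>U1 \<union> U2. A i ((p \<circ> q) i)) = (\<Prod>i\<in>U1. A i (p i)) * (\<Prod>i\<in>U2. A i (q i))"
    proof -
      have "(p \<circ> q) i = p i" if "i \<in> U1" for i
        using that disj permutes_not_in[OF pq(2)] by (auto simp: disjoint_iff)
      moreover have "(p \<circ> q) i = q i" if "i \<in> U2" for i
        using that disj permutes_not_in[OF pq(1)] permutes_in_image[OF pq(2)] by (auto simp: disjoint_iff)
      ultimately show ?thesis by (simp add: prod.union_disjoint[OF fin disj] cong: prod.cong)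
    qed
    ultimately show "of_int (sign (p \<circ> q)) * (\<Prod>i\<in>U1 \<union> U2. A i ((p \<circ> q) i)) =
      (of_int (sign p) * (\<Prod>i\<in>U1. A i (p i))) * (of_int (sign q) * (\<Prod>i\<in>U2. A i (q i)))"
      by (simp add: mult_ac)
  qed
  also have "\<dots> = sdet U1 A * sdet U2 A"
    unfolding sdet_def by (subst sum_product, subst sum.cartesian_product) simp
  finally show ?thesis .
qed

text \<open>One colour class is split off at a time; a colour that \<open>f\<close> misses
  contributes the empty determinant 1.\<close>

lemma sdet_blocks:
  assumes fin: "finite U" "finite I" and f: "f ` U \<subseteq> I"
    and zero: "\<And>i j. i \<in> U \<Longrightarrow> j \<in> U \<Longrightarrow> f i \<noteq> f j \<Longrightarrow> A i j = 0"
  shows "sdet U A = (\<Prod>c\<in>I. sdet {i \<in> U. f i = c} A)"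
  using fin(2,1) f zero
proof (induction I arbitrary: U rule: finite_induct)
  case empty
  thus ?case by simp
next
  case (insert c I)
  let ?U1 = "{i \<in> U. f i = c}" and ?U2 = "{i \<in> U. f i \<noteq> c}"
  have "sdet U A = sdet (?U1 \<union> ?U2) A" by (rule sdet_cong) auto
  also have "\<dots> = sdet ?U1 A * sdet ?U2 A"
    using insert.prems by (intro sdet_block) auto
  also have "sdet ?U2 A = (\<Prod>b\<in>I. sdet {i \<in> ?U2. f i = b} A)"
    using insert.prems by (intro insert.IH) auto
  also have "\<dots> = (\<Prod>b\<in>I. sdet {i \<in> U. f i = b} A)"
    using insert.hyps by (intro prod.cong refl sdet_cong) auto
  finally show ?case using insert.hyps by simp
qed

text \<open>Pigeonhole: the rows in \<open>W\<close> are supported on fewer columns, so every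
  permutation sends some row of \<open>W\<close> outside \<open>W'\<close>.\<close>

lemma sdet_rank_zero:
  assumes fin: "finite U" and W: "W \<subseteq> U" "W' \<subseteq> U" "card W' < card W"
    and zero: "\<And>i j. i \<in> W \<Longrightarrow> j \<in> U - W' \<Longrightarrow> A i j = 0"
  shows "sdet U A = 0"
proof -
  have "(\<Prod>i\<in>U. A i (p i)) = 0" if p: "p permutes U" for p
  proof -
    have "\<not> p ` W \<subseteq> W'"
    proof
      assume "p ` W \<subseteq> W'"
      hence "card W \<le> card W'"
        using permutes_inj_on[OF p, of W] W fin finite_subset by (metis card_inj_on_le)
      thus False using W by simp
    qed
    then obtain i where "i \<in> W" "p i \<in> U - W'" using W permutes_in_image[OF p] by blast
    thus ?thesis using zero W fin by (intro prod_zero) auto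
  qed
  thus ?thesis by (simp add: sdet_def)
qed

text \<open>The minors on \<open>T\<close> need an identification of \<open>T\<close> with
  \<open>U\<close>; \<sigma> is any such choice, and the sign it introduces enters both factors.
  Expanding the product of sums gives functions from \<open>U\<close> to \<open>E\<close>. The
  non-injective ones select a row of \<open>B\<close> twice and vanish; the injective ones with
  image \<open>T\<close> are \<open>\<sigma> T\<close> composed with the permutations of
  \<open>U\<close>.\<close>

theorem sdet_cauchy_binet:
  fixes A B :: "_ \<Rightarrow> _ \<Rightarrow> 'c::{idom,ring_char_0}"
  assumes fin: "finite U" "finite E"
    and \<sigma>: "\<And>T. T \<subseteq> E \<Longrightarrow> card T = card U \<Longrightarrow> bij_betw (\<sigma> T) U T"
  shows "sdet U (\<lambda>i j. \<Sum>e\<in>E. A i e * B e j) =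
    (\<Sum>T | T \<subseteq> E \<and> card T = card U.
       sdet U (\<lambda>i j. A i (\<sigma> T j)) * sdet U (\<lambda>i. B (\<sigma> T i)))"
proof -
  let ?F = "U \<rightarrow>\<^sub>E E" and ?T = "{T. T \<subseteq> E \<and> card T = card U}"
  let ?P = "{p. p permutes U}"
  have finF: "finite ?F" using fin by (intro finite_PiE) auto
  define w where "w f = (\<Prod>i\<in>U. A i (f i)) * sdet U (\<lambda>i. B (f i))" for f
  have "sdet U (\<lambda>i j. \<Sum>e\<in>E. A i e * B e j) =
      (\<Sum>p\<in>?P. of_int (sign p) * (\<Sum>f\<in>?F. \<Prod>i\<in>U. A i (f i) * B (f i) (p i)))"
    unfolding sdet_def using fin by (subst prod_sum_PiE) auto
  also have "\<dots> = (\<Sum>f\<in>?F. w f)"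
    unfolding sdet_def w_def sum_distrib_left
    by (subst sum.swap) (simp add: prod.distrib mult_ac)
  also have "\<dots> = (\<Sum>f | f \<in> ?F \<and> inj_on f U. w f)"
  proof (rule sum.mono_neutral_right[OF finF])
    show "\<forall>f\<in>?F - {f \<in> ?F. inj_on f U}. w f = 0"
    proof
      fix f assume "f \<in> ?F - {f \<in> ?F. inj_on f U}"
      then obtain a b where ab: "a \<in> U" "b \<in> U" "a \<noteq> b" "f a = f b" by (auto simp: inj_on_def)
      have "sdet U (\<lambda>i. B (f i)) = 0"
        by (rule sdet_equal_rows[OF fin(1) ab(1-3)]) (simp add: ab(4))
      thus "w f = 0" by (simp add: w_def)
    qed
  qed auto
  also have "\<dots> = (\<Sum>T\<in>?T. \<Sum>f | f \<in> {f \<in> ?F. inj_on f U} \<and> f ` U = T. w f)"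
    using finF fin by (intro sum.group[symmetric]) (auto simp: card_image)
  also have "\<dots> = (\<Sum>T\<in>?T. sdet U (\<lambda>i j. A i (\<sigma> T j)) * sdet U (\<lambda>i. B (\<sigma> T i)))"
  proof (rule sum.cong)
    fix T assume "T \<in> ?T"
    hence T: "T \<subseteq> E" "card T = card U" by auto
    note bT = \<sigma>[OF T]
    define \<tau> where "\<tau> = inv_into U (\<sigma> T)"
    have \<tau>: "bij_betw \<tau> T U" unfolding \<tau>_def by (rule bij_betw_inv_into[OF bT])
    have \<sigma>\<tau>: "\<sigma> T (\<tau> x) = x" if "x \<in> T" for x
      using bT that by (simp add: \<tau>_def bij_betw_inv_into_right)
    have \<tau>\<sigma>: "\<tau> (\<sigma> T x) = x" if "x \<in> U" for x
      using bT that by (simp add: \<tau>_def bij_betw_inv_into_left)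
    have bij: "bij_betw (\<lambda>p. restrict (\<sigma> T \<circ> p) U) ?P {f. f \<in> {f \<in> ?F. inj_on f U} \<and> f ` U = T}"
    proof (rule bij_betw_byWitness[where f' = "\<lambda>f. restrict_id (\<tau> \<circ> f) U"])
      show "\<forall>p\<in>?P. restrict_id (\<tau> \<circ> restrict (\<sigma> T \<circ> p) U) U = p"
        using \<tau>\<sigma> by (auto simp: fun_eq_iff restrict_id_def permutes_in_image permutes_not_in)
      show "\<forall>f\<in>{f. f \<in> {f \<in> ?F. inj_on f U} \<and> f ` U = T}. restrict (\<sigma> T \<circ> restrict_id (\<tau> \<circ> f) U) U = f"
        using \<sigma>\<tau> by (auto simp: fun_eq_iff restrict_def restrict_id_def PiE_def extensional_def)
      show "(\<lambda>p. restrict (\<sigma> T \<circ> p) U) ` ?P \<subseteq> {f. f \<in> {f \<in> ?F. inj_on f U} \<and> f ` U = T}"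
      proof clarify
        fix p assume p: "p permutes U"
        have "bij_betw (\<sigma> T \<circ> p) U T" by (rule bij_betw_trans[OF permutes_imp_bij[OF p] bT])
        hence "bij_betw (restrict (\<sigma> T \<circ> p) U) U T" by (subst bij_betw_restrict_eq)
        thus "restrict (\<sigma> T \<circ> p) U \<in> {f \<in> ?F. inj_on f U} \<and> restrict (\<sigma> T \<circ> p) U ` U = T"
          using T(1) by (auto simp: bij_betw_def)
      qed
      show "(\<lambda>f. restrict_id (\<tau> \<circ> f) U) ` {f. f \<in> {f \<in> ?F. inj_on f U} \<and> f ` U = T} \<subseteq> ?P"
      proof clarify
        fix f assume "inj_on f U" "T = f ` U"
        hence "bij_betw f U T" by (simp add: bij_betw_def)
        hence "bij_betw (\<tau> \<circ> f) U U" using \<tau> by (rule bij_betw_trans)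
        thus "restrict_id (\<tau> \<circ> f) U permutes U" by (rule permutes_restrict_id)
      qed
    qed
    have "(\<Sum>f | f \<in> {f \<in> ?F. inj_on f U} \<and> f ` U = T. w f) = (\<Sum>p\<in>?P. w (restrict (\<sigma> T \<circ> p) U))"
      by (rule sum.reindex_bij_betw[OF bij, symmetric])
    also have "\<dots> = (\<Sum>p\<in>?P. of_int (sign p) * (\<Prod>i\<in>U. A i (\<sigma> T (p i))) * sdet U (\<lambda>i. B (\<sigma> T i)))"
    proof (rule sum.cong)
      fix p assume "p \<in> ?P"
      hence p: "p permutes U" by simp
      have "sdet U (\<lambda>i. B (restrict (\<sigma> T \<circ> p) U i)) = sdet U (\<lambda>i. B (\<sigma> T (p i)))"
        by (rule sdet_cong) auto
      also have "\<dots> = of_int (sign p) * sdet U (\<lambda>i. B (\<sigma> T i))"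
        by (rule sdet_permute_rows[OF p fin(1)])
      finally show "w (restrict (\<sigma> T \<circ> p) U) =
          of_int (sign p) * (\<Prod>i\<in>U. A i (\<sigma> T (p i))) * sdet U (\<lambda>i. B (\<sigma> T i))"
        by (simp add: w_def mult_ac)
    qed simp
    also have "\<dots> = sdet U (\<lambda>i j. A i (\<sigma> T j)) * sdet U (\<lambda>i. B (\<sigma> T i))"
      by (simp add: sdet_def[of U "\<lambda>i j. A i (\<sigma> T j)"] sum_distrib_right)
    finally show "(\<Sum>f | f \<in> {f \<in> ?F. inj_on f U} \<and> f ` U = T. w f) =
      sdet U (\<lambda>i j. A i (\<sigma> T j)) * sdet U (\<lambda>i. B (\<sigma> T i))" .
  qed simp
  finally show ?thesis .
qed

corollary sdet_mult:
  fixes A B :: "'a \<Rightarrow> 'a \<Rightarrow> 'c::{idom,ring_char_0}"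
  assumes fin: "finite U"
  shows "sdet U (\<lambda>i j. \<Sum>k\<in>U. A i k * B k j) = sdet U A * sdet U B"
proof -
  have *: "T = U" if "T \<subseteq> U" "card T = card U" for T
    using that fin by (simp add: card_subset_eq)
  hence "{T. T \<subseteq> U \<and> card T = card U} = {U}" by auto
  thus ?thesis
    using * by (subst sdet_cauchy_binet[OF fin fin, where \<sigma> = "\<lambda>_ i. i"]) (auto simp: bij_betw_def)
qed

text \<open>
  Adding all rows to row \<open>q\<close> gives a product \<open>E * N\<close> where row \<open>q\<close> of \<open>N\<close> is \<open>b\<close>; adding all columns
  of \<open>N\<close> to column \<open>q\<close> then leaves the minor of \<open>L\<close> at \<open>q\<close>.
\<close>

lemma sdet_rank_one_update:
  fixes L :: "'a \<Rightarrow> 'a \<Rightarrow> 'c::{idom,ring_char_0}"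
  assumes fin: "finite U" and q: "q \<in> U"
    and rows: "\<And>i. i \<in> U \<Longrightarrow> (\<Sum>j\<in>U. L i j) = 0"
    and cols: "\<And>j. j \<in> U \<Longrightarrow> (\<Sum>i\<in>U. L i j) = 0"
  shows "sdet U (\<lambda>i j. L i j + a i * b j) = (\<Sum>i\<in>U. a i) * (\<Sum>j\<in>U. b j) * sdet (U - {q}) L"
proof -
  let ?A = "\<Sum>i\<in>U. a i" and ?B = "\<Sum>j\<in>U. b j"
  define E where "E i k = (if k = q then if i = q then ?A else a i else if k = i then 1 else 0)" for i k
  define N where "N i j = (if i = q then b j else L i j)" for i j
  have "sdet U (\<lambda>i j. L i j + a i * b j) =
      sdet U (\<lambda>i j. if i = q then \<Sum>k\<in>U. 1 * (L k j + a k * b j) else L i j + a i * b j)"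
    by (subst sdet_combine_row[OF fin q]) simp
  also have "\<dots> = sdet U (\<lambda>i j. \<Sum>k\<in>U. E i k * N k j)"
  proof (rule sdet_cong)
    fix i j assume ij: "i \<in> U" "j \<in> U"
    have "(\<Sum>k\<in>U. E i k * N k j) = (\<Sum>k\<in>U. (if k = q then (if i = q then ?A else a i) * b j else 0) +
        (if k = i then if i = q then 0 else L i j else 0))"
      by (rule sum.cong) (auto simp: E_def N_def)
    thus "(if i = q then \<Sum>k\<in>U. 1 * (L k j + a k * b j) else L i j + a i * b j) = (\<Sum>k\<in>U. E i k * N k j)"
      using fin q ij cols by (simp add: sum.distrib sum_distrib_right)
  qed simp
  also have "\<dots> = sdet U E * sdet U N" by (rule sdet_mult[OF fin])
  \<comment> \<open>Ranking \<open>q\<close> last makes \<open>E\<close> triangular: off the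
    diagonal only column \<open>q\<close> is nonzero.\<close>
  also have "sdet U E = (\<Prod>i\<in>U. E i i)"
    by (rule sdet_triangular[OF fin, where r = "\<lambda>i. if i = q then 1 else 0"]) (auto simp: E_def)
  also have "\<dots> = (\<Prod>i\<in>U. if i = q then ?A else 1)" by (rule prod.cong) (auto simp: E_def)
  also have "\<dots> = ?A" using fin q by simp
  also have "sdet U N = sdet U (\<lambda>i j. if j = q then \<Sum>k\<in>U. 1 * N i k else N i j)"
    by (subst sdet_combine_column[OF fin q]) simp
  also have "\<dots> = sdet (U - {q} \<union> {q}) (\<lambda>i j. if j = q then if i = q then ?B else 0 else N i j)"
    using q rows by (intro sdet_cong) (auto simp: N_def)
  also have "\<dots> = sdet (U - {q}) (\<lambda>i j. if j = q then if i = q then ?B else 0 else N i j) *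
      sdet {q} (\<lambda>i j. if j = q then if i = q then ?B else 0 else N i j)"
    using fin by (intro sdet_block) auto
  also have "sdet (U - {q}) (\<lambda>i j. if j = q then if i = q then ?B else 0 else N i j) = sdet (U - {q}) L"
    by (rule sdet_cong) (auto simp: N_def)
  finally show ?thesis by (simp add: sdet_def[of "{q}"] mult_ac)
qed

section \<open>The index of an integer lattice\<close>

text \<open>Congruence modulo the lattice spanned by the columns of \<open>A\<close>. Values outside
  \<open>U\<close> are ignored on both sides, so a vector may later be altered at a removed vertex
  without affecting the relation.\<close>

definition lattice_cong :: "'a set \<Rightarrow> ('a \<Rightarrow> 'a \<Rightarrow> int) \<Rightarrow> ('a \<Rightarrow> int) \<Rightarrow> ('a \<Rightarrow> int) \<Rightarrow> bool" where
  "lattice_cong U A a b \<longleftrightarrow> (\<exists>x. \<forall>u\<in>U. a u - b u = (\<Sum>v\<in>U. A u v * x v))"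

text \<open>Vanishing off \<open>U\<close> makes the representatives genuine points of the free
  module on \<open>U\<close>. A transversal can be extended one coordinate at a time, so the index
  is obtained by induction on \<open>U\<close> without forming quotients.\<close>

definition lattice_transversal :: "'a set \<Rightarrow> ('a \<Rightarrow> 'a \<Rightarrow> int) \<Rightarrow> ('a \<Rightarrow> int) set \<Rightarrow> bool" where
  "lattice_transversal U A R \<longleftrightarrow>
     (\<forall>r\<in>R. \<forall>v. v \<notin> U \<longrightarrow> r v = 0) \<and>
     (\<forall>a. (\<forall>v. v \<notin> U \<longrightarrow> a v = 0) \<longrightarrow> (\<exists>!r. r \<in> R \<and> lattice_cong U A a r))"

text \<open>Determinants agree exactly, not only up to sign: the column operations used are
  additions of a multiple of another column.\<close>

definition lattice_equiv :: "'a set \<Rightarrow> ('a \<Rightarrow> 'a \<Rightarrow> int) \<Rightarrow> ('a \<Rightarrow> 'a \<Rightarrow> int) \<Rightarrow> bool" where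
  "lattice_equiv U A B \<longleftrightarrow> sdet U B = sdet U A \<and> lattice_cong U B = lattice_cong U A"

lemma lattice_equiv_refl: "lattice_equiv U A A"
  by (simp add: lattice_equiv_def)

lemma lattice_equiv_trans: "lattice_equiv U A B \<Longrightarrow> lattice_equiv U B C \<Longrightarrow> lattice_equiv U A C"
  by (simp add: lattice_equiv_def)

section \<open>Unimodular column operations and the index\<close>

definition add_column :: "'a \<Rightarrow> 'a \<Rightarrow> int \<Rightarrow> ('a \<Rightarrow> 'a \<Rightarrow> int) \<Rightarrow> 'a \<Rightarrow> 'a \<Rightarrow> int" where
  "add_column k l c A = (\<lambda>i j. if j = k then A i k + c * A i l else A i j)"

text \<open>The coefficient of column \<open>l\<close> absorbs \<open>c\<close> times that of column
  \<open>k\<close>. One direction suffices, since the operation is undone by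
  \<open>- c\<close>.\<close>

lemma lattice_cong_add_column:
  assumes fin: "finite U" and kl: "k \<in> U" "l \<in> U" "k \<noteq> l"
    and cong: "lattice_cong U (add_column k l c A) a b"
  shows "lattice_cong U A a b"
proof -
  obtain x where x: "\<And>u. u \<in> U \<Longrightarrow> a u - b u = (\<Sum>v\<in>U. add_column k l c A u v * x v)"
    using cong by (auto simp: lattice_cong_def)
  have "a u - b u = (\<Sum>v\<in>U. A u v * (x(l := x l + c * x k)) v)" if "u \<in> U" for u
  proof -
    have "(\<Sum>v\<in>U. add_column k l c A u v * x v) =
        (\<Sum>v\<in>U. A u v * x v + (if v = k then c * A u l * x k else 0))"
      by (rule sum.cong) (auto simp: add_column_def algebra_simps)
    also have "\<dots> = (\<Sum>v\<in>U. A u v * x v + (if v = l then c * A u l * x k else 0))"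
      using fin kl by (simp add: sum.distrib)
    also have "\<dots> = (\<Sum>v\<in>U. A u v * (x(l := x l + c * x k)) v)"
      by (rule sum.cong) (auto simp: algebra_simps)
    finally show ?thesis using x[OF that] by simp
  qed
  thus ?thesis unfolding lattice_cong_def by blast
qed

lemma lattice_equiv_add_column:
  assumes fin: "finite U" and kl: "k \<in> U" "l \<in> U" "k \<noteq> l"
  shows "lattice_equiv U A (add_column k l c A)"
proof -
  have "sdet U (add_column k l c A) =
      sdet U (\<lambda>i j. if j = k then \<Sum>v\<in>U. (if v = k then 1 else if v = l then c else 0) * A i v else A i j)"
  proof (rule sdet_cong)
    fix i j
    have "(\<Sum>v\<in>U. (if v = k then 1 else if v = l then c else 0) * A i v) =
        (\<Sum>v\<in>U. (if v = k then A i k else 0) + (if v = l then c * A i l else 0))"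
      using kl by (intro sum.cong) auto
    thus "add_column k l c A i j = (if j = k then \<Sum>v\<in>U. (if v = k then 1 else if v = l then c else 0) * A i v else A i j)"
      using fin kl by (simp add: sum.distrib add_column_def)
  qed simp
  also have "\<dots> = sdet U A"
    by (subst sdet_combine_column[OF fin kl(1)]) simp
  finally have 1: "sdet U (add_column k l c A) = sdet U A" .
  have inv: "add_column k l (- c) (add_column k l c A) = A"
    using kl by (auto simp: add_column_def fun_eq_iff)
  have "lattice_cong U (add_column k l c A) = lattice_cong U A"
    using lattice_cong_add_column[OF fin kl, of c A]
      lattice_cong_add_column[OF fin kl, of "- c" "add_column k l c A", unfolded inv]
    by (intro ext) blast
  with 1 show ?thesis by (simp add: lattice_equiv_def)
qed

text \<open>The Euclidean algorithm on columns \<open>q\<close> and \<open>j\<close> clears the entry \<open>(q, j)\<close>.\<close>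

lemma clear_entry:
  assumes fin: "finite U" and qj: "q \<in> U" "j \<in> U" "j \<noteq> q"
  shows "\<exists>B. lattice_equiv U A B \<and> B q j = 0 \<and> (\<forall>i. i \<noteq> q \<longrightarrow> i \<noteq> j \<longrightarrow> B q i = A q i)"
proof (induction "nat (\<bar>A q q\<bar> + \<bar>A q j\<bar>)" arbitrary: A rule: less_induct)
  case less
  let ?a = "A q q" and ?b = "A q j"
  note E = lattice_equiv_add_column[OF fin qj(2,1,3)] lattice_equiv_add_column[OF fin qj(1,2) qj(3)[symmetric]]
  have step: ?case
    if B: "lattice_equiv U A B" "nat (\<bar>B q q\<bar> + \<bar>B q j\<bar>) < nat (\<bar>?a\<bar> + \<bar>?b\<bar>)"
      "\<And>i. i \<noteq> q \<Longrightarrow> i \<noteq> j \<Longrightarrow> B q i = A q i" for B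
    using less(1)[of B] B lattice_equiv_trans by metis
  consider "?b = 0" | "?a = 0" "?b \<noteq> 0" | "?a \<noteq> 0" "?b \<noteq> 0" "\<bar>?a\<bar> \<le> \<bar>?b\<bar>" | "?a \<noteq> 0" "?b \<noteq> 0" "\<bar>?b\<bar> < \<bar>?a\<bar>"
    by linarith
  thus ?case
  proof cases
    case 1
    thus ?thesis using lattice_equiv_refl by blast
  next
    case 2
    \<comment> \<open>With b the entry at \<open>j\<close>, row \<open>q\<close> reads (0, b) in
      columns \<open>q\<close> and \<open>j\<close>; the two additions turn it into (b, b) and then
      (b, 0). A swap of columns would change the sign of the determinant.\<close>
    let ?B = "add_column j q (- 1) (add_column q j 1 A)"
    have "lattice_equiv U A ?B" using E lattice_equiv_trans by blast
    moreover have "?B q j = 0" "\<And>i. i \<noteq> q \<Longrightarrow> i \<noteq> j \<Longrightarrow> ?B q i = A q i"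
      using 2 qj(3) by (auto simp: add_column_def)
    ultimately show ?thesis by blast
  next
    case 3
    have "\<bar>?b mod ?a\<bar> < \<bar>?a\<bar>" using 3 by (simp add: abs_mod_less)
    moreover have "?b + - (?b div ?a) * ?a = ?b mod ?a" by (simp add: minus_div_mult_eq_mod)
    ultimately show ?thesis
      using 3 qj(3) by (intro step[of "add_column j q (- (?b div ?a)) A"] E) (auto simp: add_column_def)
  next
    case 4
    have "\<bar>?a mod ?b\<bar> < \<bar>?b\<bar>" using 4 by (simp add: abs_mod_less)
    moreover have "?a + - (?a div ?b) * ?b = ?a mod ?b" by (simp add: minus_div_mult_eq_mod)
    ultimately show ?thesis
      using 4 qj(3) by (intro step[of "add_column q j (- (?a div ?b)) A"] E) (auto simp: add_column_def)
  qed
qed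

text \<open>Clearing one entry leaves row \<open>q\<close> unchanged outside columns
  \<open>q\<close> and \<open>j\<close>, so the zeros already produced persist.\<close>

lemma clear_row:
  assumes fin: "finite U" and q: "q \<in> U"
  shows "\<exists>B. lattice_equiv U A B \<and> (\<forall>j\<in>U - {q}. B q j = 0)"
proof -
  have "J \<subseteq> U - {q} \<Longrightarrow> \<exists>B. lattice_equiv U A B \<and> (\<forall>j\<in>J. B q j = 0)" if "finite J" for J
    using that
  proof (induction J rule: finite_induct)
    case empty
    show ?case using lattice_equiv_refl by blast
  next
    case (insert j J)
    then obtain B where B: "lattice_equiv U A B" "\<forall>j\<in>J. B q j = 0" by auto
    obtain C where C: "lattice_equiv U B C" "C q j = 0" "\<forall>i. i \<noteq> q \<longrightarrow> i \<noteq> j \<longrightarrow> C q i = B q i"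
      using clear_entry[OF fin q, of j B] insert.prems by auto
    have "C q i = 0" if "i \<in> insert j J" for i
      using that C(2,3) B(2) insert.prems by (cases "i = j") auto
    thus ?case using B(1) C(1) lattice_equiv_trans by blast
  qed
  thus ?thesis using fin by blast
qed

text \<open>Once row \<open>q\<close> is cleared, coordinate \<open>q\<close> sees only column
  \<open>q\<close> and is determined modulo the pivot \<open>d\<close>. Fixing it fixes the multiple
  of column \<open>q\<close>, and the other coordinates pose the same problem on \<open>V\<close>.
  The index is thus |d| times the index for \<open>V\<close>.\<close>

theorem lattice_index:
  assumes fin: "finite U" and nz: "sdet U A \<noteq> 0"
  shows "\<exists>R. finite R \<and> int (card R) = \<bar>sdet U A\<bar> \<and> lattice_transversal U A R"
  using fin nz
proof (induction U arbitrary: A rule: finite_induct)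
  case empty
  have "lattice_transversal {} A {\<lambda>_. 0}"
    by (auto simp: lattice_transversal_def lattice_cong_def)
  thus ?case by (intro exI[of _ "{\<lambda>_. 0}"]) simp
next
  case (insert q V)
  let ?U = "insert q V"
  have finU: "finite ?U" using insert.hyps by simp
  obtain B where B: "lattice_equiv ?U A B" and B0: "\<forall>j\<in>?U - {q}. B q j = 0"
    using clear_row[OF finU, of q A] by blast
  define d where "d = B q q"
  have "sdet ?U B = sdet ({q} \<union> V) B" by (rule sdet_cong) auto
  also have "\<dots> = sdet {q} B * sdet V B"
    using insert.hyps B0 by (intro sdet_block) auto
  also have "sdet {q} B = d" by (simp add: sdet_def d_def)
  finally have det: "sdet ?U A = d * sdet V B" using B by (simp add: lattice_equiv_def)
  hence d: "d \<noteq> 0" and "sdet V B \<noteq> 0" using insert.prems by auto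
  then obtain R where R: "finite R" "int (card R) = \<bar>sdet V B\<bar>" "lattice_transversal V B R"
    using insert.IH by blast
  have Rq: "r q = 0" if "r \<in> R" for r
    using R(3) that insert.hyps by (auto simp: lattice_transversal_def)
  define R' where "R' = (\<lambda>(r, i). r(q := i)) ` (R \<times> {0..<\<bar>d\<bar>})"
  have inj: "inj_on (\<lambda>(r, i). r(q := i)) (R \<times> {0..<\<bar>d\<bar>})"
  proof (rule inj_onI, clarify)
    fix r i r' i' assume r: "r \<in> R" "r' \<in> R" and eq: "r(q := i) = r'(q := i')"
    have "i = i'" using fun_cong[OF eq, of q] by simp
    moreover have "r v = r' v" for v
      using fun_cong[OF eq, of v] Rq[OF r(1)] Rq[OF r(2)] by (cases "v = q") auto
    ultimately show "r = r' \<and> i = i'" by auto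
  qed
  have "int (card R') = \<bar>sdet ?U A\<bar>"
    unfolding R'_def card_image[OF inj] det by (simp add: card_cartesian_product R(2) abs_mult)
  moreover have "finite R'" using R(1) by (simp add: R'_def)
  moreover have "lattice_transversal ?U A R'"
    unfolding lattice_transversal_def
  proof (intro conjI allI impI ballI)
    fix r v assume "r \<in> R'" "v \<notin> ?U"
    thus "r v = 0" using R(3) by (auto simp: R'_def lattice_transversal_def)
  next
    fix a :: "'a \<Rightarrow> int" assume a: "\<forall>v. v \<notin> ?U \<longrightarrow> a v = 0"
    define i where "i = a q mod \<bar>d\<bar>"
    define k where "k = (a q - i) div d"
    have "d dvd a q - i" unfolding i_def by (metis abs_dvd_iff dvd_minus_mod)
    hence k: "a q - i = d * k" by (simp add: k_def)
    have i: "0 \<le> i" "i < \<bar>d\<bar>" using d by (auto simp: i_def)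
    \<comment> \<open>What remains on \<open>V\<close> after \<open>k\<close> copies of column
      \<open>q\<close> have brought coordinate \<open>q\<close> from \<open>a q\<close> to its
      residue \<open>i\<close>.\<close>
    define a' where "a' u = (if u \<in> V then a u - B u q * k else 0)" for u
    have key: "lattice_cong ?U B a (r(q := m)) \<longleftrightarrow> m = i \<and> lattice_cong V B a' r"
      if m: "0 \<le> m" "m < \<bar>d\<bar>" for r m
    proof
      assume "lattice_cong ?U B a (r(q := m))"
      then obtain x where x: "\<And>u. u \<in> ?U \<Longrightarrow> a u - (r(q := m)) u = (\<Sum>v\<in>?U. B u v * x v)"
        unfolding lattice_cong_def by blast
      have "(\<Sum>v\<in>V. B q v * x v) = 0" using B0 insert.hyps by (intro sum.neutral) auto
      hence xq: "a q - m = d * x q" using x[of q] insert.hyps by (simp add: d_def)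
      have "m mod \<bar>d\<bar> = a q mod \<bar>d\<bar>"
        using xq by (metis abs_dvd_iff dvd_triv_left mod_eq_dvd_iff)
      hence mi: "m = i" using m by (simp add: i_def)
      hence xk: "x q = k" using xq k d by simp
      have "a' u - r u = (\<Sum>v\<in>V. B u v * x v)" if "u \<in> V" for u
        using x[of u] that insert.hyps xk by (auto simp: a'_def algebra_simps)
      thus "m = i \<and> lattice_cong V B a' r" using mi by (auto simp: lattice_cong_def)
    next
      assume R: "m = i \<and> lattice_cong V B a' r"
      then obtain x where x: "\<And>u. u \<in> V \<Longrightarrow> a' u - r u = (\<Sum>v\<in>V. B u v * x v)"
        by (auto simp: lattice_cong_def)
      have "a u - (r(q := m)) u = (\<Sum>v\<in>?U. B u v * (x(q := k)) v)" if u: "u \<in> ?U" for u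
      proof -
        have eq: "(\<Sum>v\<in>V. B u v * (x(q := k)) v) = (\<Sum>v\<in>V. B u v * x v)"
          using insert.hyps by (intro sum.cong) auto
        show ?thesis
        proof (cases "u = q")
          case True
          have "(\<Sum>v\<in>V. B q v * x v) = 0" using B0 insert.hyps by (intro sum.neutral) auto
          thus ?thesis using True eq k R insert.hyps by (simp add: d_def)
        next
          case False
          thus ?thesis using u eq x[of u] insert.hyps by (auto simp: a'_def algebra_simps)
        qed
      qed
      thus "lattice_cong ?U B a (r(q := m))" unfolding lattice_cong_def by blast
    qed
    have AB: "lattice_cong ?U A = lattice_cong ?U B" using B by (simp add: lattice_equiv_def)
    have "\<forall>v. v \<notin> V \<longrightarrow> a' v = 0" by (simp add: a'_def)
    then obtain r where r: "r \<in> R" "lattice_cong V B a' r" and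
      un: "\<And>s. s \<in> R \<Longrightarrow> lattice_cong V B a' s \<Longrightarrow> s = r"
      using R(3) unfolding lattice_transversal_def by metis
    show "\<exists>!r. r \<in> R' \<and> lattice_cong ?U A a r"
    proof (rule ex1I[of _ "r(q := i)"])
      show "r(q := i) \<in> R' \<and> lattice_cong ?U A a (r(q := i))"
        using r i key[OF i, of r] unfolding AB R'_def by force
    next
      fix s assume s: "s \<in> R' \<and> lattice_cong ?U A a s"
      then obtain t m where t: "t \<in> R" "0 \<le> m" "m < \<bar>d\<bar>" "s = t(q := m)" by (auto simp: R'_def)
      thus "s = r(q := i)" using s key[OF t(2,3), of t] un unfolding AB by blast
    qed
  qed
  ultimately show ?case by blast
qed

section \<open>Trees, cycles and components\<close>

lemma delete_edges_sel [simp]: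
  "verts (delete_edges X F) = verts X" "flip (delete_edges X F) = flip X"
  "rt (delete_edges X F) = rt X" "halfs (delete_edges X F) = halfs X - \<Union>F"
  by (simp_all add: delete_edges_def)

lemma edge_of_delete_edges [simp]: "edge_of (delete_edges X F) = edge_of X"
  by (simp add: edge_of_def fun_eq_iff)

lemma component_of_sel [simp]:
  "verts (component_of X v) = {u \<in> verts X. (v, u) \<in> (adj_rel X)\<^sup>*}"
  "halfs (component_of X v) = {h \<in> halfs X. rt X h \<in> verts X \<and> (v, rt X h) \<in> (adj_rel X)\<^sup>*}"
  "flip (component_of X v) = flip X" "rt (component_of X v) = rt X"
  by (simp_all add: component_of_def Let_def)

lemma edge_of_component_of [simp]: "edge_of (component_of X v) = edge_of X"
  by (simp add: edge_of_def fun_eq_iff)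

text \<open>A rooted spanning tree given by pointers: \<open>par v\<close> is the half-edge leaving
  \<open>v\<close> towards \<open>q\<close>, and \<open>r\<close> strictly decreases along it. The
  same \<open>r\<close> later serves as the ranking in \<open>sdet_triangular\<close>.\<close>

definition parent_map :: "('v, 'h) hgraph \<Rightarrow> 'v \<Rightarrow> ('v \<Rightarrow> nat) \<Rightarrow> ('v \<Rightarrow> 'h) \<Rightarrow> bool" where
  "parent_map X q r par \<longleftrightarrow>
     (\<forall>v \<in> verts X - {q}. par v \<in> halfs X \<and> rt X (par v) = v \<and> r (rt X (flip X (par v))) < r v)"

lemma parent_mapD:
  assumes "parent_map X q r par" "v \<in> verts X - {q}"
  shows "par v \<in> halfs X" "rt X (par v) = v" "r (rt X (flip X (par v))) < r v"
  using assms by (auto simp: parent_map_def)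

context hgraph
begin

lemma finite_edges: "finite (edges X)"
  using finite_halfs by (simp add: edges_def)

lemma edge_of_in [simp]: "h \<in> halfs X \<Longrightarrow> edge_of X h \<in> edges X"
  by (simp add: edges_def)

lemma edge_subset: "e \<in> edges X \<Longrightarrow> e \<subseteq> halfs X"
  by (auto simp: edges_def edge_of_def flip_closed)

lemma edge_eq: "e \<in> edges X \<Longrightarrow> h \<in> e \<Longrightarrow> e = edge_of X h"
  by (auto simp: edges_def edge_of_def flip_flip)

lemma edge_of_eq_iff:
  assumes "h \<in> halfs X"
  shows "edge_of X h = edge_of X k \<longleftrightarrow> k = h \<or> k = flip X h"
  using assms edge_of_flip by (auto simp: edge_of_def)

lemma adjI: "h \<in> halfs X \<Longrightarrow> (rt X h, rt X (flip X h)) \<in> adj_rel X"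
  by (auto simp: adj_rel_def)

lemma adj_verts: "(u, v) \<in> adj_rel X \<Longrightarrow> u \<in> verts X \<and> v \<in> verts X"
  by (auto simp: adj_rel_def rt_closed flip_closed)

lemma adj_sym: "(u, v) \<in> adj_rel X \<Longrightarrow> (v, u) \<in> adj_rel X"
  using adjI[OF flip_closed] by (auto simp: adj_rel_def flip_flip)

lemma adj_rtrancl_sym: "(u, v) \<in> (adj_rel X)\<^sup>* \<Longrightarrow> (v, u) \<in> (adj_rel X)\<^sup>*"
  using sym_rtrancl[of "adj_rel X"] adj_sym by (meson symD symI)

lemma connectedI:
  assumes "q \<in> verts X" "\<And>v. v \<in> verts X \<Longrightarrow> (v, q) \<in> (adj_rel X)\<^sup>*"
  shows "connected_hgraph X"
  unfolding connected_hgraph_def using assms adj_rtrancl_sym by (blast intro: rtrancl_trans)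

text \<open>Take \<open>r\<close> to be the distance to \<open>q\<close>; the first step of a
  shortest walk reaches a vertex of smaller distance.\<close>

lemma parents_exist:
  assumes conn: "connected_hgraph X" and q: "q \<in> verts X"
  shows "\<exists>r par. parent_map X q r par"
proof -
  define r where "r v = (LEAST n. (v, q) \<in> adj_rel X ^^ n)" for v
  have ex: "\<exists>h. h \<in> halfs X \<and> rt X h = v \<and> r (rt X (flip X h)) < r v" if v: "v \<in> verts X - {q}" for v
  proof -
    have "(v, q) \<in> (adj_rel X)\<^sup>*" using conn v q by (auto simp: connected_hgraph_def)
    hence "(v, q) \<in> adj_rel X ^^ r v" unfolding r_def by (metis LeastI_ex rtrancl_power)
    moreover have "r v \<noteq> 0" using calculation v by (metis DiffE relpow_0_E singletonI)
    then obtain m where m: "r v = Suc m" using not0_implies_Suc by blast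
    ultimately obtain w where w: "(v, w) \<in> adj_rel X" "(w, q) \<in> adj_rel X ^^ m"
      by (metis relpow_Suc_D2)
    have "r w < r v" unfolding m using w(2) by (simp add: r_def Least_le less_Suc_eq_le)
    thus ?thesis using w(1) by (auto simp: adj_rel_def)
  qed
  define par where "par v = (SOME h. h \<in> halfs X \<and> rt X h = v \<and> r (rt X (flip X h)) < r v)" for v
  have "parent_map X q r par" unfolding parent_map_def par_def using someI_ex[OF ex] by blast
  thus ?thesis by blast
qed

text \<open>A shared edge would make each of two vertices the parent of the other, so that
  \<open>r\<close> would decrease both ways.\<close>

lemma parent_edge_inj:
  assumes pm: "parent_map X q r par"
  shows "inj_on (\<lambda>v. edge_of X (par v)) (verts X - {q})"
proof (rule inj_onI)
  note par = parent_mapD[OF pm]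
  fix v w assume vw: "v \<in> verts X - {q}" "w \<in> verts X - {q}" "edge_of X (par v) = edge_of X (par w)"
  hence "par w = par v \<or> par w = flip X (par v)" using edge_of_eq_iff par(1) by blast
  thus "v = w"
  proof
    assume "par w = flip X (par v)"
    hence "rt X (flip X (par v)) = w" "rt X (flip X (par w)) = v"
      using par(1,2) vw flip_flip by metis+
    hence "r w < r v" "r v < r w" using par(3) vw by metis+
    thus ?thesis by simp
  qed (metis par(2) vw(1,2))
qed

lemma connected_via_parents:
  assumes q: "q \<in> verts X" and pm: "parent_map X q r par"
  shows "connected_hgraph X"
proof (rule connectedI[OF q])
  fix v assume "v \<in> verts X"
  thus "(v, q) \<in> (adj_rel X)\<^sup>*"
  proof (induction "r v" arbitrary: v rule: less_induct)
    case less
    show ?case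
    proof (cases "v = q")
      case False
      hence v: "v \<in> verts X - {q}" using less.prems by simp
      have "(rt X (flip X (par v)), q) \<in> (adj_rel X)\<^sup>*"
        using less.hyps parent_mapD[OF pm v] rt_closed flip_closed by blast
      thus ?thesis using adjI[OF parent_mapD(1)[OF pm v]] parent_mapD(2)[OF pm v] by (simp add: converse_rtrancl_into_rtrancl)
    qed simp
  qed
qed

section \<open>Edge counts, edge deletion and cycles\<close>

lemma card_verts_le:
  assumes conn: "connected_hgraph X"
  shows "card (verts X) \<le> card (edges X) + 1"
proof -
  obtain q where q: "q \<in> verts X" using conn by (auto simp: connected_hgraph_def)
  obtain r :: "'v \<Rightarrow> nat" and par where pm: "parent_map X q r par"
    using parents_exist[OF conn q] by blast
  note par = parent_mapD[OF pm]
  have "card (verts X - {q}) \<le> card (edges X)"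
    using edge_of_in[OF par(1)] finite_edges
    by (intro card_inj_on_le[OF parent_edge_inj[OF pm]]) blast+
  thus ?thesis using q finite_verts by simp
qed

lemma hgraph_delete_edges:
  assumes F: "F \<subseteq> edges X"
  shows "hgraph (delete_edges X F)"
proof
  fix h assume "h \<in> halfs (delete_edges X F)"
  hence h: "h \<in> halfs X" "h \<notin> \<Union>F" by auto
  have "flip X h \<notin> \<Union>F"
  proof
    assume "flip X h \<in> \<Union>F"
    then obtain e where e: "e \<in> F" "flip X h \<in> e" by blast
    hence "e = edge_of X h" using edge_eq F edge_of_flip[OF h(1)] by blast
    thus False using h e by (auto simp: edge_of_def)
  qed
  thus "flip (delete_edges X F) h \<in> halfs (delete_edges X F)" using h flip_closed by simp
qed (auto simp: finite_verts finite_halfs flip_flip flip_neq rt_closed)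

lemma edges_delete_edges:
  assumes F: "F \<subseteq> edges X"
  shows "edges (delete_edges X F) = edges X - F"
proof -
  have "h \<notin> \<Union>F \<longleftrightarrow> edge_of X h \<notin> F" if "h \<in> halfs X" for h
    using edge_eq F by (auto simp: edge_of_def)
  thus ?thesis by (auto simp: edges_def)
qed

text \<open>The rest of the cycle is a detour between the ends of the deleted edge, so every use of
  that edge can be replaced.\<close>

lemma connected_delete_cycle_edge:
  assumes conn: "connected_hgraph X" and c: "is_cycle X c"
  shows "connected_hgraph (delete_edges X {edge_of X (hd c)})"
proof -
  let ?h = "hd c" let ?Y = "delete_edges X {edge_of X ?h}"
  have ne: "c \<noteq> []" and halfs: "set c \<subseteq> halfs X"
    and chain: "\<And>i. i < length c \<Longrightarrow> rt X (flip X (c ! i)) = rt X (c ! (Suc i mod length c))"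
    and de: "distinct (map (edge_of X) c)" using c by (auto simp: is_cycle_def)
  have h: "?h \<in> halfs X" "?h = c ! 0" using ne halfs by (auto simp: hd_conv_nth)
  interpret Y: hgraph ?Y using h by (intro hgraph_delete_edges) auto
  have in_Y: "k \<in> halfs ?Y \<longleftrightarrow> k \<in> halfs X \<and> edge_of X k \<noteq> edge_of X ?h" for k
    using edge_of_eq_iff[OF h(1)] by (auto simp: edge_of_def)
  have walk: "n < length c \<Longrightarrow> (rt X (flip X ?h), rt X (flip X (c ! n))) \<in> (adj_rel ?Y)\<^sup>*" for n
  proof (induction n)
    case (Suc n)
    have "edge_of X (c ! Suc n) \<noteq> edge_of X ?h"
      using de Suc.prems ne unfolding h(2) by (subst (asm) distinct_conv_nth) force
    hence "c ! Suc n \<in> halfs ?Y" using in_Y halfs Suc.prems nth_mem by blast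
    hence "(rt X (c ! Suc n), rt X (flip X (c ! Suc n))) \<in> adj_rel ?Y" using Y.adjI by fastforce
    moreover have "rt X (flip X (c ! n)) = rt X (c ! Suc n)" using chain[of n] Suc.prems by simp
    ultimately show ?case using Suc by (metis Suc_lessD rtrancl.rtrancl_into_rtrancl)
  qed (simp add: h(2))
  \<comment> \<open>The last half-edge wraps around to index 0, that is, back to the root of
    \<open>hd c\<close>.\<close>
  have "Suc (length c - 1) mod length c = 0" using ne by simp
  hence "rt X (flip X (c ! (length c - 1))) = rt X ?h" using chain[of "length c - 1"] ne h(2) by simp
  hence hh: "(rt X (flip X ?h), rt X ?h) \<in> (adj_rel ?Y)\<^sup>*"
    using walk[of "length c - 1"] ne by simp
  have "adj_rel X \<subseteq> (adj_rel ?Y)\<^sup>*"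
  proof clarify
    fix u v assume "(u, v) \<in> adj_rel X"
    then obtain k where k: "k \<in> halfs X" "u = rt X k" "v = rt X (flip X k)" by (auto simp: adj_rel_def)
    show "(u, v) \<in> (adj_rel ?Y)\<^sup>*"
    proof (cases "k \<in> halfs ?Y")
      case True
      thus ?thesis using Y.adjI[OF True] k by auto
    next
      case False
      hence "k = ?h \<or> k = flip X ?h" using in_Y k(1) edge_of_eq_iff[OF h(1)] by metis
      thus ?thesis using hh Y.adj_rtrancl_sym[OF hh] k flip_flip[OF h(1)] by auto
    qed
  qed
  hence "(adj_rel X)\<^sup>* \<subseteq> (adj_rel ?Y)\<^sup>*" by (metis rtrancl_mono rtrancl_idemp)
  thus ?thesis using conn by (auto simp: connected_hgraph_def)
qed

text \<open>Deleting an edge of a cycle would leave a connected graph with two edges fewer than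
  vertices.\<close>

lemma is_tree_if_card:
  assumes conn: "connected_hgraph X" and card: "card (verts X) = card (edges X) + 1"
  shows "is_tree X"
  unfolding is_tree_def
proof (intro conjI notI conn)
  assume "\<exists>c. is_cycle X c"
  then obtain c where c: "is_cycle X c" ..
  let ?F = "{edge_of X (hd c)}"
  have "hd c \<in> halfs X" using c hd_in_set[of c] unfolding is_cycle_def by blast
  hence F: "?F \<subseteq> edges X" by simp
  interpret Y: hgraph "delete_edges X ?F" by (rule hgraph_delete_edges[OF F])
  have "card (edges X - ?F) < card (edges X)"
    using F finite_edges by (intro psubset_card_mono) auto
  thus False
    using Y.card_verts_le[OF connected_delete_cycle_edge[OF conn c]] card edges_delete_edges[OF F] by simp
qed

text \<open>The vertex list \<open>map (rt X) p @ [v]\<close> includes the end point, so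
  distinctness covers every vertex visited. When the new starting vertex already lies on the path,
  the path is cut there instead of prolonged.\<close>

lemma simple_path_exists:
  assumes "(u, v) \<in> (adj_rel X)\<^sup>*"
  shows "\<exists>p. set p \<subseteq> halfs X \<and> distinct (map (rt X) p @ [v]) \<and> (map (rt X) p @ [v]) ! 0 = u \<and>
    (\<forall>i < length p. rt X (flip X (p ! i)) = (map (rt X) p @ [v]) ! Suc i)"
  using assms
proof (induction rule: converse_rtrancl_induct)
  case base
  show ?case by (intro exI[of _ "[]"]) simp
next
  case (step u w)
  then obtain p where p: "set p \<subseteq> halfs X" "distinct (map (rt X) p @ [v])" "(map (rt X) p @ [v]) ! 0 = w"
    "\<And>i. i < length p \<Longrightarrow> rt X (flip X (p ! i)) = (map (rt X) p @ [v]) ! Suc i" by blast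
  obtain k where k: "k \<in> halfs X" "u = rt X k" "w = rt X (flip X k)" using step.hyps by (auto simp: adj_rel_def)
  show ?case
  proof (cases "u \<in> set (map (rt X) p @ [v])")
    case False
    have "rt X (flip X ((k # p) ! i)) = (map (rt X) (k # p) @ [v]) ! Suc i" if "i < length (k # p)" for i
      using that p(3,4) k by (cases i) auto
    thus ?thesis using p k False by (intro exI[of _ "k # p"]) auto
  next
    case True
    then obtain n where n: "n < Suc (length p)" "(map (rt X) p @ [v]) ! n = u"
      by (metis in_set_conv_nth length_append_singleton length_map)
    have eq: "map (rt X) (drop n p) @ [v] = drop n (map (rt X) p @ [v])"
      using n by (simp add: drop_map)
    \<comment> \<open>\<open>n\<close> may equal \<open>length p\<close>; then \<open>u\<close> is
      the end point and the path becomes empty.\<close>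
    show ?thesis
    proof (intro exI[of _ "drop n p"] conjI allI impI)
      show "set (drop n p) \<subseteq> halfs X" using p(1) set_drop_subset[of n p] by (rule order_trans[rotated])
      show "distinct (map (rt X) (drop n p) @ [v])" unfolding eq using p(2) by (rule distinct_drop)
      show "(map (rt X) (drop n p) @ [v]) ! 0 = u" unfolding eq using n by (simp del: drop_append)
      show "rt X (flip X (drop n p ! i)) = (map (rt X) (drop n p) @ [v]) ! Suc i"
        if "i < length (drop n p)" for i
        unfolding eq using that p(4)[of "n + i"] n by (simp del: drop_append)
    qed
  qed
qed

text \<open>There are too many edges for the parent tree, so some edge \<open>e\<close> lies outside
  it. Its ends stay joined without \<open>e\<close>, and a simple path between them closes up with
  \<open>e\<close>; for a loop that path is empty.\<close>

lemma cycle_exists: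
  assumes conn: "connected_hgraph X" and card: "card (verts X) \<le> card (edges X)"
  shows "\<exists>c. is_cycle X c"
proof -
  obtain q where q: "q \<in> verts X" using conn by (auto simp: connected_hgraph_def)
  obtain r :: "'v \<Rightarrow> nat" and par where pm: "parent_map X q r par"
    using parents_exist[OF conn q] by blast
  note par = parent_mapD[OF pm]
  let ?T = "(\<lambda>v. edge_of X (par v)) ` (verts X - {q})"
  have "card ?T \<le> card (verts X - {q})" using finite_verts by (intro card_image_le) auto
  hence "card ?T < card (edges X)"
    using card q finite_verts by (metis card_Diff1_less le_less_trans less_le_trans)
  moreover have "?T \<subseteq> edges X" using edge_of_in[OF par(1)] by blast
  ultimately obtain e where e: "e \<in> edges X" "e \<notin> ?T" by (metis less_irrefl subsetI subset_antisym)
  then obtain h where h: "h \<in> halfs X" "e = edge_of X h" by (auto simp: edges_def)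
  let ?Y = "delete_edges X {e}"
  interpret Y: hgraph ?Y using e by (intro hgraph_delete_edges) auto
  have in_Y: "k \<in> halfs ?Y \<longleftrightarrow> k \<in> halfs X \<and> edge_of X k \<noteq> e" for k
    using edge_of_eq_iff[OF h(1)] by (auto simp: h(2) edge_of_def)
  have "par v \<in> halfs ?Y" if "v \<in> verts X - {q}" for v using e(2) par(1)[OF that] that in_Y by blast
  hence "connected_hgraph ?Y"
    using Y.connected_via_parents[of q r par] q par by (auto simp: parent_map_def)
  hence "(rt X (flip X h), rt X h) \<in> (adj_rel ?Y)\<^sup>*"
    using h rt_closed flip_closed by (auto simp: connected_hgraph_def)
  from Y.simple_path_exists[OF this] obtain p where
    p: "set p \<subseteq> halfs ?Y" "distinct (map (rt X) p @ [rt X h])" "(map (rt X) p @ [rt X h]) ! 0 = rt X (flip X h)"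
    "\<And>i. i < length p \<Longrightarrow> rt X (flip X (p ! i)) = (map (rt X) p @ [rt X h]) ! Suc i"
    by auto
  let ?W = "map (rt X) p @ [rt X h]"
  have W: "?W ! i = ?W ! j \<longleftrightarrow> i = j" if "i \<le> length p" "j \<le> length p" for i j
    using nth_eq_iff_index_eq[OF p(2)] that by simp
  have pW: "rt X (p ! i) = ?W ! i" if "i < length p" for i using that by (simp add: nth_append)
  have ph: "p ! i \<in> halfs X" "edge_of X (p ! i) \<noteq> e" if "i < length p" for i
    using p(1) that in_Y nth_mem by blast+
  \<comment> \<open>Distinct vertices leave only one way to repeat an edge, namely turning back at
    once, and that would revisit the vertex where the edge was entered.\<close>
  have ne: "edge_of X (p ! i) \<noteq> edge_of X (p ! j)" if ij: "i < j" "j < length p" for i j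
  proof
    have i: "i < length p" using ij by simp
    assume "edge_of X (p ! i) = edge_of X (p ! j)"
    hence "p ! j = p ! i \<or> p ! j = flip X (p ! i)" using edge_of_eq_iff[OF ph(1)[OF i]] by metis
    thus False
    proof
      assume "p ! j = p ! i"
      thus False using pW[OF i] pW[OF ij(2)] W[of i j] ij by simp
    next
      assume *: "p ! j = flip X (p ! i)"
      hence "?W ! j = ?W ! Suc i" using pW[OF ij(2)] p(4)[OF i] by simp
      hence j: "j = Suc i" using W ij by simp
      have "?W ! Suc j = ?W ! i" using p(4)[OF ij(2)] * flip_flip[OF ph(1)[OF i]] pW[OF i] by simp
      thus False using W[of "Suc j" i] ij j by simp
    qed
  qed
  have "is_cycle X (h # p)"
    unfolding is_cycle_def
  proof (intro conjI allI impI)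
    show "set (h # p) \<subseteq> halfs X" using p(1) h by auto
    show "distinct (map (rt X) (h # p))" using p(2) by auto
    have "distinct (map (edge_of X) p)"
      unfolding distinct_conv_nth using ne by (simp add: nat_neq_iff) metis
    moreover have "edge_of X h \<notin> set (map (edge_of X) p)"
      using p(1) in_Y h(2) by auto
    ultimately show "distinct (map (edge_of X) (h # p))" by simp
    fix i assume i: "i < length (h # p)"
    \<comment> \<open>Prepending \<open>h\<close> shifts indices by one; the successor of the last
      half-edge is \<open>h\<close> itself, whose root is the last entry of
      \<open>?W\<close>.\<close>
    have C: "rt X ((h # p) ! (Suc j mod length (h # p))) = ?W ! j" if "j \<le> length p" for j
      using that by (cases "j = length p") (auto simp: nth_append)
    show "rt X (flip X ((h # p) ! i)) = rt X ((h # p) ! (Suc i mod length (h # p)))"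
      using i C[of i] p(3,4) by (cases i) auto
  qed simp
  thus ?thesis ..
qed

lemma tree_card:
  assumes "is_tree X"
  shows "card (verts X) = card (edges X) + 1"
  using assms card_verts_le cycle_exists by (force simp: is_tree_def)

text \<open>Supplies the nonvanishing of the reduced Laplacian, on which the finiteness of the
  Jacobian rests. The parent edges form the tree.\<close>

lemma spanning_tree_exists:
  assumes conn: "connected_hgraph X"
  shows "spanning_trees X \<noteq> {}"
proof -
  obtain q where q: "q \<in> verts X" using conn by (auto simp: connected_hgraph_def)
  obtain r :: "'v \<Rightarrow> nat" and par where pm: "parent_map X q r par"
    using parents_exist[OF conn q] by blast
  note par = parent_mapD[OF pm]
  let ?T = "(\<lambda>v. edge_of X (par v)) ` (verts X - {q})"
  let ?Y = "delete_edges X (edges X - ?T)"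
  interpret Y: hgraph ?Y by (rule hgraph_delete_edges) auto
  have T: "?T \<subseteq> edges X" using edge_of_in[OF par(1)] by blast
  have "par v \<in> halfs ?Y" if v: "v \<in> verts X - {q}" for v
  proof -
    have "par v \<notin> e" if "e \<in> edges X" "e \<notin> ?T" for e
      using edge_eq[OF that(1), of "par v"] that(2) v by blast
    thus ?thesis using par(1)[OF v] by auto
  qed
  hence "connected_hgraph ?Y"
    using Y.connected_via_parents[of q r par] q par by (auto simp: parent_map_def)
  moreover have "card ?T = card (verts X - {q})" by (rule card_image[OF parent_edge_inj[OF pm]])
  hence "card (verts X) = card ?T + 1" using card.remove[OF finite_verts q] by simp
  moreover have "edges ?Y = ?T" using T by (subst edges_delete_edges) auto
  ultimately have "is_tree ?Y" by (intro Y.is_tree_if_card) simp_all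
  thus ?thesis using T by (auto simp: spanning_trees_def)
qed

section \<open>Connected components\<close>

lemma hgraph_component_of:
  assumes v: "v \<in> verts X"
  shows "hgraph (component_of X v)"
proof
  fix h assume "h \<in> halfs (component_of X v)"
  hence h: "h \<in> halfs X" "(v, rt X h) \<in> (adj_rel X)\<^sup>*" by auto
  show "flip (component_of X v) h \<in> halfs (component_of X v)"
    using h flip_closed rt_closed adjI[OF h(1)] by (auto intro: rtrancl.rtrancl_into_rtrancl)
  show "flip (component_of X v) (flip (component_of X v) h) = h" "flip (component_of X v) h \<noteq> h"
    "rt (component_of X v) h \<in> verts (component_of X v)"
    using h flip_flip flip_neq rt_closed by auto
qed (auto simp: finite_verts finite_halfs)

lemma connected_component_of:
  assumes v: "v \<in> verts X"
  shows "connected_hgraph (component_of X v)"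
proof -
  let ?C = "component_of X v"
  interpret C: hgraph ?C by (rule hgraph_component_of[OF v])
  have "(v, u) \<in> (adj_rel ?C)\<^sup>*" if "(v, u) \<in> (adj_rel X)\<^sup>*" for u
    using that
  proof (induction rule: rtrancl_induct)
    case (step u w)
    then obtain h where h: "h \<in> halfs X" "u = rt X h" "w = rt X (flip X h)" by (auto simp: adj_rel_def)
    hence "h \<in> halfs ?C" using step rt_closed by auto
    hence "(u, w) \<in> adj_rel ?C" using C.adjI h by fastforce
    thus ?case using step.IH by simp
  qed simp
  thus ?thesis using v C.adj_rtrancl_sym by (intro C.connectedI[of v]) auto
qed

lemma component_of_eq:
  assumes "(u, v) \<in> (adj_rel X)\<^sup>*"
  shows "component_of X u = component_of X v"
proof -
  have "(u, w) \<in> (adj_rel X)\<^sup>* \<longleftrightarrow> (v, w) \<in> (adj_rel X)\<^sup>*" for w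
    using assms adj_rtrancl_sym rtrancl_trans by metis
  thus ?thesis by (simp add: component_of_def)
qed

lemma component_of_self: "v \<in> verts X \<Longrightarrow> v \<in> verts (component_of X v)"
  by simp

lemma component_of_eq_iff:
  assumes "C \<in> components X" "u \<in> verts X"
  shows "component_of X u = C \<longleftrightarrow> u \<in> verts C"
proof -
  obtain v where v: "v \<in> verts X" "C = component_of X v" using assms by (auto simp: components_def)
  show ?thesis
  proof
    assume "component_of X u = C"
    thus "u \<in> verts C" using component_of_self[OF assms(2)] by blast
  next
    assume "u \<in> verts C"
    hence "(v, u) \<in> (adj_rel X)\<^sup>*" using v by simp
    thus "component_of X u = C" using component_of_eq[of v u] v(2) by simp
  qed
qed

lemma component_verts: "C \<in> components X \<Longrightarrow> verts C = {v \<in> verts X. component_of X v = C}"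
  using component_of_eq_iff by (fastforce simp: components_def)

lemma finite_components: "finite (components X)"
  using finite_verts by (simp add: components_def)

text \<open>The ends of an edge are joined by it, so any half-edge of \<open>e\<close> gives the
  same component.\<close>

definition edge_component :: "'h set \<Rightarrow> ('v, 'h) hgraph" where
  "edge_component e = component_of X (rt X (SOME h. h \<in> e))"

lemma edge_component_eq:
  assumes h: "h \<in> halfs X"
  shows "edge_component (edge_of X h) = component_of X (rt X h)"
proof -
  have "(SOME k. k \<in> edge_of X h) \<in> edge_of X h" by (rule someI[of _ h]) (simp add: edge_of_def)
  hence "(SOME k. k \<in> edge_of X h) = h \<or> (SOME k. k \<in> edge_of X h) = flip X h" by (simp add: edge_of_def)
  moreover have "component_of X (rt X (flip X h)) = component_of X (rt X h)"
    using adjI[OF h] by (intro component_of_eq[symmetric]) auto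
  ultimately show ?thesis by (auto simp: edge_component_def)
qed

lemma component_edges:
  assumes C: "C \<in> components X"
  shows "edges C = {e \<in> edges X. edge_component e = C}"
proof -
  obtain v where v: "v \<in> verts X" "C = component_of X v" using C by (auto simp: components_def)
  have "halfs C = {h \<in> halfs X. component_of X (rt X h) = C}"
    using component_of_eq_iff[OF C] rt_closed v by auto
  moreover have "edge_of C = edge_of X" using v by simp
  ultimately show ?thesis unfolding edges_def by (auto simp: edge_component_eq)
qed

lemma edge_component_in: "e \<in> edges X \<Longrightarrow> edge_component e \<in> components X"
  using rt_closed by (auto simp: edges_def edge_component_eq components_def)

lemma component_of_connected:
  assumes "connected_hgraph X" "v \<in> verts X"
  shows "component_of X v = X"
proof -
  have "{u \<in> verts X. (v, u) \<in> (adj_rel X)\<^sup>*} = verts X"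
    using assms by (auto simp: connected_hgraph_def)
  thus ?thesis using rt_closed by (simp add: component_of_def Let_def cong: conj_cong)
qed

end

section \<open>The matrix-tree theorem for voltage graphs\<close>

text \<open>Conjugation is inversion on the unit circle, so this is the multiplicative form of the
  rule that \<eta> changes sign on a reversed edge.\<close>

definition unit_voltage :: "('v, 'h) hgraph \<Rightarrow> ('h \<Rightarrow> complex) \<Rightarrow> bool" where
  "unit_voltage X z \<longleftrightarrow> (\<forall>h \<in> halfs X. cmod (z h) = 1 \<and> z (flip X h) = cnj (z h))"

text \<open>A twisted boundary matrix. At a loop both terms fall into one entry, 1 minus a voltage,
  which need not vanish; this is what gives a loop its weight as a genus-one component.\<close>

definition incidence ::
  "('v, 'h) hgraph \<Rightarrow> ('h set \<Rightarrow> 'h) \<Rightarrow> ('h \<Rightarrow> complex) \<Rightarrow> 'v \<Rightarrow> 'h set \<Rightarrow> complex" where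
  "incidence X ori z x e =
     of_bool (rt X (ori e) = x) - of_bool (rt X (flip X (ori e)) = x) * z (flip X (ori e))"

text \<open>A sum over half-edges rather than edges, so that a loop enters twice, once with its
  voltage and once with the conjugate.\<close>

definition twisted_laplacian :: "('v, 'h) hgraph \<Rightarrow> ('h \<Rightarrow> complex) \<Rightarrow> 'v \<Rightarrow> 'v \<Rightarrow> complex" where
  "twisted_laplacian X z u v =
     (\<Sum>h \<in> halfs X. of_bool (rt X h = u) * (of_bool (u = v) - of_bool (rt X (flip X h) = v) * z h))"

text \<open>
  Components with trivial cycle value are not excluded here: they contribute weight zero.
\<close>

definition good_component :: "'v set \<Rightarrow> ('v, 'h) hgraph \<Rightarrow> bool" where
  "good_component S C \<longleftrightarrow>
     genus C = 1 \<and> verts C \<inter> S = {} \<or> is_tree C \<and> (\<exists>!v. v \<in> verts C \<and> v \<in> S)"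

text \<open>Reversing the cycle conjugates the value. Only its distance to 1 matters, and
  \<open>unicyclic_minor\<close> computes that for whichever cycle is selected.\<close>

definition component_value :: "('h \<Rightarrow> complex) \<Rightarrow> ('v, 'h) hgraph \<Rightarrow> complex" where
  "component_value z C = prod_list (map z (SOME c. is_cycle C c))"

definition component_wt :: "('h \<Rightarrow> complex) \<Rightarrow> 'v set \<Rightarrow> ('v, 'h) hgraph \<Rightarrow> real" where
  "component_wt z S C =
     (if genus C = 1 \<and> verts C \<inter> S = {} then (cmod (1 - component_value z C))\<^sup>2 else 1)"

lemma card_eq_sum_fibers:
  assumes "finite A" "finite I" "f ` A \<subseteq> I"
  shows "card A = (\<Sum>c\<in>I. card {a \<in> A. f a = c})"
  using sum.group[OF assms, of "\<lambda>_. 1::nat"] by simp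

lemma incidence_cong:
  "rt C = rt X \<Longrightarrow> flip C = flip X \<Longrightarrow> incidence C ori z = incidence X ori z"
  by (simp add: incidence_def fun_eq_iff)

lemma unit_voltage_subgraph:
  "unit_voltage X z \<Longrightarrow> halfs C \<subseteq> halfs X \<Longrightarrow> flip C = flip X \<Longrightarrow> unit_voltage C z"
  by (auto simp: unit_voltage_def)

lemma orientation_subgraph: "orientation X ori \<Longrightarrow> edges C \<subseteq> edges X \<Longrightarrow> orientation C ori"
  by (auto simp: orientation_def)

context hgraph
begin

section \<open>Factorisation of the twisted Laplacian and minors of connected graphs\<close>

lemma orientation_cases:
  assumes ori: "orientation X ori" and h: "h \<in> halfs X"
  shows "ori (edge_of X h) = h \<or> ori (edge_of X h) = flip X h"
  using ori h by (auto simp: orientation_def edge_of_def edges_def)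

lemma orientation_half:
  assumes ori: "orientation X ori" and e: "e \<in> edges X"
  shows "ori e \<in> halfs X" "edge_of X (ori e) = e"
  using ori e edge_subset edge_eq by (auto simp: orientation_def)

lemma sum_halfs:
  assumes ori: "orientation X ori"
  shows "(\<Sum>h \<in> halfs X. f h) = (\<Sum>e \<in> edges X. f (ori e) + f (flip X (ori e)))"
proof -
  have "(\<Sum>h \<in> halfs X. f h) = (\<Sum>e \<in> edges X. \<Sum>h | h \<in> halfs X \<and> edge_of X h = e. f h)"
    using finite_halfs finite_edges by (intro sum.group[symmetric]) auto
  also have "\<dots> = (\<Sum>e \<in> edges X. f (ori e) + f (flip X (ori e)))"
  proof (rule sum.cong)
    fix e assume e: "e \<in> edges X"
    note o = orientation_half[OF ori e]
    have "{h \<in> halfs X. edge_of X h = e} = {ori e, flip X (ori e)}"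
      using o edge_of_eq_iff[OF o(1)] flip_closed by auto
    thus "(\<Sum>h | h \<in> halfs X \<and> edge_of X h = e. f h) = f (ori e) + f (flip X (ori e))"
      using flip_neq[OF o(1)] by simp
  qed simp
  finally show ?thesis .
qed

text \<open>Each edge contributes the four products of its two incidence entries; the diagonal one
  at the target is 1 because the voltage has modulus 1.\<close>

lemma twisted_laplacian_factor:
  assumes ori: "orientation X ori" and z: "unit_voltage X z"
  shows "twisted_laplacian X z u v = (\<Sum>e \<in> edges X. incidence X ori z u e * cnj (incidence X ori z v e))"
  unfolding twisted_laplacian_def sum_halfs[OF ori]
proof (rule sum.cong)
  fix e assume e: "e \<in> edges X"
  note o = orientation_half[OF ori e]
  define w where "w = z (flip X (ori e))"
  have "z (flip X (ori e)) = cnj (z (ori e))" using z o(1) by (simp add: unit_voltage_def)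
  hence zo: "z (ori e) = cnj w" by (simp add: w_def)
  have "w * cnj w = 1"
    using z o(1) flip_closed[OF o(1)] complex_norm_square[of w] by (simp add: unit_voltage_def w_def)
  thus "of_bool (rt X (ori e) = u) * (of_bool (u = v) - of_bool (rt X (flip X (ori e)) = v) * z (ori e)) +
      of_bool (rt X (flip X (ori e)) = u) * (of_bool (u = v) -
        of_bool (rt X (flip X (flip X (ori e))) = v) * z (flip X (ori e))) =
      incidence X ori z u e * cnj (incidence X ori z v e)"
    using flip_flip[OF o(1)] by (auto simp: incidence_def zo w_def[symmetric] algebra_simps)
qed simp

text \<open>The column of the parent edge of \<open>y\<close> meets only \<open>y\<close> and its
  parent, which has smaller \<open>r\<close>. The minor is therefore triangular with diagonal
  entries of modulus 1, whatever the voltages.\<close>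

lemma tree_minor:
  assumes card: "card (verts X) = card (edges X) + 1"
    and q: "q \<in> verts X" and pm: "parent_map X q r par"
    and ori: "orientation X ori" and z: "unit_voltage X z"
  defines "\<sigma> \<equiv> \<lambda>v. edge_of X (par v)"
  shows "bij_betw \<sigma> (verts X - {q}) (edges X)"
    and "cmod (sdet (verts X - {q}) (\<lambda>x y. incidence X ori z x (\<sigma> y))) = 1"
proof -
  let ?V = "verts X - {q}"
  note par = parent_mapD[OF pm]
  have inj: "inj_on \<sigma> ?V" unfolding \<sigma>_def by (rule parent_edge_inj[OF pm])
  have "card (\<sigma> ` ?V) = card (edges X)"
    using card_image[OF inj] card q finite_verts by simp
  moreover have "\<sigma> ` ?V \<subseteq> edges X" unfolding \<sigma>_def using edge_of_in[OF par(1)] by blast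
  ultimately have "\<sigma> ` ?V = edges X" using finite_edges by (simp add: card_subset_eq)
  thus "bij_betw \<sigma> ?V (edges X)" using inj by (simp add: bij_betw_def)
  have o: "ori (\<sigma> y) = par y \<or> ori (\<sigma> y) = flip X (par y)" if "y \<in> ?V" for y
    unfolding \<sigma>_def by (rule orientation_cases[OF ori par(1)[OF that]])
  have "sdet ?V (\<lambda>x y. incidence X ori z x (\<sigma> y)) = (\<Prod>y\<in>?V. incidence X ori z y (\<sigma> y))"
  proof (rule sdet_triangular[where r = r])
    show "finite ?V" using finite_verts by simp
    fix x y assume xy: "x \<in> ?V" "y \<in> ?V" "x \<noteq> y" "\<not> r x < r y"
    hence "x \<noteq> rt X (par y)" "x \<noteq> rt X (flip X (par y))" using par(2,3)[OF xy(2)] by auto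
    thus "incidence X ori z x (\<sigma> y) = 0"
      using o[OF xy(2)] flip_flip[OF par(1)[OF xy(2)]] by (auto simp: incidence_def)
  qed
  moreover have "cmod (incidence X ori z y (\<sigma> y)) = 1" if y: "y \<in> ?V" for y
  proof -
    have "rt X (flip X (par y)) \<noteq> y" using par(3)[OF y] by auto
    moreover have "cmod (z (par y)) = 1" using z par(1)[OF y] by (simp add: unit_voltage_def)
    ultimately show ?thesis
      using o[OF y] par(2)[OF y] flip_flip[OF par(1)[OF y]] by (auto simp: incidence_def)
  qed
  ultimately show "cmod (sdet ?V (\<lambda>x y. incidence X ori z x (\<sigma> y))) = 1"
    by (simp add: prod_norm[symmetric] del: prod_norm)
qed

text \<open>A tree carries no holonomy: the voltages on its edges form a coboundary. \<psi> is built
  level by level, each step redefining only the vertices with \<open>r v = n\<close>, whose parents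
  are already final.\<close>

lemma gauge_exists:
  assumes pm: "parent_map X q r par" and z: "unit_voltage X z"
  shows "\<exists>\<psi>. (\<forall>v. cmod (\<psi> v) = 1) \<and>
    (\<forall>v \<in> verts X - {q}. \<psi> (rt X (flip X (par v))) = z (par v) * \<psi> v)"
proof -
  note par = parent_mapD[OF pm]
  let ?ok = "\<lambda>\<psi> v. \<psi> (rt X (flip X (par v))) = z (par v) * \<psi> v"
  have "\<exists>\<psi>. (\<forall>v. cmod (\<psi> v) = 1) \<and> (\<forall>v \<in> verts X - {q}. r v < n \<longrightarrow> ?ok \<psi> v)" for n
  proof (induction n)
    case 0
    show ?case by (intro exI[of _ "\<lambda>_. 1"]) simp
  next
    case (Suc n)
    then obtain \<psi> where \<psi>: "\<And>v. cmod (\<psi> v) = 1" "\<And>v. v \<in> verts X - {q} \<Longrightarrow> r v < n \<Longrightarrow> ?ok \<psi> v"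
      by blast
    define \<psi>' where "\<psi>' v = (if v \<in> verts X - {q} \<and> r v = n
      then cnj (z (par v)) * \<psi> (rt X (flip X (par v))) else \<psi> v)" for v
    have z1: "cmod (z (par v)) = 1" if "v \<in> verts X - {q}" for v
      using z par(1)[OF that] by (simp add: unit_voltage_def)
    have zz: "z (par v) * cnj (z (par v)) = 1" if "v \<in> verts X - {q}" for v
      using z1[OF that] complex_norm_square[of "z (par v)"] by simp
    have "cmod (\<psi>' v) = 1" for v using z1 \<psi>(1) by (auto simp: \<psi>'_def norm_mult)
    moreover have "?ok \<psi>' v" if v: "v \<in> verts X - {q}" "r v < Suc n" for v
    proof -
      have "r (rt X (flip X (par v))) < n" using par(3)[OF v(1)] v(2) by simp
      hence p: "\<psi>' (rt X (flip X (par v))) = \<psi> (rt X (flip X (par v)))" by (simp add: \<psi>'_def)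
      show ?thesis
      proof (cases "r v = n")
        case True
        hence "z (par v) * \<psi>' v = (z (par v) * cnj (z (par v))) * \<psi> (rt X (flip X (par v)))"
          using v by (simp add: \<psi>'_def)
        thus ?thesis using p zz[OF v(1)] by simp
      next
        case False
        hence "\<psi>' v = \<psi> v" by (simp add: \<psi>'_def)
        thus ?thesis using False v \<psi>(2)[OF v(1)] p by simp
      qed
    qed
    ultimately show ?case by blast
  qed
  \<comment> \<open>Enough levels to exhaust the finite vertex set.\<close>
  from this[of "Suc (Max (r ` verts X))"] obtain \<psi> where
    \<psi>: "\<And>v. cmod (\<psi> v) = 1" "\<And>v. v \<in> verts X - {q} \<Longrightarrow> r v < Suc (Max (r ` verts X)) \<Longrightarrow> ?ok \<psi> v"
    by blast
  have "r v < Suc (Max (r ` verts X))" if "v \<in> verts X" for v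
    using that finite_verts by (simp add: less_Suc_eq_le)
  thus ?thesis using \<psi> by (intro exI[of _ \<psi>]) blast
qed

text \<open>
  After removing one edge of the cycle the voltages are a coboundary \<open>\<psi>\<close>; the combination of the
  rows of the incidence matrix with coefficients \<open>\<psi>\<close> is supported on the removed edge.
\<close>

lemma unicyclic_minor:
  assumes conn: "connected_hgraph X" and card: "card (verts X) = card (edges X)"
    and c: "is_cycle X c" and ori: "orientation X ori" and z: "unit_voltage X z"
  shows "\<exists>\<sigma>. bij_betw \<sigma> (verts X) (edges X) \<and>
    cmod (sdet (verts X) (\<lambda>x y. incidence X ori z x (\<sigma> y))) = cmod (1 - prod_list (map z c))"
proof -
  let ?h = "hd c"
  let ?e = "edge_of X ?h"
  let ?Y = "delete_edges X {?e}"
  have ne: "c \<noteq> []" and halfs: "set c \<subseteq> halfs X"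
    and chain: "\<And>i. i < length c \<Longrightarrow> rt X (flip X (c ! i)) = rt X (c ! (Suc i mod length c))"
    and de: "distinct (map (edge_of X) c)" using c by (auto simp: is_cycle_def)
  have h: "?h \<in> halfs X" "?h = c ! 0" using ne halfs by (auto simp: hd_conv_nth)
  hence e: "?e \<in> edges X" by simp
  hence F: "{?e} \<subseteq> edges X" by simp
  interpret Y: hgraph ?Y by (rule hgraph_delete_edges[OF F])
  have eY: "edges ?Y = edges X - {?e}" by (rule edges_delete_edges[OF F])
  have connY: "connected_hgraph ?Y" by (rule connected_delete_cycle_edge[OF conn c])
  have "card (edges X) = card (edges ?Y) + 1" unfolding eY using card.remove[OF finite_edges e] by simp
  hence cardY: "card (verts ?Y) = card (edges ?Y) + 1" using card by simp
  obtain q where q: "q \<in> verts X" using conn by (auto simp: connected_hgraph_def)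
  hence qY: "q \<in> verts ?Y" by simp
  obtain r par where pm: "parent_map ?Y q r par" using Y.parents_exist[OF connY qY] by blast
  have oriY: "orientation ?Y ori" using ori eY by (auto intro: orientation_subgraph)
  have zY: "unit_voltage ?Y z" using z by (auto intro: unit_voltage_subgraph)
  define \<sigma> where "\<sigma> v = edge_of ?Y (par v)" for v
  note tm = Y.tree_minor[OF cardY qY pm oriY zY, folded \<sigma>_def]
  have bij: "bij_betw \<sigma> (verts X - {q}) (edges X - {?e})" using tm(1) eY by (simp add: \<sigma>_def[abs_def])
  have minor: "cmod (sdet (verts X - {q}) (\<lambda>x y. incidence X ori z x (\<sigma> y))) = 1"
    using tm(2) incidence_cong[of ?Y X ori z] by (simp add: \<sigma>_def)
  obtain \<psi> where \<psi>1: "\<And>v. cmod (\<psi> v) = 1" and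
    \<psi>p: "\<And>v. v \<in> verts X - {q} \<Longrightarrow> \<psi> (rt X (flip X (par v))) = z (par v) * \<psi> v"
    using Y.gauge_exists[OF pm zY] by auto
  have zz: "z k * cnj (z k) = 1" if "k \<in> halfs X" for k
    using z that complex_norm_square[of "z k"] by (simp add: unit_voltage_def)
  have zf: "z (flip X k) = cnj (z k)" if "k \<in> halfs X" for k
    using z that by (simp add: unit_voltage_def)
  have \<psi>: "\<psi> (rt X (flip X k)) = z k * \<psi> (rt X k)" if k: "k \<in> halfs X" "edge_of X k \<noteq> ?e" for k
  proof -
    have "edge_of X k \<in> \<sigma> ` (verts X - {q})" using bij k by (auto simp: bij_betw_def)
    then obtain v where v: "v \<in> verts X - {q}" "edge_of X k = edge_of X (par v)" by (auto simp: \<sigma>_def)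
    have vY: "v \<in> verts ?Y - {q}" using v by simp
    have p: "par v \<in> halfs X" "rt X (par v) = v" using parent_mapD(1,2)[OF pm vY] by auto
    have "k = par v \<or> k = flip X (par v)" using v(2) edge_of_eq_iff[OF p(1)] by metis
    thus ?thesis
    proof
      assume "k = par v"
      thus ?thesis using \<psi>p[OF v(1)] p by simp
    next
      assume k: "k = flip X (par v)"
      have "z k * \<psi> (rt X k) = (z (par v) * cnj (z (par v))) * \<psi> v"
        unfolding k \<psi>p[OF v(1)] zf[OF p(1)] by simp
      thus ?thesis using zz[OF p(1)] p flip_flip[OF p(1)] k by simp
    qed
  qed
  \<comment> \<open>The deleted edge is matched with \<open>q\<close>, the one vertex without a
    parent edge.\<close>
  define \<tau> where "\<tau> = \<sigma>(q := ?e)"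
  have "bij_betw \<tau> (verts X - {q}) (edges X - {?e}) = bij_betw \<sigma> (verts X - {q}) (edges X - {?e})"
    by (rule bij_betw_cong) (simp add: \<tau>_def)
  hence "bij_betw \<tau> (verts X - {q} \<union> {q}) (edges X - {?e} \<union> {?e})"
    using bij by (intro bij_betw_combine) (auto simp: \<tau>_def)
  hence bij\<tau>: "bij_betw \<tau> (verts X) (edges X)" using q e by (simp add: insert_absorb)
  let ?M = "\<lambda>x y. incidence X ori z x (\<tau> y)"
  have comb: "(\<Sum>x\<in>verts X. \<psi> x * incidence X ori z x e') =
      \<psi> (rt X (ori e')) - \<psi> (rt X (flip X (ori e'))) * z (flip X (ori e'))" if "e' \<in> edges X" for e'
  proof -
    have o: "ori e' \<in> halfs X" using orientation_half[OF ori that] by simp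
    have "(\<Sum>x\<in>verts X. \<psi> x * incidence X ori z x e') =
      (\<Sum>x\<in>verts X. (if x = rt X (ori e') then \<psi> x else 0) -
        (if x = rt X (flip X (ori e')) then \<psi> x * z (flip X (ori e')) else 0))"
      by (rule sum.cong) (auto simp: incidence_def algebra_simps)
    thus ?thesis
      using finite_verts rt_closed[OF o] rt_closed[OF flip_closed[OF o]] by (simp add: sum_subtractf)
  qed
  have comb0: "(\<Sum>x\<in>verts X. \<psi> x * incidence X ori z x e') = 0" if e': "e' \<in> edges X" "e' \<noteq> ?e" for e'
  proof -
    note o = orientation_half[OF ori e'(1)]
    have "z (flip X (ori e')) * (z (ori e') * \<psi> (rt X (ori e'))) = (z (ori e') * cnj (z (ori e'))) * \<psi> (rt X (ori e'))"
      unfolding zf[OF o(1)] by simp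
    thus ?thesis using \<psi>[OF o(1)] o(2) e'(2) zz[OF o(1)] unfolding comb[OF e'(1)] by (simp add: mult_ac)
  qed
  define \<kappa> where "\<kappa> = (\<Sum>x\<in>verts X. \<psi> x * incidence X ori z x ?e)"
  have "\<psi> q * sdet (verts X) ?M =
      sdet (verts X) (\<lambda>i j. if i = q then \<Sum>k\<in>verts X. \<psi> k * ?M k j else ?M i j)"
    by (rule sdet_combine_row[OF finite_verts q, symmetric])
  also have "\<dots> = sdet ({q} \<union> (verts X - {q})) (\<lambda>i j. if i = q then \<Sum>k\<in>verts X. \<psi> k * ?M k j else ?M i j)"
    using q by (intro sdet_cong) auto
  also have "\<dots> = sdet {q} (\<lambda>i j. if i = q then \<Sum>k\<in>verts X. \<psi> k * ?M k j else ?M i j) *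
      sdet (verts X - {q}) (\<lambda>i j. if i = q then \<Sum>k\<in>verts X. \<psi> k * ?M k j else ?M i j)"
  proof (rule sdet_block)
    fix i j assume ij: "i \<in> {q}" "j \<in> verts X - {q}"
    hence "\<tau> j \<in> edges X - {?e}" using bij by (auto simp: \<tau>_def bij_betw_def)
    thus "(if i = q then \<Sum>k\<in>verts X. \<psi> k * ?M k j else ?M i j) = 0" using ij comb0 by simp
  qed (use finite_verts in auto)
  also have "sdet {q} (\<lambda>i j. if i = q then \<Sum>k\<in>verts X. \<psi> k * ?M k j else ?M i j) = \<kappa>"
    by (simp add: sdet_def \<kappa>_def \<tau>_def)
  also have "sdet (verts X - {q}) (\<lambda>i j. if i = q then \<Sum>k\<in>verts X. \<psi> k * ?M k j else ?M i j) =
      sdet (verts X - {q}) (\<lambda>x y. incidence X ori z x (\<sigma> y))"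
    by (rule sdet_cong) (auto simp: \<tau>_def)
  finally have "cmod (\<psi> q * sdet (verts X) ?M) = cmod \<kappa>" using minor by (simp add: norm_mult)
  hence det: "cmod (sdet (verts X) ?M) = cmod \<kappa>" using \<psi>1 by (simp add: norm_mult)
  \<comment> \<open>Walking from the far end of \<open>?h\<close> along the remaining edges of the
    cycle multiplies \<psi> by their voltages; the deleted edge is never crossed.\<close>
  have walk: "n < length c \<Longrightarrow>
      \<psi> (rt X (flip X (c ! n))) = prod_list (map z (take n (tl c))) * \<psi> (rt X (flip X ?h))" for n
  proof (induction n)
    case (Suc n)
    have k: "c ! Suc n \<in> halfs X" using halfs Suc.prems nth_mem by blast
    have "edge_of X (c ! Suc n) \<noteq> ?e"
      using de Suc.prems ne unfolding h(2) by (subst (asm) distinct_conv_nth) force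
    moreover have "rt X (flip X (c ! n)) = rt X (c ! Suc n)" using chain[of n] Suc.prems by simp
    ultimately have "\<psi> (rt X (flip X (c ! Suc n))) = z (c ! Suc n) * \<psi> (rt X (flip X (c ! n)))"
      using \<psi>[OF k] by simp
    moreover have "take (Suc n) (tl c) = take n (tl c) @ [c ! Suc n]"
      using Suc.prems by (simp add: take_Suc_conv_app_nth nth_tl)
    ultimately show ?case using Suc by (simp add: mult_ac)
  qed (simp add: h(2))
  have "Suc (length c - 1) mod length c = 0" using ne by simp
  hence "rt X (flip X (c ! (length c - 1))) = rt X ?h" using chain[of "length c - 1"] ne h(2) by simp
  hence close: "\<psi> (rt X ?h) = prod_list (map z (tl c)) * \<psi> (rt X (flip X ?h))"
    using walk[of "length c - 1"] ne by simp
  have P: "prod_list (map z c) = z ?h * prod_list (map z (tl c))" using ne by (cases c) auto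
  let ?w = "\<psi> (rt X (flip X ?h))"
  have \<kappa>: "\<kappa> = \<psi> (rt X (ori ?e)) - \<psi> (rt X (flip X (ori ?e))) * z (flip X (ori ?e))"
    unfolding \<kappa>_def by (rule comb[OF e])
  \<comment> \<open>Either orientation of the deleted edge yields the holonomy defect
    \<open>1 - prod_list (map z c)\<close>, up to sign and factors of modulus 1.\<close>
  have "cmod \<kappa> = cmod (1 - prod_list (map z c))"
    using orientation_cases[OF ori h(1)]
  proof
    assume "ori ?e = ?h"
    hence "z ?h * \<kappa> = z ?h * \<psi> (rt X ?h) - (z ?h * cnj (z ?h)) * ?w"
      by (simp add: \<kappa> zf[OF h(1)] algebra_simps)
    also have "\<dots> = (prod_list (map z c) - 1) * ?w"
      unfolding zz[OF h(1)] close P by (simp add: algebra_simps)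
    finally have "cmod (z ?h * \<kappa>) = cmod ((prod_list (map z c) - 1) * ?w)" by simp
    moreover have "cmod (z ?h) = 1" using z h(1) by (simp add: unit_voltage_def)
    ultimately show ?thesis using \<psi>1 by (simp add: norm_mult norm_minus_commute)
  next
    assume "ori ?e = flip X ?h"
    hence "\<kappa> = ?w - \<psi> (rt X ?h) * z ?h" using flip_flip[OF h(1)] by (simp add: \<kappa>)
    also have "\<dots> = (1 - prod_list (map z c)) * ?w" unfolding close P by (simp add: algebra_simps)
    finally show ?thesis using \<psi>1 by (simp add: norm_mult)
  qed
  thus ?thesis using bij\<tau> det by auto
qed

text \<open>Connectedness gives |V| <= |E| + 1, so |V - S| = |E| leaves at most one vertex in
  \<open>S\<close>: none forces genus one, exactly one forces a tree.\<close>

lemma good_component_iff_card: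
  assumes conn: "connected_hgraph X"
  shows "good_component S X \<longleftrightarrow> card (verts X - S) = card (edges X)"
proof -
  have split: "card (verts X) = card (verts X - S) + card (verts X \<inter> S)"
    using finite_verts by (subst card_Un_disjoint[symmetric]) (auto intro: arg_cong[where f = card])
  have one: "(\<exists>!v. v \<in> verts X \<and> v \<in> S) \<longleftrightarrow> card (verts X \<inter> S) = 1"
    by (auto simp: card_1_singleton_iff set_eq_iff Ex1_def)
  have zero: "verts X \<inter> S = {} \<longleftrightarrow> card (verts X \<inter> S) = 0" using finite_verts by simp
  have tree: "is_tree X \<longleftrightarrow> card (verts X) = card (edges X) + 1"
    using tree_card is_tree_if_card[OF conn] by blast
  have "genus X = 1 \<longleftrightarrow> card (verts X) = card (edges X)" by (auto simp: genus_def)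
  thus ?thesis
    unfolding good_component_def tree one zero using split card_verts_le[OF conn] by linarith
qed

lemma component_minor:
  assumes conn: "connected_hgraph X" and good: "good_component S X"
    and ori: "orientation X ori" and z: "unit_voltage X z"
  shows "\<exists>\<sigma>. bij_betw \<sigma> (verts X - S) (edges X) \<and>
    (cmod (sdet (verts X - S) (\<lambda>x y. incidence X ori z x (\<sigma> y))))\<^sup>2 = component_wt z S X"
proof (cases "genus X = 1 \<and> verts X \<inter> S = {}")
  case True
  hence "card (verts X) = card (edges X)" by (auto simp: genus_def)
  moreover from this have "is_cycle X (SOME c. is_cycle X c)"
    by (intro someI_ex[of "is_cycle X"] cycle_exists[OF conn]) simp
  moreover have "verts X - S = verts X" using True by blast
  ultimately show ?thesis
    using unicyclic_minor[OF conn _ _ ori z] True by (auto simp: component_wt_def component_value_def)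
next
  case False
  hence "is_tree X" "\<exists>!v. v \<in> verts X \<and> v \<in> S" using good by (auto simp: good_component_def)
  then obtain q where q: "q \<in> verts X" "q \<in> S" "\<And>v. v \<in> verts X \<Longrightarrow> v \<in> S \<Longrightarrow> v = q" by blast
  obtain r par where pm: "parent_map X q r par" using parents_exist[OF conn q(1)] by blast
  \<comment> \<open>The tree is rooted at its unique vertex in \<open>S\<close>, whose row is the
    one already absent.\<close>
  have "verts X - S = verts X - {q}" using q by blast
  thus ?thesis
    using tree_minor[OF tree_card[OF \<open>is_tree X\<close>] q(1) pm ori z] False
    unfolding component_wt_def by (intro exI[of _ "\<lambda>v. edge_of X (par v)"]) auto
qed

section \<open>From connected graphs to arbitrary edge sets\<close>

lemma component_props:
  assumes C: "C \<in> components X"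
  shows "hgraph C" "connected_hgraph C" "rt C = rt X" "flip C = flip X" "halfs C \<subseteq> halfs X" "edges C \<subseteq> edges X"
  using C hgraph_component_of connected_component_of component_edges[OF C] by (auto simp: components_def)

lemma card_verts_components: "card (verts X - S) = (\<Sum>C\<in>components X. card (verts C - S))"
proof -
  have "{v \<in> verts X - S. component_of X v = C} = verts C - S" if "C \<in> components X" for C
    using component_verts[OF that] by auto
  moreover have "card (verts X - S) = (\<Sum>C\<in>components X. card {v \<in> verts X - S. component_of X v = C})"
    using finite_verts finite_components by (intro card_eq_sum_fibers) (auto simp: components_def)
  ultimately show ?thesis by simp
qed

lemma card_edges_components: "card (edges X) = (\<Sum>C\<in>components X. card (edges C))"
proof -
  have "card (edges X) = (\<Sum>C\<in>components X. card {e \<in> edges X. edge_component e = C})"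
    using finite_edges finite_components edge_component_in by (intro card_eq_sum_fibers) auto
  thus ?thesis using component_edges by simp
qed

lemma component_good_iff_card:
  assumes C: "C \<in> components X"
  shows "good_component S C \<longleftrightarrow> card (verts C - S) = card (edges C)"
proof -
  interpret C: hgraph C by (rule component_props[OF C])
  show ?thesis by (rule C.good_component_iff_card[OF component_props(2)[OF C]])
qed

lemma components_cover_card:
  assumes "\<forall>C \<in> components X. good_component S C"
  shows "card (verts X - S) = card (edges X)"
  using assms component_good_iff_card by (simp add: card_verts_components card_edges_components)

text \<open>If all components are good, vertices and edges match within each component and the
  matrix is block diagonal. Otherwise some component has more rows than columns, and its rows have
  too small a support.\<close>

lemma edge_set_minor:
  assumes card: "card (verts X - S) = card (edges X)"
    and ori: "orientation X ori" and z: "unit_voltage X z"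
  shows "\<exists>\<sigma>. bij_betw \<sigma> (verts X - S) (edges X) \<and>
    (cmod (sdet (verts X - S) (\<lambda>x y. incidence X ori z x (\<sigma> y))))\<^sup>2 =
    (if \<forall>C \<in> components X. good_component S C then \<Prod>C\<in>components X. component_wt z S C else 0)"
proof (cases "\<forall>C \<in> components X. good_component S C")
  case True
  have "\<exists>\<sigma>. bij_betw \<sigma> (verts C - S) (edges C) \<and>
    (cmod (sdet (verts C - S) (\<lambda>x y. incidence X ori z x (\<sigma> y))))\<^sup>2 = component_wt z S C"
    if C: "C \<in> components X" for C
  proof -
    note P = component_props[OF C]
    interpret C: hgraph C by (rule P)
    show ?thesis
      using C.component_minor[OF P(2) _ orientation_subgraph[OF ori P(6)] unit_voltage_subgraph[OF z P(5,4)]]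
        True C incidence_cong[OF P(3,4)] by simp
  qed
  then obtain \<sigma> where \<sigma>: "\<And>C. C \<in> components X \<Longrightarrow> bij_betw (\<sigma> C) (verts C - S) (edges C)"
    "\<And>C. C \<in> components X \<Longrightarrow>
      (cmod (sdet (verts C - S) (\<lambda>x y. incidence X ori z x (\<sigma> C y))))\<^sup>2 = component_wt z S C"
    by metis
  define \<tau> where "\<tau> v = \<sigma> (component_of X v) v" for v
  have comp: "component_of X v \<in> components X" if "v \<in> verts X" for v
    using that by (simp add: components_def)
  have W: "{v \<in> verts X - S. component_of X v = C} = verts C - S" if "C \<in> components X" for C
    using component_verts[OF that] by auto
  have mem: "\<tau> v \<in> edges X" "edge_component (\<tau> v) = component_of X v" if "v \<in> verts X - S" for v
  proof -
    have "v \<in> verts (component_of X v) - S" using that by simp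
    hence "\<tau> v \<in> edges (component_of X v)"
      unfolding \<tau>_def using \<sigma>(1)[OF comp[of v]] that by (auto simp: bij_betw_def)
    thus "\<tau> v \<in> edges X" "edge_component (\<tau> v) = component_of X v"
      using component_edges[OF comp[of v]] that by auto
  qed
  have inj: "inj_on \<tau> (verts X - S)"
  proof (rule inj_onI)
    fix v w assume vw: "v \<in> verts X - S" "w \<in> verts X - S" "\<tau> v = \<tau> w"
    hence eq: "component_of X v = component_of X w" using mem by metis
    have "v \<in> verts (component_of X v) - S" using vw by simp
    moreover have "w \<in> verts (component_of X v) - S" unfolding eq using vw by simp
    moreover have "\<sigma> (component_of X v) v = \<sigma> (component_of X v) w" using vw(3) eq by (simp add: \<tau>_def)
    ultimately show "v = w" using \<sigma>(1)[OF comp[of v]] vw(1) by (auto simp: bij_betw_def inj_on_def)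
  qed
  have "\<tau> ` (verts X - S) \<subseteq> edges X" using mem by blast
  hence bij: "bij_betw \<tau> (verts X - S) (edges X)"
    using inj card card_image[OF inj] finite_edges by (simp add: bij_betw_def card_subset_eq)
  let ?M = "\<lambda>x y. incidence X ori z x (\<tau> y)"
  have "sdet (verts X - S) ?M = (\<Prod>C\<in>components X. sdet {v \<in> verts X - S. component_of X v = C} ?M)"
  proof (rule sdet_blocks)
    show "component_of X ` (verts X - S) \<subseteq> components X" using comp by blast
    fix x y assume xy: "x \<in> verts X - S" "y \<in> verts X - S" "component_of X x \<noteq> component_of X y"
    note o = orientation_half[OF ori mem(1)[OF xy(2)]]
    have "component_of X (rt X (ori (\<tau> y))) = component_of X y"
      using edge_component_eq[OF o(1)] o(2) mem(2)[OF xy(2)] by simp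
    moreover have "component_of X (rt X (flip X (ori (\<tau> y)))) = component_of X y"
      using edge_component_eq[OF flip_closed[OF o(1)]] edge_of_flip[OF o(1)] o(2) mem(2)[OF xy(2)] by simp
    ultimately show "?M x y = 0" using xy(3) by (auto simp: incidence_def)
  qed (use finite_verts finite_components in auto)
  also have "\<dots> = (\<Prod>C\<in>components X. sdet (verts C - S) (\<lambda>x y. incidence X ori z x (\<sigma> C y)))"
    using W component_verts by (intro prod.cong sdet_cong) (auto simp: \<tau>_def)
  finally have "(cmod (sdet (verts X - S) ?M))\<^sup>2 =
      (\<Prod>C\<in>components X. (cmod (sdet (verts C - S) (\<lambda>x y. incidence X ori z x (\<sigma> C y))))\<^sup>2)"
    by (simp add: prod_norm[symmetric] prod_power_distrib del: prod_norm)
  also have "\<dots> = (\<Prod>C\<in>components X. component_wt z S C)" using \<sigma>(2) by (rule prod.cong[OF refl])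
  finally show ?thesis using True bij by (intro exI[of _ \<tau>]) simp
next
  case False
  have sums: "(\<Sum>C\<in>components X. card (verts C - S)) = (\<Sum>C\<in>components X. card (edges C))"
    using card card_verts_components[of S] card_edges_components by simp
  \<comment> \<open>The totals agree, so a mismatch somewhere forces a surplus of vertices in some
    component.\<close>
  have "\<exists>C\<in>components X. card (edges C) < card (verts C - S)"
  proof (rule ccontr)
    assume "\<not> ?thesis"
    hence le: "\<And>C. C \<in> components X \<Longrightarrow> card (verts C - S) \<le> card (edges C)" by force
    moreover have "\<exists>C\<in>components X. card (verts C - S) < card (edges C)"
      using False component_good_iff_card le le_neq_trans by blast
    ultimately have "(\<Sum>C\<in>components X. card (verts C - S)) < (\<Sum>C\<in>components X. card (edges C))"
      using finite_components by (intro sum_strict_mono_ex1) auto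
    thus False using sums by simp
  qed
  then obtain C where C: "C \<in> components X" "card (edges C) < card (verts C - S)" by blast
  note vC = component_verts[OF C(1)] and eC = component_edges[OF C(1)]
  obtain \<sigma> where \<sigma>: "bij_betw \<sigma> (verts X - S) (edges X)"
    using finite_same_card_bij[OF _ _ card] finite_verts finite_edges by blast
  \<comment> \<open>The columns whose edge lies in \<open>C\<close>, too few for the rows of
    \<open>C\<close>.\<close>
  let ?W' = "{v \<in> verts X - S. \<sigma> v \<in> edges C}"
  have "sdet (verts X - S) (\<lambda>x y. incidence X ori z x (\<sigma> y)) = 0"
  proof (rule sdet_rank_zero[where W = "verts C - S" and W' = ?W'])
    have "finite (edges C)" using finite_edges by (simp add: eC)
    hence "card ?W' \<le> card (edges C)"
      using \<sigma> by (intro card_inj_on_le[where f = \<sigma>]) (auto simp: bij_betw_def inj_on_def)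
    thus "card ?W' < card (verts C - S)" using C(2) by simp
    fix x y assume xy: "x \<in> verts C - S" "y \<in> (verts X - S) - ?W'"
    have y: "\<sigma> y \<in> edges X" "edge_component (\<sigma> y) \<noteq> C" using xy(2) \<sigma> eC by (auto simp: bij_betw_def)
    note o = orientation_half[OF ori y(1)]
    have "component_of X (rt X (ori (\<sigma> y))) \<noteq> C"
      using edge_component_eq[OF o(1)] o(2) y(2) by simp
    moreover have "component_of X (rt X (flip X (ori (\<sigma> y)))) \<noteq> C"
      using edge_component_eq[OF flip_closed[OF o(1)]] edge_of_flip[OF o(1)] o(2) y(2) by simp
    ultimately show "incidence X ori z x (\<sigma> y) = 0" using xy(1) vC by (auto simp: incidence_def)
  qed (use finite_verts vC in auto)
  thus ?thesis unfolding if_not_P[OF False] using \<sigma> by (intro exI[of _ \<sigma>]) simp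
qed

text \<open>Cauchy-Binet for the incidence matrix times its conjugate transpose gives squared moduli
  of minors, one for each set \<open>T\<close> of retained edges; the sets \<open>F\<close> of the
  statement are the complements.\<close>

theorem voltage_matrix_tree:
  assumes ori: "orientation X ori" and z: "unit_voltage X z"
  shows "sdet (verts X - S) (twisted_laplacian X z) =
    of_real (\<Sum>F | F \<subseteq> edges X \<and> (\<forall>C \<in> components (delete_edges X F). good_component S C).
      \<Prod>C\<in>components (delete_edges X F). component_wt z S C)"
proof -
  let ?U = "verts X - S" and ?E = "edges X"
  let ?Y = "\<lambda>T. delete_edges X (?E - T)"
  let ?good = "\<lambda>Y. \<forall>C \<in> components Y. good_component S C"
  let ?w = "\<lambda>Y. \<Prod>C\<in>components Y. component_wt z S C"
  have fin: "finite ?U" "finite ?E" using finite_verts finite_edges by auto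
  have Y: "hgraph (?Y T)" "edges (?Y T) = T" if "T \<subseteq> ?E" for T
    using that hgraph_delete_edges[of "?E - T"] edges_delete_edges[of "?E - T"] by auto
  define P where "P T \<sigma> \<longleftrightarrow> bij_betw \<sigma> ?U T \<and>
      (cmod (sdet ?U (\<lambda>x y. incidence X ori z x (\<sigma> y))))\<^sup>2 = (if ?good (?Y T) then ?w (?Y T) else 0)"
    for T \<sigma>
  have "\<exists>\<sigma>. P T \<sigma>"
    if T: "T \<subseteq> ?E" "card T = card ?U" for T
  proof -
    interpret Y: hgraph "?Y T" by (rule Y(1)[OF T(1)])
    have "orientation (?Y T) ori" using ori Y(2)[OF T(1)] T(1) by (auto intro: orientation_subgraph)
    moreover have "unit_voltage (?Y T) z" using z by (rule unit_voltage_subgraph) auto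
    ultimately show ?thesis
      using Y.edge_set_minor[of S ori z] T Y(2)[OF T(1)] incidence_cong[of "?Y T" X ori z]
      by (simp add: P_def)
  qed
  then obtain \<sigma> where "\<And>T. T \<subseteq> ?E \<Longrightarrow> card T = card ?U \<Longrightarrow> P T (\<sigma> T)" by metis
  hence \<sigma>: "\<And>T. T \<subseteq> ?E \<Longrightarrow> card T = card ?U \<Longrightarrow> bij_betw (\<sigma> T) ?U T"
    "\<And>T. T \<subseteq> ?E \<Longrightarrow> card T = card ?U \<Longrightarrow>
      (cmod (sdet ?U (\<lambda>x y. incidence X ori z x (\<sigma> T y))))\<^sup>2 = (if ?good (?Y T) then ?w (?Y T) else 0)"
    for T unfolding P_def by blast+
  have cnj_sdet: "cnj (sdet ?U A) = sdet ?U (\<lambda>i j. cnj (A i j))" for A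
    by (simp add: sdet_def)
  have "sdet ?U (twisted_laplacian X z) =
      sdet ?U (\<lambda>i j. \<Sum>e\<in>?E. incidence X ori z i e * cnj (incidence X ori z j e))"
    by (rule sdet_cong) (auto simp: twisted_laplacian_factor[OF ori z])
  also have "\<dots> = (\<Sum>T | T \<subseteq> ?E \<and> card T = card ?U.
      sdet ?U (\<lambda>i j. incidence X ori z i (\<sigma> T j)) * sdet ?U (\<lambda>i j. cnj (incidence X ori z j (\<sigma> T i))))"
    by (rule sdet_cauchy_binet[OF fin \<sigma>(1)])
  also have "\<dots> = (\<Sum>T | T \<subseteq> ?E \<and> card T = card ?U. of_real (if ?good (?Y T) then ?w (?Y T) else 0))"
  proof (rule sum.cong)
    fix T assume "T \<in> {T. T \<subseteq> ?E \<and> card T = card ?U}"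
    hence T: "T \<subseteq> ?E" "card T = card ?U" by auto
    let ?d = "sdet ?U (\<lambda>i j. incidence X ori z i (\<sigma> T j))"
    have "sdet ?U (\<lambda>i j. cnj (incidence X ori z j (\<sigma> T i))) = cnj ?d"
      unfolding cnj_sdet by (rule sdet_transpose[OF fin(1)])
    thus "?d * sdet ?U (\<lambda>i j. cnj (incidence X ori z j (\<sigma> T i))) =
        of_real (if ?good (?Y T) then ?w (?Y T) else 0)"
      unfolding \<sigma>(2)[OF T, symmetric] using complex_norm_square[of ?d] by simp
  qed simp
  also have "\<dots> = of_real (\<Sum>T | T \<subseteq> ?E \<and> card T = card ?U. if ?good (?Y T) then ?w (?Y T) else 0)"
    by simp
  also have "(\<Sum>T | T \<subseteq> ?E \<and> card T = card ?U. if ?good (?Y T) then ?w (?Y T) else 0) =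
      (\<Sum>T | T \<subseteq> ?E \<and> ?good (?Y T). ?w (?Y T))"
  proof (rule sum.mono_neutral_cong)
    \<comment> \<open>No such \<open>T\<close> exists: good components force |T| = |V - S|.\<close>
    fix T assume "T \<in> {T. T \<subseteq> ?E \<and> ?good (?Y T)} - {T. T \<subseteq> ?E \<and> card T = card ?U}"
    hence T: "T \<subseteq> ?E" "?good (?Y T)" "card T \<noteq> card ?U" by auto
    interpret Y: hgraph "?Y T" by (rule Y(1)[OF T(1)])
    show "?w (?Y T) = 0" using Y.components_cover_card[OF T(2)] Y(2)[OF T(1)] T(3) by simp
  qed (use fin in auto)
  also have "\<dots> = (\<Sum>F | F \<subseteq> ?E \<and> ?good (delete_edges X F). ?w (delete_edges X F))"
    by (rule sum.reindex_bij_witness[where i = "\<lambda>F. ?E - F" and j = "\<lambda>T. ?E - T"])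
       (auto simp: double_diff)
  finally show ?thesis .
qed

end

section \<open>The Jacobian and spanning trees\<close>

context hgraph
begin

section \<open>The untwisted case: counting spanning trees\<close>

lemma adjacency_sum:
  "adjacency X u v = (\<Sum>h \<in> halfs X. of_bool (rt X h = u) * of_bool (rt X (flip X h) = v))"
proof -
  have "(\<Sum>h \<in> halfs X. of_bool (rt X h = u) * of_bool (rt X (flip X h) = v)) =
      (\<Sum>h \<in> halfs X. of_bool (rt X h = u \<and> rt X (flip X h) = v) :: int)"
    by (rule sum.cong) auto
  also have "\<dots> = adjacency X u v"
    using finite_halfs by (simp add: adjacency_def Int_def)
  finally show ?thesis by simp
qed

lemma val_sum: "int (val X u) = (\<Sum>h \<in> halfs X. of_bool (rt X h = u))"
  using finite_halfs by (simp add: val_def tangent_def Int_def)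

text \<open>Brings the Laplacian into the shape of \<open>twisted_laplacian\<close>; a half-edge of
  a loop contributes zero.\<close>

lemma laplacian_entry_sum:
  "laplacian_entry X u v =
     (\<Sum>h \<in> halfs X. of_bool (rt X h = u) * (of_bool (u = v) - of_bool (rt X (flip X h) = v)))"
proof -
  have "laplacian_entry X u v = int (val X u) * of_bool (u = v) - adjacency X u v"
    by (simp add: laplacian_entry_def)
  also have "\<dots> = (\<Sum>h \<in> halfs X. of_bool (rt X h = u) * (of_bool (u = v) - of_bool (rt X (flip X h) = v)))"
    unfolding val_sum adjacency_sum sum_distrib_right sum_subtractf[symmetric]
    by (rule sum.cong) (auto simp: algebra_simps)
  finally show ?thesis .
qed

lemma twisted_laplacian_trivial:
  "twisted_laplacian X (\<lambda>_. 1) u v = of_int (laplacian_entry X u v)"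
  by (simp add: twisted_laplacian_def laplacian_entry_sum of_int_sum)

lemma adjacency_sym: "adjacency X u v = adjacency X v u"
proof -
  have "bij_betw (flip X) {h \<in> halfs X. rt X h = u \<and> rt X (flip X h) = v}
      {h \<in> halfs X. rt X h = v \<and> rt X (flip X h) = u}"
    by (rule bij_betw_byWitness[where f' = "flip X"]) (auto simp: flip_flip flip_closed)
  thus ?thesis using bij_betw_same_card by (auto simp: adjacency_def)
qed

lemma laplacian_entry_sym: "laplacian_entry X u v = laplacian_entry X v u"
  using adjacency_sym by (auto simp: laplacian_entry_def)

lemma laplacian_row_sum:
  assumes u: "u \<in> verts X"
  shows "(\<Sum>v \<in> verts X. laplacian_entry X u v) = 0"
proof -
  have "(\<Sum>v \<in> verts X. of_bool (u = v) - of_bool (rt X (flip X h) = v) :: int) = 0" if "h \<in> halfs X" for h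
  proof -
    have "(\<Sum>v \<in> verts X. of_bool (w = v) :: int) = 1" if "w \<in> verts X" for w
      using that finite_verts by (simp add: of_bool_def)
    thus ?thesis using u rt_closed[OF flip_closed[OF that]] by (simp add: sum_subtractf)
  qed
  thus ?thesis
    unfolding laplacian_entry_sum by (subst sum.swap) (simp add: sum_distrib_left[symmetric])
qed

lemma laplacian_column_sum:
  "v \<in> verts X \<Longrightarrow> (\<Sum>u \<in> verts X. laplacian_entry X u v) = 0"
  using laplacian_row_sum by (subst laplacian_entry_sym)

lemma laplacian_complex_sums:
  "i \<in> verts X \<Longrightarrow> (\<Sum>j\<in>verts X. complex_of_int (laplacian_entry X i j)) = 0"
  "j \<in> verts X \<Longrightarrow> (\<Sum>i\<in>verts X. complex_of_int (laplacian_entry X i j)) = 0"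
  using laplacian_row_sum laplacian_column_sum by (metis of_int_0 of_int_sum)+

text \<open>With voltage 1 every genus-one component weighs |1 - 1|^2 = 0. A nonzero term thus has
  only tree components, each containing \<open>q\<close>, hence just one.\<close>

lemma tree_iff_component_wt:
  assumes q: "q \<in> verts X"
  shows "(if \<forall>C \<in> components X. good_component {q} C
      then \<Prod>C\<in>components X. component_wt (\<lambda>_. 1) {q} C else 0) = of_bool (is_tree X)"
proof (cases "is_tree X")
  case True
  hence "connected_hgraph X" by (simp add: is_tree_def)
  hence "components X = {X}" using component_of_connected q by (auto simp: components_def)
  moreover have "good_component {q} X" using True q by (auto simp: good_component_def)
  ultimately show ?thesis using True tree_card[OF True] by (simp add: component_wt_def genus_def)
next
  case False
  have "(\<Prod>C\<in>components X. component_wt (\<lambda>_. 1) {q} C) = 0"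
    if good: "\<forall>C \<in> components X. good_component {q} C"
  proof (rule ccontr)
    assume "\<not> ?thesis"
    hence nz: "component_wt (\<lambda>_. 1) {q} C \<noteq> 0" if "C \<in> components X" for C
      using that prod_zero[of "components X" "component_wt (\<lambda>_. 1) {q}"] finite_components by blast
    have tree: "is_tree C" "q \<in> verts C" if C: "C \<in> components X" for C
    proof -
      have "component_value (\<lambda>_. 1) C = 1"
        by (simp add: component_value_def map_replicate_const prod_list_replicate)
      hence "\<not> (genus C = 1 \<and> verts C \<inter> {q} = {})" using nz[OF C] by (auto simp: component_wt_def split: if_splits)
      thus "is_tree C" "q \<in> verts C" using good C by (auto simp: good_component_def)
    qed
    have "(v, q) \<in> (adj_rel X)\<^sup>*" if "v \<in> verts X" for v
      using tree(2)[of "component_of X v"] that by (simp add: components_def)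
    hence "connected_hgraph X" by (rule connectedI[OF q])
    hence "X \<in> components X"
      using component_of_connected[of q] q unfolding components_def by (metis imageI)
    thus False using tree(1) False by blast
  qed
  thus ?thesis using False by simp
qed

theorem matrix_tree:
  assumes q: "q \<in> verts X"
  shows "sdet (verts X - {q}) (laplacian_entry X) = int (card (spanning_trees X))"
proof -
  define ori :: "'h set \<Rightarrow> 'h" where "ori e = (SOME h. h \<in> e)" for e
  have ori: "orientation X ori"
    unfolding orientation_def ori_def by (auto simp: some_in_eq edges_def edge_of_def)
  let ?E = "edges X"
  let ?F = "{F. F \<subseteq> ?E}"
  let ?w = "\<lambda>Y. \<Prod>C\<in>components Y. component_wt (\<lambda>_. 1) {q} C"
  let ?good = "\<lambda>Y. \<forall>C \<in> components Y. good_component {q} C"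
  have finF: "finite ?F" using finite_edges by (simp add: Pow_def[symmetric])
  have "complex_of_int (sdet (verts X - {q}) (laplacian_entry X)) =
      sdet (verts X - {q}) (twisted_laplacian X (\<lambda>_. 1))"
    unfolding sdet_of_int[symmetric] by (simp add: twisted_laplacian_trivial[abs_def])
  also have "\<dots> = of_real (\<Sum>F | F \<subseteq> ?E \<and> ?good (delete_edges X F). ?w (delete_edges X F))"
    by (rule voltage_matrix_tree[OF ori]) (simp add: unit_voltage_def)
  also have "(\<Sum>F | F \<subseteq> ?E \<and> ?good (delete_edges X F). ?w (delete_edges X F)) =
      (\<Sum>F\<in>?F. if ?good (delete_edges X F) then ?w (delete_edges X F) else 0)"
    using finF by (intro sum.mono_neutral_cong_left) auto
  also have "\<dots> = (\<Sum>F\<in>?F. of_bool (is_tree (delete_edges X F)))"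
  proof (rule sum.cong)
    fix F assume "F \<in> ?F"
    then interpret Y: hgraph "delete_edges X F" by (intro hgraph_delete_edges) auto
    show "(if ?good (delete_edges X F) then ?w (delete_edges X F) else 0) = of_bool (is_tree (delete_edges X F))"
      using Y.tree_iff_component_wt[of q] q by simp
  qed simp
  also have "\<dots> = real (card {F \<in> ?F. is_tree (delete_edges X F)})"
    using finF by (simp add: Int_def)
  also have "card {F \<in> ?F. is_tree (delete_edges X F)} = card (spanning_trees X)"
    by (rule bij_betw_same_card[of "\<lambda>F. ?E - F"], rule bij_betw_byWitness[where f' = "\<lambda>F. ?E - F"])
       (auto simp: spanning_trees_def double_diff)
  finally have "complex_of_int (sdet (verts X - {q}) (laplacian_entry X)) = of_int (int (card (spanning_trees X)))"
    by simp
  thus ?thesis by (simp only: of_int_eq_iff)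
qed

section \<open>The Jacobian as a quotient by the reduced lattice\<close>

lemma laplacian_in_Div0:
  assumes "x \<in> Divs X"
  shows "laplacian X x \<in> carrier (Div0 X)"
proof -
  have "(\<Sum>u \<in> verts X. laplacian X x u) = (\<Sum>v \<in> verts X. (\<Sum>u \<in> verts X. laplacian_entry X u v) * x v)"
    by (simp add: laplacian_def sum_distrib_right) (rule sum.swap)
  also have "\<dots> = 0" using laplacian_column_sum by simp
  finally show ?thesis by (simp add: Div0_def Divs_def laplacian_def)
qed

lemma laplacian_diff:
  "laplacian X (\<lambda>v. x v - y v) = (\<lambda>u. laplacian X x u - laplacian X y u)"
  by (simp add: laplacian_def fun_eq_iff sum_subtractf right_diff_distrib)

text \<open>Constants lie in the kernel of the Laplacian, so a preimage can be normalised to vanish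
  at \<open>q\<close>. Conversely the equation at \<open>q\<close> follows from the others, because
  both sides have total zero.\<close>

lemma principal_iff_lattice_cong:
  assumes q: "q \<in> verts X" and ab: "a \<in> carrier (Div0 X)" "b \<in> carrier (Div0 X)"
  shows "(\<lambda>v. a v - b v) \<in> laplacian X ` Divs X \<longleftrightarrow> lattice_cong (verts X - {q}) (laplacian_entry X) a b"
proof
  let ?U = "verts X - {q}"
  assume "(\<lambda>v. a v - b v) \<in> laplacian X ` Divs X"
  then obtain x where x: "(\<lambda>v. a v - b v) = laplacian X x" by blast
  have "a u - b u = (\<Sum>v\<in>?U. laplacian_entry X u v * (x v - x q))" if u: "u \<in> ?U" for u
  proof -
    have "a u - b u = (\<Sum>v\<in>verts X. laplacian_entry X u v * x v)"
      using fun_cong[OF x, of u] u by (simp add: laplacian_def)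
    also have "\<dots> = (\<Sum>v\<in>verts X. laplacian_entry X u v * x v) - (\<Sum>v\<in>verts X. laplacian_entry X u v) * x q"
      using laplacian_row_sum u by simp
    also have "\<dots> = (\<Sum>v\<in>verts X. laplacian_entry X u v * (x v - x q))"
      by (simp only: sum_distrib_right sum_subtractf right_diff_distrib)
    also have "\<dots> = (\<Sum>v\<in>?U. laplacian_entry X u v * (x v - x q))"
      using finite_verts q by (simp add: sum.remove[of _ q])
    finally show ?thesis .
  qed
  thus "lattice_cong ?U (laplacian_entry X) a b"
    unfolding lattice_cong_def by (intro exI[of _ "\<lambda>v. x v - x q"]) simp
next
  let ?U = "verts X - {q}"
  assume "lattice_cong ?U (laplacian_entry X) a b"
  then obtain x where x: "\<And>u. u \<in> ?U \<Longrightarrow> a u - b u = (\<Sum>v\<in>?U. laplacian_entry X u v * x v)"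
    unfolding lattice_cong_def by blast
  define x' where "x' v = (if v \<in> ?U then x v else 0)" for v
  have x'D: "x' \<in> Divs X" by (simp add: x'_def Divs_def)
  have U: "laplacian X x' u = a u - b u" if "u \<in> ?U" for u
  proof -
    have "laplacian X x' u = (\<Sum>v\<in>?U. laplacian_entry X u v * x' v)"
      using that finite_verts q by (simp add: laplacian_def sum.remove[of _ q] x'_def)
    also have "\<dots> = (\<Sum>v\<in>?U. laplacian_entry X u v * x v)"
      by (rule sum.cong) (auto simp: x'_def)
    finally show ?thesis using x[OF that] by simp
  qed
  have "(\<Sum>u\<in>verts X. laplacian X x' u) = (\<Sum>u\<in>verts X. a u - b u)"
    using laplacian_in_Div0[OF x'D] ab by (simp add: Div0_def sum_subtractf)
  moreover have "(\<Sum>u\<in>?U. laplacian X x' u) = (\<Sum>u\<in>?U. a u - b u)"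
    by (rule sum.cong) (simp_all add: U)
  ultimately have Q: "laplacian X x' q = a q - b q"
    using sum.remove[OF finite_verts q, of "laplacian X x'"] sum.remove[OF finite_verts q, of "\<lambda>u. a u - b u"]
    by simp
  have "laplacian X x' v = a v - b v" for v
  proof (cases "v \<in> verts X")
    case True
    thus ?thesis using U Q by (cases "v = q") auto
  next
    case False
    thus ?thesis using ab by (simp add: laplacian_def Div0_def Divs_def)
  qed
  hence "laplacian X x' = (\<lambda>v. a v - b v)" by (simp add: fun_eq_iff)
  thus "(\<lambda>v. a v - b v) \<in> laplacian X ` Divs X" using x'D by force
qed

lemma principal_coset_eq_iff:
  assumes ab: "a \<in> carrier (Div0 X)" "b \<in> carrier (Div0 X)"
  defines "H \<equiv> laplacian X ` Divs X"
  shows "H #>\<^bsub>Div0 X\<^esub> a = H #>\<^bsub>Div0 X\<^esub> b \<longleftrightarrow> (\<lambda>v. a v - b v) \<in> H"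
proof -
  have coset: "H #>\<^bsub>Div0 X\<^esub> c = {x. (\<lambda>v. x v - c v) \<in> H}" for c
  proof -
    have "(\<lambda>v. x v - c v) \<in> H \<longleftrightarrow> (\<exists>h\<in>H. x = (\<lambda>v. h v + c v))" for x
    proof
      assume "(\<lambda>v. x v - c v) \<in> H"
      thus "\<exists>h\<in>H. x = (\<lambda>v. h v + c v)" by (intro bexI[of _ "\<lambda>v. x v - c v"]) simp_all
    qed auto
    thus ?thesis by (auto simp: r_coset_def Div0_def)
  qed
  have zero: "(\<lambda>_. 0) \<in> H"
    unfolding H_def by (rule image_eqI[of _ _ "\<lambda>_. 0"]) (auto simp: laplacian_def Divs_def)
  have diff: "(\<lambda>v. g v - h v) \<in> H" if gh: "g \<in> H" "h \<in> H" for g h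
  proof -
    obtain x y where "x \<in> Divs X" "y \<in> Divs X" "g = laplacian X x" "h = laplacian X y"
      using gh by (auto simp: H_def)
    thus ?thesis unfolding H_def
      by (intro image_eqI[of _ _ "\<lambda>v. x v - y v"]) (auto simp: laplacian_diff Divs_def)
  qed
  show ?thesis
  proof
    assume "H #>\<^bsub>Div0 X\<^esub> a = H #>\<^bsub>Div0 X\<^esub> b"
    moreover have "a \<in> H #>\<^bsub>Div0 X\<^esub> a" using zero by (simp add: coset)
    ultimately show "(\<lambda>v. a v - b v) \<in> H" by (simp add: coset)
  next
    assume D: "(\<lambda>v. a v - b v) \<in> H"
    have neg: "(\<lambda>v. b v - a v) \<in> H" using diff[OF zero D] by simp
    have "(\<lambda>v. x v - a v) \<in> H \<longleftrightarrow> (\<lambda>v. x v - b v) \<in> H" for x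
      using diff[of "\<lambda>v. x v - a v" "\<lambda>v. b v - a v"] diff[of "\<lambda>v. x v - b v" "\<lambda>v. a v - b v"] D neg by auto
    thus "H #>\<^bsub>Div0 X\<^esub> a = H #>\<^bsub>Div0 X\<^esub> b" by (simp add: coset)
  qed
qed

text \<open>A divisor of degree zero is determined by its values off \<open>q\<close>, which
  identifies \<open>Jac X\<close> with the free module on the other vertices modulo the columns of
  the reduced Laplacian.\<close>

theorem order_Jac:
  assumes conn: "connected_hgraph X"
  shows "order (Jac X) = card (spanning_trees X)"
proof -
  obtain q where q: "q \<in> verts X" using conn by (auto simp: connected_hgraph_def)
  let ?U = "verts X - {q}" and ?L = "laplacian_entry X"
  let ?H = "laplacian X ` Divs X"
  have finU: "finite ?U" using finite_verts by simp
  have "spanning_trees X \<subseteq> Pow (edges X)" by (auto simp: spanning_trees_def)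
  hence "card (spanning_trees X) \<noteq> 0"
    using spanning_tree_exists[OF conn] finite_edges by (simp add: finite_subset)
  hence "sdet ?U ?L \<noteq> 0" using matrix_tree[OF q] by simp
  from lattice_index[OF finU this] obtain R where
    R: "int (card R) = \<bar>sdet ?U ?L\<bar>" "lattice_transversal ?U ?L R" by blast
  \<comment> \<open>Restores the value at \<open>q\<close> that makes the total zero; the congruence
    off \<open>q\<close> does not notice it.\<close>
  define ext where "ext r = r(q := - (\<Sum>u\<in>?U. r u))" for r :: "'v \<Rightarrow> int"
  have extD: "ext r \<in> carrier (Div0 X)" if "r \<in> R" for r
  proof -
    have "(\<Sum>u\<in>?U. ext r u) = (\<Sum>u\<in>?U. r u)" by (rule sum.cong) (auto simp: ext_def)
    moreover have "ext r q = - (\<Sum>u\<in>?U. r u)" by (simp add: ext_def)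
    ultimately have "(\<Sum>u\<in>verts X. ext r u) = 0"
      using sum.remove[OF finite_verts q, of "ext r"] by simp
    moreover have "ext r v = 0" if "v \<notin> verts X" for v
      using R(2) \<open>r \<in> R\<close> that q by (auto simp: ext_def lattice_transversal_def)
    ultimately show ?thesis by (simp add: Div0_def Divs_def)
  qed
  have cong_ext: "lattice_cong ?U ?L a (ext r) = lattice_cong ?U ?L a r"
    "lattice_cong ?U ?L (ext r) a = lattice_cong ?U ?L r a" for a r
    unfolding lattice_cong_def by (auto simp: ext_def)
  have eq: "?H #>\<^bsub>Div0 X\<^esub> a = ?H #>\<^bsub>Div0 X\<^esub> ext r \<longleftrightarrow> lattice_cong ?U ?L a r"
    if "a \<in> carrier (Div0 X)" "r \<in> R" for a r
    using principal_coset_eq_iff[OF that(1) extD[OF that(2)]]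
      principal_iff_lattice_cong[OF q that(1) extD[OF that(2)]] cong_ext by simp
  have unique: "\<exists>!r. r \<in> R \<and> lattice_cong ?U ?L a r" if "\<And>v. v \<notin> ?U \<Longrightarrow> a v = 0" for a
    using R(2) that unfolding lattice_transversal_def by blast
  have "bij_betw (\<lambda>r. ?H #>\<^bsub>Div0 X\<^esub> ext r) R (carrier (Jac X))"
  proof (rule bij_betw_imageI)
    show "inj_on (\<lambda>r. ?H #>\<^bsub>Div0 X\<^esub> ext r) R"
    proof (rule inj_onI)
      fix r s assume rs: "r \<in> R" "s \<in> R" "?H #>\<^bsub>Div0 X\<^esub> ext r = ?H #>\<^bsub>Div0 X\<^esub> ext s"
      have "lattice_cong ?U ?L r s" using rs eq[OF extD[OF rs(1)] rs(2)] cong_ext by simp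
      moreover have "lattice_cong ?U ?L r r" using eq[OF extD[OF rs(1)] rs(1)] cong_ext by simp
      moreover have "\<And>v. v \<notin> ?U \<Longrightarrow> r v = 0" using R(2) rs(1) unfolding lattice_transversal_def by blast
      ultimately show "r = s" using unique[of r] rs by blast
    qed
    show "(\<lambda>r. ?H #>\<^bsub>Div0 X\<^esub> ext r) ` R = carrier (Jac X)"
    proof
      show "(\<lambda>r. ?H #>\<^bsub>Div0 X\<^esub> ext r) ` R \<subseteq> carrier (Jac X)"
        using extD by (auto simp: Jac_def FactGroup_def RCOSETS_def)
      show "carrier (Jac X) \<subseteq> (\<lambda>r. ?H #>\<^bsub>Div0 X\<^esub> ext r) ` R"
      proof
        fix c assume "c \<in> carrier (Jac X)"
        then obtain a where a: "a \<in> carrier (Div0 X)" "c = ?H #>\<^bsub>Div0 X\<^esub> a"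
          by (auto simp: Jac_def FactGroup_def RCOSETS_def)
        have "(a(q := 0)) v = 0" if "v \<notin> ?U" for v using a(1) that by (auto simp: Div0_def Divs_def)
        then obtain r where r: "r \<in> R" "lattice_cong ?U ?L (a(q := 0)) r" using unique by blast
        hence "lattice_cong ?U ?L a r" unfolding lattice_cong_def by auto
        thus "c \<in> (\<lambda>r. ?H #>\<^bsub>Div0 X\<^esub> ext r) ` R" using eq[OF a(1) r(1)] a(2) r(1) by blast
      qed
    qed
  qed
  hence "order (Jac X) = card R" using bij_betw_same_card by (fastforce simp: order_def)
  thus ?thesis using R(1) matrix_tree[OF q] by simp
qed

end

section \<open>Characters of finite abelian groups\<close>

lemma charactersD:
  assumes "\<rho> \<in> characters G"
  shows "g \<in> carrier G \<Longrightarrow> \<rho> g \<noteq> 0"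
    and "g \<in> carrier G \<Longrightarrow> h \<in> carrier G \<Longrightarrow> \<rho> (g \<otimes>\<^bsub>G\<^esub> h) = \<rho> g * \<rho> h"
  using assms by (auto simp: characters_def Cstar_def hom_def)

lemma charactersI:
  assumes "\<And>g. g \<in> carrier G \<Longrightarrow> \<rho> g \<noteq> 0"
    and "\<And>g h. g \<in> carrier G \<Longrightarrow> h \<in> carrier G \<Longrightarrow> \<rho> (g \<otimes>\<^bsub>G\<^esub> h) = \<rho> g * \<rho> h"
    and "\<rho> \<in> extensional (carrier G)"
  shows "\<rho> \<in> characters G"
  using assms by (auto simp: characters_def Cstar_def hom_def)

lemma characters_eqI:
  assumes "\<rho> \<in> characters G" "\<rho>' \<in> characters G" "\<And>g. g \<in> carrier G \<Longrightarrow> \<rho> g = \<rho>' g"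
  shows "\<rho> = \<rho>'"
  using assms by (auto simp: characters_def intro: extensionalityI)

context group
begin

lemma sum_cosets:
  fixes F :: "'a set \<Rightarrow> 'c::comm_semiring_1"
  assumes H: "subgroup H G" and fin: "finite (carrier G)"
  shows "(\<Sum>g \<in> carrier G. F (H #> g)) = of_nat (card H) * (\<Sum>C \<in> rcosets H. F C)"
proof -
  have finR: "finite (rcosets H)" using fin by (simp add: RCOSETS_def)
  have "(\<Sum>g \<in> carrier G. F (H #> g)) = (\<Sum>C \<in> rcosets H. \<Sum>g | g \<in> carrier G \<and> H #> g = C. F (H #> g))"
    using fin finR by (intro sum.group[symmetric]) (auto simp: RCOSETS_def)
  also have "\<dots> = (\<Sum>C \<in> rcosets H. of_nat (card H) * F C)"
  proof (rule sum.cong)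
    fix C assume C: "C \<in> rcosets H"
    have "{g \<in> carrier G. H #> g = C} = C"
    proof
      show "{g \<in> carrier G. H #> g = C} \<subseteq> C" using rcos_self[OF _ H] by blast
      show "C \<subseteq> {g \<in> carrier G. H #> g = C}"
        using C repr_independence[OF _ _ H] rcosets_part_G[OF H]
        by (auto simp: RCOSETS_def)
    qed
    moreover have "card C = card H"
      using card_rcosets_equal[OF C] subgroup.subset[OF H] by simp
    moreover have "(\<Sum>g | g \<in> carrier G \<and> H #> g = C. F (H #> g)) = (\<Sum>g | g \<in> carrier G \<and> H #> g = C. F C)"
      by (rule sum.cong) auto
    ultimately show "(\<Sum>g | g \<in> carrier G \<and> H #> g = C. F (H #> g)) = of_nat (card H) * F C"
      by simp
  qed simp
  finally show ?thesis by (simp add: sum_distrib_left)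
qed

text \<open>Translation by \<open>x\<close> permutes \<open>H\<close> and multiplies the sum by
  \<open>f x\<close>.\<close>

lemma sum_nontrivial_hom:
  fixes f :: "'a \<Rightarrow> complex"
  assumes H: "subgroup H G"
    and mult: "\<And>g h. g \<in> H \<Longrightarrow> h \<in> H \<Longrightarrow> f (g \<otimes> h) = f g * f h"
    and nt: "x \<in> H" "f x \<noteq> 1"
  shows "(\<Sum>h \<in> H. f h) = 0"
proof -
  have sub: "h \<in> carrier G" if "h \<in> H" for h using H that by (rule subgroup.mem_carrier)
  have "bij_betw (\<lambda>h. x \<otimes> h) H H"
  proof (rule bij_betw_byWitness[where f' = "\<lambda>h. inv x \<otimes> h"])
    show "\<forall>h\<in>H. inv x \<otimes> (x \<otimes> h) = h" "\<forall>h\<in>H. x \<otimes> (inv x \<otimes> h) = h"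
      using sub nt(1) by (simp_all add: m_assoc[symmetric])
  qed (use H nt(1) subgroup.m_closed[OF H] subgroup.m_inv_closed[OF H] in auto)
  hence "(\<Sum>h \<in> H. f h) = (\<Sum>h \<in> H. f (x \<otimes> h))" by (rule sum.reindex_bij_betw[symmetric])
  also have "\<dots> = f x * (\<Sum>h \<in> H. f h)" using mult nt(1) by (simp add: sum_distrib_left)
  finally have "(f x - 1) * (\<Sum>h \<in> H. f h) = 0" by (simp add: algebra_simps)
  thus ?thesis using nt(2) by simp
qed

lemma character_one: "\<rho> \<in> characters G \<Longrightarrow> \<rho> \<one> = 1"
  using charactersD[of \<rho> G \<one>] charactersD(2)[of \<rho> G \<one> \<one>] by simp

lemma character_inv:
  assumes \<rho>: "\<rho> \<in> characters G" and g: "g \<in> carrier G"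
  shows "\<rho> (inv g) = inverse (\<rho> g)"
proof -
  have "\<rho> (inv g) * \<rho> g = 1" using charactersD(2)[OF \<rho>, of "inv g" g] g character_one[OF \<rho>] by simp
  thus ?thesis using charactersD(1)[OF \<rho> g] by (simp add: field_simps)
qed

lemma character_pow:
  assumes \<rho>: "\<rho> \<in> characters G" and g: "g \<in> carrier G"
  shows "\<rho> (g [^] (n::nat)) = \<rho> g ^ n"
  using charactersD(2)[OF \<rho>] g character_one[OF \<rho>] by (induction n) auto

text \<open>The values are roots of unity of order dividing |G|.\<close>

lemma character_norm:
  assumes \<rho>: "\<rho> \<in> characters G" and g: "g \<in> carrier G" and fin: "finite (carrier G)"
  shows "cmod (\<rho> g) = 1"
proof -
  have "\<rho> g ^ order G = 1"
    using character_pow[OF \<rho> g, of "order G"] pow_order_eq_1[OF g] character_one[OF \<rho>] by simp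
  hence "cmod (\<rho> g) ^ order G = 1" by (metis norm_one norm_power)
  moreover have "order G > 0" using fin order_gt_0_iff_finite by blast
  ultimately show ?thesis using power_eq_iff_eq_base[of "order G" "cmod (\<rho> g)" 1] by simp
qed

lemma character_inv_cnj:
  assumes \<rho>: "\<rho> \<in> characters G" and g: "g \<in> carrier G" and fin: "finite (carrier G)"
  shows "\<rho> (inv g) = cnj (\<rho> g)"
proof -
  have "\<rho> g * \<rho> (inv g) = \<rho> g * cnj (\<rho> g)"
    using character_inv[OF \<rho> g] character_norm[OF assms] charactersD(1)[OF \<rho> g]
      complex_norm_square[of "\<rho> g"] by simp
  thus ?thesis using charactersD(1)[OF \<rho> g] by simp
qed

end

section \<open>Extending characters from subgroups\<close>

context comm_group
begin

text \<open>Adjoining one element \<open>x\<close>: an extension is determined by its value \<open>\<zeta>\<close> at \<open>x\<close>, an \<open>m\<close>-th root.\<close>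

lemma card_character_extensions:
  assumes fin: "finite (carrier G)" and H: "subgroup H G"
    and \<chi>: "\<And>h. h \<in> H \<Longrightarrow> \<chi> h \<noteq> (0::complex)"
      "\<And>g h. g \<in> H \<Longrightarrow> h \<in> H \<Longrightarrow> \<chi> (g \<otimes> h) = \<chi> g * \<chi> h"
  shows "card {\<rho> \<in> characters G. \<forall>h \<in> H. \<rho> h = \<chi> h} * card H = order G \<and>
    finite {\<rho> \<in> characters G. \<forall>h \<in> H. \<rho> h = \<chi> h}"
  using H \<chi>
proof (induction "order G - card H" arbitrary: H \<chi> rule: less_induct)
  case less
  note H = less.prems(1) and \<chi> = less.prems(2,3)
  have sub: "H \<subseteq> carrier G" by (rule subgroup.subset[OF H])
  have finH: "finite H" using sub fin by (rule finite_subset)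
  let ?E = "{\<rho> \<in> characters G. \<forall>h \<in> H. \<rho> h = \<chi> h}"
  show ?case
  proof (cases "H = carrier G")
    case True
    have "restrict \<chi> (carrier G) \<in> characters G"
      using \<chi> True by (intro charactersI) auto
    moreover have "\<rho> = restrict \<chi> (carrier G)" if "\<rho> \<in> ?E" for \<rho>
      using that True calculation by (intro characters_eqI) auto
    ultimately have "?E = {restrict \<chi> (carrier G)}" using True by auto
    thus ?thesis using True by (simp add: order_def)
  next
    case False
    then obtain x where x: "x \<in> carrier G" "x \<notin> H" using sub by blast
    have "x [^] order G \<in> H" using pow_order_eq_1[OF x(1)] subgroup.one_closed[OF H] by simp
    hence ex: "\<exists>k>0. x [^] (k::nat) \<in> H" using fin order_gt_0_iff_finite by blast
    \<comment> \<open>The order of \<open>x\<close> modulo \<open>H\<close>, which is also the index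
      of \<open>H\<close> in the subgroup \<open>K\<close> below.\<close>
    define m where "m = (LEAST k. k > 0 \<and> x [^] (k::nat) \<in> H)"
    have m: "m > 0" "x [^] m \<in> H" using LeastI_ex[OF ex] by (simp_all add: m_def)
    have Hpow: "h [^] (k::nat) \<in> H" if "h \<in> H" for h k
      using that H sub by (induction k) (auto simp: subgroup.one_closed subgroup.m_closed)
    have \<chi>1: "\<chi> \<one> = 1"
      using \<chi>(1)[of \<one>] \<chi>(2)[of \<one> \<one>] subgroup.one_closed[OF H] by simp
    have \<chi>pow: "\<chi> (h [^] (k::nat)) = \<chi> h ^ k" if "h \<in> H" for h k
      using \<chi>(2) Hpow that \<chi>1 by (induction k) auto
    have m_mult: "x [^] (k * m) = (x [^] m) [^] k" for k :: nat
      using x(1) by (simp add: nat_pow_pow mult.commute)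
    have dvd: "m dvd n" if n: "x [^] (n::nat) \<in> H" for n
    proof -
      have "x [^] n = x [^] (n div m * m) \<otimes> x [^] (n mod m)"
        using x(1) by (simp add: nat_pow_mult)
      hence "x [^] (n mod m) = inv (x [^] (n div m * m)) \<otimes> x [^] n"
        using x(1) by (simp add: m_assoc[symmetric])
      hence "x [^] (n mod m) \<in> H"
        using n Hpow[OF m(2)] m_mult H by (simp add: subgroup.m_closed subgroup.m_inv_closed)
      moreover have "n mod m < m" using m(1) by simp
      ultimately have "n mod m = 0" using not_less_Least[of "n mod m" "\<lambda>k. k > 0 \<and> x [^] k \<in> H"]
        unfolding m_def[symmetric] by auto
      thus ?thesis by auto
    qed
    \<comment> \<open>Natural exponents suffice, since \<open>x\<close> has finite order and its
      inverse is a power.\<close>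
    define K where "K = {h \<otimes> x [^] (i::nat) | h i. h \<in> H}"
    have K: "subgroup K G"
    proof (rule subgroupI)
      show "K \<subseteq> carrier G" using sub x(1) by (auto simp: K_def)
      show "K \<noteq> {}" using subgroup.one_closed[OF H] by (auto simp: K_def)
    next
      fix a assume "a \<in> K"
      then obtain h i where a: "a = h \<otimes> x [^] (i::nat)" "h \<in> H" by (auto simp: K_def)
      have hc: "h \<in> carrier G" using a sub by blast
      have "x [^] i \<otimes> x [^] (i * (order G - 1)) = x [^] (i * order G)"
        using x(1) fin order_gt_0_iff_finite by (simp add: nat_pow_mult algebra_simps)
      also have "\<dots> = \<one>" using x(1) pow_order_eq_1[OF x(1)]
        by (metis mult.commute nat_pow_one nat_pow_pow)
      finally have "inv (x [^] i) = x [^] (i * (order G - 1))"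
        using x(1) by (metis inv_equality m_comm nat_pow_closed)
      hence "inv a = inv h \<otimes> x [^] (i * (order G - 1))"
        using a hc x(1) by (simp add: inv_mult)
      thus "inv a \<in> K" using a H by (auto simp: K_def subgroup.m_inv_closed)
    next
      fix a b assume "a \<in> K" "b \<in> K"
      then obtain h i k j where ab: "a = h \<otimes> x [^] (i::nat)" "h \<in> H" "b = k \<otimes> x [^] (j::nat)" "k \<in> H"
        by (auto simp: K_def)
      have "h \<in> carrier G" "k \<in> carrier G" using ab sub by auto
      hence "a \<otimes> b = (h \<otimes> k) \<otimes> x [^] (i + j)"
        using x(1) by (simp add: ab nat_pow_mult[symmetric] m_ac)
      thus "a \<otimes> b \<in> K" using ab H by (auto simp: K_def subgroup.m_closed)
    qed
    \<comment> \<open>Two ways of writing an element of \<open>K\<close> differ by a power of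
      \<open>x\<close> lying in \<open>H\<close>, hence by a multiple of \<open>m\<close> in the
      exponent.\<close>
    have shift: "j - i = (j - i) div m * m \<and> h = k \<otimes> x [^] (j - i) \<and> x [^] (j - i) \<in> H"
      if eq: "h \<otimes> x [^] i = k \<otimes> x [^] j" "h \<in> H" "k \<in> H" "i \<le> j" for h k and i j :: nat
    proof -
      have hk: "h \<in> carrier G" "k \<in> carrier G" using eq sub by auto
      have "x [^] j = x [^] (j - i) \<otimes> x [^] i" using eq(4) x(1) by (simp add: nat_pow_mult)
      hence "h \<otimes> x [^] i = (k \<otimes> x [^] (j - i)) \<otimes> x [^] i" using eq(1) hk x(1) by (simp add: m_assoc)
      hence h: "h = k \<otimes> x [^] (j - i)" using hk x(1) by simp
      hence "x [^] (j - i) = inv k \<otimes> h" using hk x(1) by (simp add: m_assoc[symmetric])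
      hence *: "x [^] (j - i) \<in> H" using eq(2,3) H by (simp add: subgroup.m_closed subgroup.m_inv_closed)
      thus ?thesis using h dvd[OF *] by simp
    qed
    have "bij_betw (\<lambda>(h, i). h \<otimes> x [^] i) (H \<times> {..<m}) K"
    proof (rule bij_betw_imageI)
      have "h = k \<and> i = j" if "h \<otimes> x [^] i = k \<otimes> x [^] j" "h \<in> H" "k \<in> H" "i < m" "j < m" "i \<le> j"
        for h k and i j :: nat
      proof -
        have "j - i < m" using that by simp
        hence "j - i = 0" using shift[OF that(1-3,6)] by (metis div_less mult_0)
        thus ?thesis using shift[OF that(1-3,6)] that(3,6) sub by auto
      qed
      note * = this
      show "inj_on (\<lambda>(h, i). h \<otimes> x [^] i) (H \<times> {..<m})"
      proof (rule inj_onI, clarify)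
        fix h i k j assume "h \<in> H" "i < m" "k \<in> H" "j < m" "h \<otimes> x [^] i = k \<otimes> x [^] j"
        thus "h = k \<and> i = j" using *[of h i k j] *[of k j h i] by (cases "i \<le> j") auto
      qed
      show "(\<lambda>(h, i). h \<otimes> x [^] i) ` (H \<times> {..<m}) = K"
      proof
        show "(\<lambda>(h, i). h \<otimes> x [^] i) ` (H \<times> {..<m}) \<subseteq> K" by (auto simp: K_def)
        show "K \<subseteq> (\<lambda>(h, i). h \<otimes> x [^] i) ` (H \<times> {..<m})"
        proof
          fix a assume "a \<in> K"
          then obtain h i where a: "a = h \<otimes> x [^] (i::nat)" "h \<in> H" by (auto simp: K_def)
          have hc: "h \<in> carrier G" using a sub by blast
          have "x [^] i = x [^] (i div m * m) \<otimes> x [^] (i mod m)" using x(1) by (simp add: nat_pow_mult)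
          hence "a = (h \<otimes> (x [^] m) [^] (i div m)) \<otimes> x [^] (i mod m)"
            using a hc x(1) m_mult by (simp add: m_assoc)
          moreover have "h \<otimes> (x [^] m) [^] (i div m) \<in> H" using a(2) Hpow[OF m(2)] H
            by (simp add: subgroup.m_closed)
          moreover have "i mod m < m" using m(1) by simp
          ultimately show "a \<in> (\<lambda>(h, i). h \<otimes> x [^] i) ` (H \<times> {..<m})" by force
        qed
      qed
    qed
    hence cardK: "card K = card H * m" using bij_betw_same_card by (fastforce simp: card_cartesian_product)
    have HK: "H \<subseteq> K"
    proof
      fix h assume h: "h \<in> H"
      hence "h = h \<otimes> x [^] (0::nat)" using sub by auto
      thus "h \<in> K" using h unfolding K_def by blast
    qed
    have xK: "x \<in> K"
    proof -
      have "x = \<one> \<otimes> x [^] (1::nat)" using x(1) by simp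
      thus ?thesis using subgroup.one_closed[OF H] unfolding K_def by blast
    qed
    have "card H < card K"
      using HK xK x(2) finite_subset[OF subgroup.subset[OF K] fin] by (intro psubset_card_mono) auto
    moreover have "card K \<le> order G" unfolding order_def
      by (rule card_mono[OF fin subgroup.subset[OF K]])
    ultimately have smaller: "order G - card K < order G - card H" by simp
    \<comment> \<open>The constraint on the value at \<open>x\<close>: its power of exponent
      \<open>m\<close> is prescribed by \<chi>.\<close>
    let ?Z = "{\<zeta>. \<zeta> ^ m = \<chi> (x [^] m)}"
    let ?E\<zeta> = "\<lambda>\<zeta>. {\<rho> \<in> ?E. \<rho> x = \<zeta>}"
    have cardZ: "card ?Z = m" by (rule card_nth_roots[OF \<chi>(1)[OF m(2)] m(1)])
    have finZ: "finite ?Z" by (rule finite_nth_roots[OF m(1)])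
    have each: "card (?E\<zeta> \<zeta>) * card K = order G \<and> finite (?E\<zeta> \<zeta>)" if \<zeta>: "\<zeta> \<in> ?Z" for \<zeta>
    proof -
      have \<zeta>0: "\<zeta> \<noteq> 0" using \<zeta> \<chi>(1)[OF m(2)] m(1) by (auto simp: zero_power)
      have wd: "\<chi> h * \<zeta> ^ i = \<chi> k * \<zeta> ^ j"
        if "h \<otimes> x [^] i = k \<otimes> x [^] j" "h \<in> H" "k \<in> H" "i \<le> j" for h k and i j :: nat
      proof -
        note s = shift[OF that]
        have "\<chi> h = \<chi> k * \<chi> (x [^] (j - i))" using s \<chi>(2) that(3) by metis
        also have "\<chi> (x [^] (j - i)) = \<chi> (x [^] m) ^ ((j - i) div m)"
          using s m_mult[of "(j - i) div m"] \<chi>pow[OF m(2)] by simp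
        also have "\<dots> = \<zeta> ^ ((j - i) div m * m)" using \<zeta> by (simp add: power_mult mult.commute[of _ m])
        also have "\<dots> = \<zeta> ^ (j - i)" using s by simp
        finally show ?thesis using that(4) by (simp add: power_add[symmetric])
      qed
      \<comment> \<open>Defined through an arbitrary representation of \<open>a\<close>;
        \<open>wd\<close> makes the value independent of it.\<close>
      define \<psi> where "\<psi> a = (SOME c. \<exists>h\<in>H. \<exists>i::nat. a = h \<otimes> x [^] i \<and> c = \<chi> h * \<zeta> ^ i)" for a
      have \<psi>: "\<psi> (h \<otimes> x [^] i) = \<chi> h * \<zeta> ^ i" if h: "h \<in> H" for h and i :: nat
      proof -
        have "\<exists>c. \<exists>k\<in>H. \<exists>j::nat. h \<otimes> x [^] i = k \<otimes> x [^] j \<and> c = \<chi> k * \<zeta> ^ j" using h by blast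
        from someI_ex[OF this] obtain k j where
          kj: "k \<in> H" "h \<otimes> x [^] i = k \<otimes> x [^] (j::nat)" "\<psi> (h \<otimes> x [^] i) = \<chi> k * \<zeta> ^ j"
          unfolding \<psi>_def by blast
        thus ?thesis using wd[of h i k j] wd[of k j h i] h by (cases "i \<le> j") auto
      qed
      have \<psi>0: "\<psi> a \<noteq> 0" if "a \<in> K" for a
        using that \<psi> \<chi>(1) \<zeta>0 by (auto simp: K_def)
      have \<psi>m: "\<psi> (a \<otimes> b) = \<psi> a * \<psi> b" if ab: "a \<in> K" "b \<in> K" for a b
      proof -
        obtain h i k j where ab: "a = h \<otimes> x [^] (i::nat)" "h \<in> H" "b = k \<otimes> x [^] (j::nat)" "k \<in> H"
          using ab by (auto simp: K_def)
        have "h \<in> carrier G" "k \<in> carrier G" using ab sub by auto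
        hence "a \<otimes> b = (h \<otimes> k) \<otimes> x [^] (i + j)"
          using x(1) by (simp add: ab nat_pow_mult[symmetric] m_ac)
        hence "\<psi> (a \<otimes> b) = \<chi> (h \<otimes> k) * \<zeta> ^ (i + j)" using \<psi> ab H by (simp add: subgroup.m_closed)
        thus ?thesis using \<psi> ab \<chi>(2) by (simp add: power_add)
      qed
      have "?E\<zeta> \<zeta> = {\<rho> \<in> characters G. \<forall>a \<in> K. \<rho> a = \<psi> a}"
      proof (intro Collect_cong iffI)
        fix \<rho> assume "\<rho> \<in> ?E \<and> \<rho> x = \<zeta>"
        hence \<rho>: "\<rho> \<in> characters G" "\<And>h. h \<in> H \<Longrightarrow> \<rho> h = \<chi> h" "\<rho> x = \<zeta>" by auto
        have "\<rho> (h \<otimes> x [^] i) = \<psi> (h \<otimes> x [^] i)" if "h \<in> H" for h and i :: nat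
          using charactersD(2)[OF \<rho>(1), of h "x [^] i"] character_pow[OF \<rho>(1) x(1)] that \<psi>[OF that] \<rho>(2,3) sub x(1)
          by auto
        thus "\<rho> \<in> characters G \<and> (\<forall>a \<in> K. \<rho> a = \<psi> a)" using \<rho>(1) by (auto simp: K_def)
      next
        fix \<rho> assume \<rho>: "\<rho> \<in> characters G \<and> (\<forall>a \<in> K. \<rho> a = \<psi> a)"
        have "\<psi> h = \<chi> h" if "h \<in> H" for h using \<psi>[OF that, of 0] that sub by auto
        moreover have "\<psi> x = \<zeta>" using \<psi>[OF subgroup.one_closed[OF H], of 1] x(1) \<chi>1 by simp
        ultimately show "\<rho> \<in> ?E \<and> \<rho> x = \<zeta>" using \<rho> HK xK by auto
      qed
      thus ?thesis using less.hyps[OF smaller K \<psi>0 \<psi>m] by simp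
    qed
    have E: "?E = (\<Union>\<zeta>\<in>?Z. ?E\<zeta> \<zeta>)"
    proof -
      have "\<rho> x ^ m = \<chi> (x [^] m)" if "\<rho> \<in> ?E" for \<rho>
        using that character_pow[of \<rho> x m] x(1) m(2) by simp
      thus ?thesis by auto
    qed
    have "finite (\<Union>\<zeta>\<in>?Z. ?E\<zeta> \<zeta>)" using finZ each by (intro finite_UN_I) simp_all
    hence finE: "finite ?E" by (simp only: E[symmetric])
    have "card (\<Union>\<zeta>\<in>?Z. ?E\<zeta> \<zeta>) = (\<Sum>\<zeta>\<in>?Z. card (?E\<zeta> \<zeta>))"
      using finZ each by (intro card_UN_disjoint) auto
    \<comment> \<open>There are \<open>m\<close> values of \<zeta>, each with |G|/|K| extensions,
      and |K| = m |H|.\<close>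
    hence "card ?E * card K = (\<Sum>\<zeta>\<in>?Z. card (?E\<zeta> \<zeta>) * card K)"
      unfolding E[symmetric] by (simp add: sum_distrib_right)
    also have "\<dots> = m * order G" using each cardZ by simp
    finally have "m * (card ?E * card H) = m * order G" by (simp add: cardK mult_ac)
    thus ?thesis using m(1) finE by simp
  qed
qed

text \<open>With D(v) for \<open>H\<close> this counts the Fourier vectors over
  \<open>v\<close>.\<close>

lemma card_annihilator:
  assumes fin: "finite (carrier G)" and H: "subgroup H G"
  shows "card {\<rho> \<in> characters G. \<forall>h \<in> H. \<rho> h = 1} * card H = order G"
  using card_character_extensions[OF fin H, of "\<lambda>_. 1"] by simp

lemma finite_characters:
  assumes fin: "finite (carrier G)"
  shows "finite (characters G)"
proof -
  have "{\<rho> \<in> characters G. \<forall>h \<in> {\<one>}. \<rho> h = 1} = characters G" using character_one by auto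
  thus ?thesis using card_character_extensions[OF fin triv_subgroup, of "\<lambda>_. 1"] by simp
qed

end

section \<open>Fourier decomposition of the Laplacian of a voltage cover\<close>

locale voltage_data = comm_group G + base: hgraph X + cover: hgraph "voltage_cover G X ori D l"
  for G :: "('a, 'b) monoid_scheme" (structure) and X :: "('v, 'h) hgraph" and ori :: "'h set \<Rightarrow> 'h" and D :: "'v \<Rightarrow> 'a set"
    and l :: "'h set \<Rightarrow> 'a" +
  assumes fin: "finite (carrier G)"
    and ori: "orientation X ori"
    and subgroup_D: "v \<in> verts X \<Longrightarrow> subgroup (D v) G"
    and l_closed: "e \<in> edges X \<Longrightarrow> l e \<in> carrier G"
begin

abbreviation Y :: "('v \<times> 'a set, 'h \<times> 'a) hgraph" where
  "Y \<equiv> voltage_cover G X ori D l"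

text \<open>The half-edge (h, g) of the cover is rooted at the coset of
  \<open>g \<otimes> shift h\<close>: there is no translation at the source of an edge, and one by
  the lifted voltage at its target.\<close>

definition shift :: "'h \<Rightarrow> 'a" where
  "shift h = (if h = ori (edge_of X h) then \<one> else l (edge_of X h))"

text \<open>The quotient of the character values at the two ends: \<rho> of the lifted voltage along
  the orientation and its conjugate against it.\<close>

definition char_voltage :: "('a \<Rightarrow> complex) \<Rightarrow> 'h \<Rightarrow> complex" where
  "char_voltage \<rho> h = \<rho> (shift (flip X h)) * cnj (\<rho> (shift h))"

definition nontriv_verts :: "('a \<Rightarrow> complex) \<Rightarrow> 'v set" where
  "nontriv_verts \<rho> = {v \<in> verts X. \<exists>d \<in> D v. \<rho> d \<noteq> 1}"

text \<open>The frequencies. Functions on the fibre over \<open>v\<close>, that is on G/D(v), are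
  spanned by the characters trivial on D(v), and these pairs index the resulting basis.\<close>

definition dual_verts :: "('v \<times> ('a \<Rightarrow> complex)) set" where
  "dual_verts = (SIGMA v : verts X. {\<rho> \<in> characters G. \<forall>d \<in> D v. \<rho> d = 1})"

text \<open>
  For \<open>w\<close> in \<open>dual_verts\<close> the character is constant on the coset, so the choice of \<open>g\<close> is immaterial.
\<close>

definition fourier :: "'v \<times> 'a set \<Rightarrow> 'v \<times> ('a \<Rightarrow> complex) \<Rightarrow> complex" where
  "fourier i w = (if fst i = fst w then snd w (SOME g. g \<in> snd i) else 0)"

definition trivial_char :: "'a \<Rightarrow> complex" where
  "trivial_char = restrict (\<lambda>_. 1) (carrier G)"

section \<open>Fourier vectors on the vertices of the cover\<close>

lemma shift_closed: "h \<in> halfs X \<Longrightarrow> shift h \<in> carrier G"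
  using l_closed by (simp add: shift_def)

lemma verts_Y: "verts Y = (SIGMA v : verts X. rcosets (D v))"
  by (simp add: voltage_cover_def FactGroup_def)

lemma halfs_Y: "halfs Y = halfs X \<times> carrier G"
  by (simp add: voltage_cover_def)

lemma rt_Y: "h \<in> halfs X \<Longrightarrow> g \<in> carrier G \<Longrightarrow> rt Y (h, g) = (rt X h, D (rt X h) #> (g \<otimes> shift h))"
  by (simp add: voltage_cover_def shift_def)

lemma flip_Y: "flip Y (h, g) = (flip X h, g)"
  by (simp add: voltage_cover_def)

lemma char_voltage_unit:
  assumes \<rho>: "\<rho> \<in> characters G"
  shows "unit_voltage X (char_voltage \<rho>)"
  using character_norm[OF \<rho> shift_closed fin] base.flip_closed base.flip_flip
  by (auto simp: unit_voltage_def char_voltage_def norm_mult)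

lemma trivial_char_in: "trivial_char \<in> characters G"
  by (rule charactersI) (auto simp: trivial_char_def)

lemma characters_split: "characters G = insert trivial_char (nontrivial_characters G)"
  "trivial_char \<notin> nontrivial_characters G"
proof -
  have "\<rho> = trivial_char" if "\<rho> \<in> characters G" "\<rho> \<notin> nontrivial_characters G" for \<rho>
    using that trivial_char_in by (intro characters_eqI) (auto simp: nontrivial_characters_def trivial_char_def)
  thus "characters G = insert trivial_char (nontrivial_characters G)"
    using trivial_char_in by (auto simp: nontrivial_characters_def)
  show "trivial_char \<notin> nontrivial_characters G"
    by (auto simp: nontrivial_characters_def trivial_char_def)
qed

lemma finite_rcosets: "finite (rcosets (D v))"
  using fin by (simp add: RCOSETS_def)

lemma card_rcosets: "v \<in> verts X \<Longrightarrow> card (rcosets (D v)) * card (D v) = order G"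
  using lagrange[OF subgroup_D] by simp

lemma card_D_pos: "v \<in> verts X \<Longrightarrow> card (D v) > 0"
  using subgroup.finite_imp_card_positive[OF subgroup_D fin] .

lemma coset_props:
  assumes v: "v \<in> verts X" and C: "C \<in> rcosets (D v)"
  shows "C \<subseteq> carrier G" "card C = card (D v)" "C \<noteq> {}"
    "g \<in> carrier G \<Longrightarrow> D v #> g = C \<longleftrightarrow> g \<in> C"
proof -
  note S = subgroup_D[OF v]
  show "C \<subseteq> carrier G" using rcosets_part_G[OF S] C by blast
  show c: "card C = card (D v)" using card_rcosets_equal[OF C subgroup.subset[OF S]] by simp
  thus "C \<noteq> {}" using card_D_pos[OF v] by auto
  show "D v #> g = C \<longleftrightarrow> g \<in> C" if g: "g \<in> carrier G"
    using C rcos_self[OF g S] repr_independence[OF _ _ S] by (auto simp: RCOSETS_def)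
qed

lemma fourier_eq:
  assumes w: "(u, \<rho>) \<in> dual_verts" and C: "C \<in> rcosets (D v)" and g: "g \<in> C"
  shows "fourier (v, C) (u, \<rho>) = (if v = u then \<rho> g else 0)"
proof (cases "v = u")
  case True
  have u: "u \<in> verts X" "\<rho> \<in> characters G" "\<And>d. d \<in> D u \<Longrightarrow> \<rho> d = 1"
    using w by (auto simp: dual_verts_def)
  note S = subgroup_D[OF u(1)]
  have "(SOME g. g \<in> C) \<in> C" using g by (rule someI)
  moreover obtain c where c: "c \<in> carrier G" "C = D u #> c" using C True by (auto simp: RCOSETS_def)
  moreover have "\<rho> x = \<rho> c" if "x \<in> C" for x
    using that c u(2,3) charactersD(2)[OF u(2) _ c(1)] subgroup.mem_carrier[OF S] by (auto simp: r_coset_def)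
  ultimately show ?thesis using True g by (simp add: fourier_def)
qed (simp add: fourier_def)

lemma fourier_rcos:
  assumes w: "(u, \<rho>) \<in> dual_verts" and v: "v \<in> verts X" and g: "g \<in> carrier G"
  shows "fourier (v, D v #> g) (u, \<rho>) = (if v = u then \<rho> g else 0)"
  using fourier_eq[OF w, of "D v #> g" v g] rcos_self[OF g subgroup_D[OF v]]
    rcosetsI[OF subgroup.subset[OF subgroup_D[OF v]] g] by simp

text \<open>Origin of the row factor |D(v)|: summing over a coset kills the characters that are
  nontrivial on D(v) and multiplies the others by the size of the coset.\<close>

lemma sum_character_coset:
  assumes v: "v \<in> verts X" and C: "C \<in> rcosets (D v)" and \<rho>: "\<rho> \<in> characters G"
  shows "(\<Sum>g \<in> C. \<rho> g) =
    (if \<forall>d \<in> D v. \<rho> d = 1 then of_nat (card (D v)) * fourier (v, C) (v, \<rho>) else 0)"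
proof -
  note S = subgroup_D[OF v]
  obtain c where c: "c \<in> carrier G" "C = D v #> c" using C by (auto simp: RCOSETS_def)
  have "bij_betw (\<lambda>d. d \<otimes> c) (D v) C"
    using c subgroup.subset[OF S] by (auto simp: bij_betw_def r_coset_def inj_on_def subsetD)
  hence "(\<Sum>g \<in> C. \<rho> g) = (\<Sum>d \<in> D v. \<rho> (d \<otimes> c))" by (rule sum.reindex_bij_betw[symmetric])
  also have "\<dots> = (\<Sum>d \<in> D v. \<rho> d) * \<rho> c"
    using charactersD(2)[OF \<rho> _ c(1)] subgroup.mem_carrier[OF S] by (simp add: sum_distrib_right)
  finally have *: "(\<Sum>g \<in> C. \<rho> g) = (\<Sum>d \<in> D v. \<rho> d) * \<rho> c" .
  show ?thesis
  proof (cases "\<forall>d \<in> D v. \<rho> d = 1")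
    case True
    hence "(v, \<rho>) \<in> dual_verts" using v \<rho> by (simp add: dual_verts_def)
    hence "fourier (v, C) (v, \<rho>) = \<rho> c" using fourier_rcos[of v \<rho> v c] v c by simp
    thus ?thesis using * True by simp
  next
    case False
    then obtain d where "d \<in> D v" "\<rho> d \<noteq> 1" by blast
    hence "(\<Sum>d \<in> D v. \<rho> d) = 0"
      using charactersD(2)[OF \<rho>] subgroup.mem_carrier[OF S] by (intro sum_nontrivial_hom[OF S]) auto
    thus ?thesis unfolding if_not_P[OF False] using * by simp
  qed
qed

text \<open>Over each half-edge at \<open>v\<close> there are |D(v)| half-edges rooted at (v, C),
  whose far ends are indexed by the elements of \<open>C\<close> translated by the voltage. The
  character sum over \<open>C\<close> then keeps \<rho> and annihilates the result where \<rho> is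
  nontrivial on D(v).\<close>

lemma laplacian_fourier:
  assumes i: "(v, C) \<in> verts Y" and w: "(u, \<rho>) \<in> dual_verts"
  shows "(\<Sum>j \<in> verts Y. of_int (laplacian_entry Y (v, C) j) * fourier j (u, \<rho>)) =
    (if (v, \<rho>) \<in> dual_verts
     then fourier (v, C) (v, \<rho>) * (of_nat (card (D v)) * twisted_laplacian X (char_voltage \<rho>) v u) else 0)"
proof -
  let ?\<phi> = "\<lambda>j. fourier j (u, \<rho>)" and ?z = "char_voltage \<rho>"
  have v: "v \<in> verts X" and C: "C \<in> rcosets (D v)" using i by (auto simp: verts_Y)
  have u: "u \<in> verts X" and \<rho>: "\<rho> \<in> characters G" using w by (auto simp: dual_verts_def)
  note cp = coset_props[OF v C]
  have finC: "finite C" using cp(1) fin by (rule finite_subset)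
  have pick: "(\<Sum>j \<in> verts Y. of_bool (a = j) * ?\<phi> j) = ?\<phi> a" if "a \<in> verts Y" for a
    using that cover.finite_verts by (simp add: of_bool_def if_distrib[of "\<lambda>x. x * _"] cong: if_cong)
  have "(\<Sum>j \<in> verts Y. of_int (laplacian_entry Y (v, C) j) * ?\<phi> j) =
      (\<Sum>j \<in> verts Y. \<Sum>k \<in> halfs Y. of_bool (rt Y k = (v, C)) *
        (of_bool ((v, C) = j) * ?\<phi> j - of_bool (rt Y (flip Y k) = j) * ?\<phi> j))"
    unfolding cover.laplacian_entry_sum of_int_sum sum_distrib_right
    by (intro sum.cong refl) (simp add: algebra_simps)
  also have "\<dots> = (\<Sum>k \<in> halfs Y. of_bool (rt Y k = (v, C)) * (?\<phi> (v, C) - ?\<phi> (rt Y (flip Y k))))"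
  proof (subst sum.swap, rule sum.cong)
    fix k assume k: "k \<in> halfs Y"
    have "rt Y (flip Y k) \<in> verts Y" using k cover.flip_closed cover.rt_closed by blast
    thus "(\<Sum>j \<in> verts Y. of_bool (rt Y k = (v, C)) *
        (of_bool ((v, C) = j) * ?\<phi> j - of_bool (rt Y (flip Y k) = j) * ?\<phi> j)) =
        of_bool (rt Y k = (v, C)) * (?\<phi> (v, C) - ?\<phi> (rt Y (flip Y k)))"
      unfolding sum_distrib_left[symmetric] sum_subtractf using pick i by simp
  qed simp
  also have "\<dots> = (\<Sum>h \<in> halfs X. \<Sum>g \<in> carrier G. of_bool (rt Y (h, g) = (v, C)) *
      (?\<phi> (v, C) - ?\<phi> (rt Y (flip Y (h, g)))))"
    unfolding halfs_Y by (simp add: sum.cartesian_product)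
  also have "\<dots> = (\<Sum>h \<in> halfs X. of_bool (rt X h = v) *
      (of_nat (card (D v)) * ?\<phi> (v, C) - of_bool (rt X (flip X h) = u) * ?z h * (\<Sum>g \<in> C. \<rho> g)))"
  proof (rule sum.cong)
    fix h assume h: "h \<in> halfs X"
    have fh: "flip X h \<in> halfs X" by (rule base.flip_closed[OF h])
    have s: "shift h \<in> carrier G" "shift (flip X h) \<in> carrier G" using shift_closed h fh by auto
    show "(\<Sum>g \<in> carrier G. of_bool (rt Y (h, g) = (v, C)) * (?\<phi> (v, C) - ?\<phi> (rt Y (flip Y (h, g))))) =
      of_bool (rt X h = v) *
      (of_nat (card (D v)) * ?\<phi> (v, C) - of_bool (rt X (flip X h) = u) * ?z h * (\<Sum>g \<in> C. \<rho> g))"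
    proof (cases "rt X h = v")
      case False
      thus ?thesis using h by (simp add: rt_Y)
    next
      case True
      \<comment> \<open>The half-edges at (v, C) are indexed by the element
        \<open>g \<otimes> shift h\<close> of \<open>C\<close> at which they are rooted.\<close>
      have bij: "bij_betw (\<lambda>g. g \<otimes> inv (shift h)) C {g \<in> carrier G. g \<otimes> shift h \<in> C}"
        by (rule bij_betw_byWitness[where f' = "\<lambda>g. g \<otimes> shift h"]) (use s cp(1) in \<open>auto simp: m_assoc subsetD\<close>)
      have tm: "?\<phi> (rt Y (flip Y (h, g \<otimes> inv (shift h)))) = of_bool (rt X (flip X h) = u) * ?z h * \<rho> g"
        if g: "g \<in> carrier G" for g
      proof -
        let ?g = "g \<otimes> inv (shift h)"
        have "?g \<in> carrier G" using g s by simp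
        hence "?\<phi> (rt Y (flip Y (h, ?g))) = (if rt X (flip X h) = u then \<rho> (?g \<otimes> shift (flip X h)) else 0)"
          unfolding flip_Y using fh s by (subst rt_Y) (auto simp: fourier_rcos[OF w] base.rt_closed)
        also have "\<rho> (?g \<otimes> shift (flip X h)) = ?z h * \<rho> g"
          using g s charactersD(2)[OF \<rho>] character_inv_cnj[OF \<rho> s(1) fin] by (simp add: char_voltage_def)
        finally show ?thesis by simp
      qed
      have "(\<Sum>g \<in> carrier G. of_bool (rt Y (h, g) = (v, C)) * (?\<phi> (v, C) - ?\<phi> (rt Y (flip Y (h, g))))) =
          (\<Sum>g \<in> carrier G. of_bool (g \<otimes> shift h \<in> C) * (?\<phi> (v, C) - ?\<phi> (rt Y (flip Y (h, g)))))"
        using True h s cp(4) by (intro sum.cong) (auto simp: rt_Y)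
      also have "\<dots> = (\<Sum>g | g \<in> carrier G \<and> g \<otimes> shift h \<in> C. ?\<phi> (v, C) - ?\<phi> (rt Y (flip Y (h, g))))"
        using fin by (intro sum.mono_neutral_cong_right) auto
      also have "\<dots> = (\<Sum>g \<in> C. ?\<phi> (v, C) - ?\<phi> (rt Y (flip Y (h, g \<otimes> inv (shift h)))))"
        by (rule sum.reindex_bij_betw[OF bij, symmetric])
      also have "\<dots> = (\<Sum>g \<in> C. ?\<phi> (v, C) - of_bool (rt X (flip X h) = u) * ?z h * \<rho> g)"
        using tm cp(1) by (intro sum.cong) auto
      finally show ?thesis using True cp(2) by (simp add: sum_subtractf sum_distrib_left)
    qed
  qed simp
  also have "\<dots> = (if (v, \<rho>) \<in> dual_verts
     then fourier (v, C) (v, \<rho>) * (of_nat (card (D v)) * twisted_laplacian X ?z v u) else 0)"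
  proof (cases "(v, \<rho>) \<in> dual_verts")
    case True
    hence S: "(\<Sum>g \<in> C. \<rho> g) = of_nat (card (D v)) * fourier (v, C) (v, \<rho>)"
      using sum_character_coset[OF v C \<rho>] by (auto simp: dual_verts_def)
    have "?\<phi> (v, C) = of_bool (v = u) * fourier (v, C) (v, \<rho>)" by (simp add: fourier_def)
    thus ?thesis
      unfolding S using True by (simp add: twisted_laplacian_def sum_distrib_left algebra_simps)
  next
    case False
    hence "(\<Sum>g \<in> C. \<rho> g) = 0" using sum_character_coset[OF v C \<rho>] v \<rho> by (auto simp: dual_verts_def)
    moreover have "?\<phi> (v, C) = 0" using False w by (auto simp: fourier_def)
    ultimately show ?thesis using False by simp
  qed
  finally show ?thesis .
qed

text \<open>The weight |D(u)| turns the sum over cosets into a sum over the group, where distinct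
  characters are orthogonal.\<close>

lemma fourier_sum_cosets:
  assumes u: "u \<in> verts X" and w: "(u, \<rho>) \<in> dual_verts" "(u, \<rho>') \<in> dual_verts"
  shows "of_nat (card (D u)) * (\<Sum>C \<in> rcosets (D u). cnj (fourier (u, C) (u, \<rho>)) * fourier (u, C) (u, \<rho>')) =
    (if \<rho> = \<rho>' then of_nat (order G) else 0)"
proof -
  have \<rho>: "\<rho> \<in> characters G" "\<rho>' \<in> characters G" using w by (auto simp: dual_verts_def)
  have "of_nat (card (D u)) * (\<Sum>C \<in> rcosets (D u). cnj (fourier (u, C) (u, \<rho>)) * fourier (u, C) (u, \<rho>')) =
      (\<Sum>g \<in> carrier G. cnj (fourier (u, D u #> g) (u, \<rho>)) * fourier (u, D u #> g) (u, \<rho>'))"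
    by (rule sum_cosets[OF subgroup_D[OF u] fin, symmetric])
  also have "\<dots> = (\<Sum>g \<in> carrier G. cnj (\<rho> g) * \<rho>' g)"
    using fourier_rcos[OF w(1) u] fourier_rcos[OF w(2) u] by simp
  also have "\<dots> = (if \<rho> = \<rho>' then of_nat (order G) else 0)"
  proof (cases "\<rho> = \<rho>'")
    case True
    have "cnj (\<rho> g) * \<rho> g = 1" if "g \<in> carrier G" for g
      using character_norm[OF \<rho>(1) that fin] complex_norm_square[of "\<rho> g"] by (simp add: mult.commute)
    thus ?thesis using True by (simp add: order_def)
  next
    case False
    then obtain x where x: "x \<in> carrier G" "\<rho> x \<noteq> \<rho>' x" using characters_eqI[OF \<rho>] by blast
    have "cnj (\<rho> x) * \<rho>' x \<noteq> 1"
    proof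
      assume "cnj (\<rho> x) * \<rho>' x = 1"
      hence "\<rho> x * (cnj (\<rho> x) * \<rho>' x) = \<rho> x" by simp
      hence "(\<rho> x * cnj (\<rho> x)) * \<rho>' x = \<rho> x" by (simp only: mult.assoc)
      moreover have "\<rho> x * cnj (\<rho> x) = 1"
        using character_norm[OF \<rho>(1) x(1) fin] complex_norm_square[of "\<rho> x"] by simp
      ultimately have "\<rho>' x = \<rho> x" by (simp only: mult_1_left)
      thus False using x(2) by simp
    qed
    thus ?thesis using False x charactersD(2)[OF \<rho>(1)] charactersD(2)[OF \<rho>(2)]
      by (simp, intro sum_nontrivial_hom[OF subgroup_self]) (auto simp: mult_ac)
  qed
  finally show ?thesis .
qed

lemma sum_verts_Y: "(\<Sum>i \<in> verts Y. f i) = (\<Sum>v \<in> verts X. \<Sum>C \<in> rcosets (D v). f (v, C))"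
  unfolding verts_Y using base.finite_verts finite_rcosets by (subst sum.Sigma) auto

lemma fourier_orthogonal:
  assumes w: "w \<in> dual_verts" "w' \<in> dual_verts"
  shows "of_nat (card (D (fst w))) * (\<Sum>i \<in> verts Y. cnj (fourier i w) * fourier i w') =
    (if w = w' then of_nat (order G) else 0)"
proof -
  obtain u \<rho> u' \<rho>' where ww: "w = (u, \<rho>)" "w' = (u', \<rho>')" by (cases w, cases w')
  have u: "u \<in> verts X" using w ww by (auto simp: dual_verts_def)
  have "(\<Sum>i \<in> verts Y. cnj (fourier i w) * fourier i w') =
      (\<Sum>v \<in> verts X. if v = u then \<Sum>C \<in> rcosets (D u). cnj (fourier (u, C) w) * fourier (u, C) w' else 0)"
    unfolding sum_verts_Y by (rule sum.cong) (auto simp: ww fourier_def)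
  also have "\<dots> = (\<Sum>C \<in> rcosets (D u). cnj (fourier (u, C) w) * fourier (u, C) w')"
    using base.finite_verts u by simp
  finally have *: "(\<Sum>i \<in> verts Y. cnj (fourier i w) * fourier i w') =
    (\<Sum>C \<in> rcosets (D u). cnj (fourier (u, C) w) * fourier (u, C) w')" .
  show ?thesis
  proof (cases "u' = u")
    case True
    thus ?thesis using fourier_sum_cosets[OF u, of \<rho> \<rho>'] w * ww by simp
  next
    case False
    hence "fourier (u, C) w' = 0" for C by (simp add: fourier_def ww)
    thus ?thesis using * False ww by simp
  qed
qed

text \<open>The total is the inner product with the trivial Fourier vector, so the rank one
  perturbation, which sees only this total, acts on a single block.\<close>

lemma fourier_total:
  assumes w: "(u, \<rho>) \<in> dual_verts"
  shows "(\<Sum>j \<in> verts Y. fourier j (u, \<rho>)) = of_bool (\<rho> = trivial_char) * of_nat (card (rcosets (D u)))"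
proof -
  have u: "u \<in> verts X" using w by (auto simp: dual_verts_def)
  have subD: "d \<in> carrier G" if "d \<in> D u" for d using subgroup.mem_carrier[OF subgroup_D[OF u] that] .
  have t: "(u, trivial_char) \<in> dual_verts"
    using trivial_char_in u subD by (simp add: dual_verts_def trivial_char_def)
  have one: "fourier (u, C) (u, trivial_char) = 1" if C: "C \<in> rcosets (D u)" for C
  proof -
    obtain g where "g \<in> carrier G" "C = D u #> g" using C by (auto simp: RCOSETS_def)
    thus ?thesis using fourier_rcos[OF t u] by (simp add: trivial_char_def)
  qed
  have "(\<Sum>j \<in> verts Y. fourier j (u, \<rho>)) =
      (\<Sum>v \<in> verts X. if v = u then \<Sum>C \<in> rcosets (D u). fourier (u, C) (u, \<rho>) else 0)"
    unfolding sum_verts_Y by (rule sum.cong) (auto simp: fourier_def)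
  also have "\<dots> = (\<Sum>C \<in> rcosets (D u). cnj (fourier (u, C) (u, trivial_char)) * fourier (u, C) (u, \<rho>))"
    using base.finite_verts u one by simp
  finally have *: "(\<Sum>j \<in> verts Y. fourier j (u, \<rho>)) =
    (\<Sum>C \<in> rcosets (D u). cnj (fourier (u, C) (u, trivial_char)) * fourier (u, C) (u, \<rho>))" .
  have "of_nat (card (D u)) * (\<Sum>j \<in> verts Y. fourier j (u, \<rho>)) =
      of_nat (card (D u)) * (of_bool (\<rho> = trivial_char) * (of_nat (card (rcosets (D u))) :: complex))"
    unfolding * fourier_sum_cosets[OF u t w] card_rcosets[OF u, symmetric] by auto
  thus ?thesis using card_D_pos[OF u] by simp
qed

section \<open>Change to the Fourier basis and the determinant of the cover\<close>

lemma card_dual_fiber: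
  assumes v: "v \<in> verts X"
  shows "card {\<rho> \<in> characters G. \<forall>d \<in> D v. \<rho> d = 1} = card (rcosets (D v))"
proof -
  have "card {\<rho> \<in> characters G. \<forall>d \<in> D v. \<rho> d = 1} * card (D v) = card (rcosets (D v)) * card (D v)"
    using card_annihilator[OF fin subgroup_D[OF v]] card_rcosets[OF v] by simp
  thus ?thesis using card_D_pos[OF v] by simp
qed

lemma finite_dual_verts: "finite dual_verts"
  using base.finite_verts finite_characters[OF fin] by (auto simp: dual_verts_def)

lemma card_dual_verts: "card dual_verts = card (verts Y)"
  unfolding dual_verts_def verts_Y
  using base.finite_verts finite_rcosets finite_characters[OF fin] card_dual_fiber by (simp add: card_SigmaI)

lemma nontriv_verts_compl: "verts X - nontriv_verts \<rho> = {v \<in> verts X. \<forall>d \<in> D v. \<rho> d = 1}"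
  by (auto simp: nontriv_verts_def)

text \<open>The matrix of the perturbed Laplacian in the Fourier basis; the last factor |G/D(u)| is
  the total of the trivial Fourier vector over \<open>u\<close>.\<close>

definition fourier_block :: "'v \<times> ('a \<Rightarrow> complex) \<Rightarrow> 'v \<times> ('a \<Rightarrow> complex) \<Rightarrow> complex" where
  "fourier_block w w' = (if snd w = snd w' then of_nat (card (D (fst w))) *
     (twisted_laplacian X (char_voltage (snd w')) (fst w) (fst w') +
      of_bool (snd w' = trivial_char) * of_nat (card (rcosets (D (fst w'))))) else 0)"

text \<open>With \<Phi> the matrix of Fourier vectors and B the block matrix, the perturbed
  Laplacian M satisfies M \<Phi> = \<Phi> B, and \<Phi> is invertible by orthogonality.\<close>

lemma sdet_fourier:
  "sdet (verts Y) (\<lambda>i j. of_int (laplacian_entry Y i j) + of_nat (card (D (fst i))) * 1) =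
   sdet dual_verts fourier_block"
proof -
  let ?W = dual_verts and ?I = "verts Y"
  let ?M = "\<lambda>i j. complex_of_int (laplacian_entry Y i j) + of_nat (card (D (fst i))) * 1"
  note finW = finite_dual_verts
  \<comment> \<open>An arbitrary enumeration of vertices by frequencies makes \<Phi> a square matrix
    over one index set; the choice does not affect the determinant of M.\<close>
  obtain \<beta> where \<beta>: "bij_betw \<beta> ?W ?I"
    using finite_same_card_bij[OF finW cover.finite_verts card_dual_verts] by blast
  have \<beta>I: "\<beta> a \<in> ?I" if "a \<in> ?W" for a using \<beta> that by (auto simp: bij_betw_def)
  let ?\<Phi> = "\<lambda>a b. fourier (\<beta> a) b"
  have intertwine: "(\<Sum>c\<in>?W. ?M (\<beta> a) (\<beta> c) * ?\<Phi> c b) = (\<Sum>c\<in>?W. ?\<Phi> a c * fourier_block c b)"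
    if ab: "a \<in> ?W" "b \<in> ?W" for a b
  proof -
    obtain v C u \<rho> where vC: "\<beta> a = (v, C)" and b: "b = (u, \<rho>)" by (cases "\<beta> a", cases b)
    have i: "(v, C) \<in> ?I" using \<beta>I[OF ab(1)] vC by simp
    hence v: "v \<in> verts X" and C: "C \<in> rcosets (D v)" by (auto simp: verts_Y)
    have w: "(u, \<rho>) \<in> ?W" using ab b by simp
    let ?t = "of_bool (\<rho> = trivial_char) * of_nat (card (rcosets (D u))) :: complex"
    have "(\<Sum>c\<in>?W. ?M (\<beta> a) (\<beta> c) * ?\<Phi> c b) = (\<Sum>j\<in>?I. ?M (v, C) j * fourier j (u, \<rho>))"
      unfolding vC b by (rule sum.reindex_bij_betw[OF \<beta>])
    also have "\<dots> = (\<Sum>j\<in>?I. of_int (laplacian_entry Y (v, C) j) * fourier j (u, \<rho>)) +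
        of_nat (card (D v)) * (\<Sum>j\<in>?I. fourier j (u, \<rho>))"
      by (simp add: distrib_right sum.distrib sum_distrib_left)
    also have "\<dots> = (if (v, \<rho>) \<in> ?W then fourier (v, C) (v, \<rho>) * fourier_block (v, \<rho>) (u, \<rho>) else 0)"
    proof (cases "(v, \<rho>) \<in> ?W")
      case True
      have "of_nat (card (D v)) * ?t = fourier (v, C) (v, \<rho>) * (of_nat (card (D v)) * ?t)"
      proof (cases "\<rho> = trivial_char")
        case True
        obtain g where "g \<in> carrier G" "C = D v #> g" using C by (auto simp: RCOSETS_def)
        hence "fourier (v, C) (v, \<rho>) = 1"
          using fourier_rcos[OF \<open>(v, \<rho>) \<in> ?W\<close> v] True by (simp add: trivial_char_def)
        thus ?thesis by simp
      qed simp
      thus ?thesis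
        unfolding laplacian_fourier[OF i w] fourier_total[OF w] using True
        by (simp add: fourier_block_def distrib_left)
    next
      case False
      hence "\<rho> \<noteq> trivial_char"
        using v trivial_char_in subgroup.mem_carrier[OF subgroup_D[OF v]]
        by (auto simp: dual_verts_def trivial_char_def)
      thus ?thesis unfolding laplacian_fourier[OF i w] fourier_total[OF w] using False by simp
    qed
    also have "\<dots> = (\<Sum>c\<in>?W. if c = (v, \<rho>) then fourier (v, C) (v, \<rho>) * fourier_block (v, \<rho>) (u, \<rho>) else 0)"
      using finW by simp
    also have "\<dots> = (\<Sum>c\<in>?W. ?\<Phi> a c * fourier_block c b)"
      by (rule sum.cong) (auto simp: vC b fourier_def fourier_block_def)
    finally show ?thesis .
  qed
  \<comment> \<open>The Gram matrix is diagonal with entries |G|/|D(u)|, so the determinant of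
    \<Phi> cannot vanish.\<close>
  have "sdet ?W (\<lambda>a b. \<Sum>c\<in>?W. cnj (?\<Phi> c a) * ?\<Phi> c b) \<noteq> 0"
  proof -
    define m where "m w = (of_nat (order G) / of_nat (card (D (fst w))) :: complex)" for w :: "'v \<times> ('a \<Rightarrow> complex)"
    have gram: "(\<Sum>c\<in>?W. cnj (?\<Phi> c a) * ?\<Phi> c b) = (if a = b then m a else 0)"
      if ab: "a \<in> ?W" "b \<in> ?W" for a b
    proof -
      have "card (D (fst a)) > 0" using card_D_pos ab by (auto simp: dual_verts_def)
      moreover have "(\<Sum>c\<in>?W. cnj (?\<Phi> c a) * ?\<Phi> c b) = (\<Sum>i\<in>?I. cnj (fourier i a) * fourier i b)"
        by (rule sum.reindex_bij_betw[OF \<beta>])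
      ultimately show ?thesis using fourier_orthogonal[OF ab] by (auto simp: m_def field_simps)
    qed
    have "sdet ?W (\<lambda>a b. \<Sum>c\<in>?W. cnj (?\<Phi> c a) * ?\<Phi> c b) = sdet ?W (\<lambda>a b. if a = b then m a else 0)"
      by (rule sdet_cong) (simp_all add: gram)
    also have "\<dots> = (\<Prod>a\<in>?W. m a)"
      by (subst sdet_triangular[OF finW, where r = "\<lambda>_. 0"]) auto
    also have "\<dots> \<noteq> 0"
    proof -
      have "m a \<noteq> 0" if "a \<in> ?W" for a
      proof -
        have "fst a \<in> verts X" using that by (auto simp: dual_verts_def)
        thus ?thesis using card_D_pos[of "fst a"] fin order_gt_0_iff_finite by (simp add: m_def)
      qed
      thus ?thesis using finW by simp
    qed
    finally show ?thesis .
  qed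
  hence nz: "sdet ?W ?\<Phi> \<noteq> 0"
    unfolding sdet_mult[OF finW, of "\<lambda>a c. cnj (?\<Phi> c a)"] by simp
  have "sdet ?W (\<lambda>a c. ?M (\<beta> a) (\<beta> c)) * sdet ?W ?\<Phi> = sdet ?W (\<lambda>a b. \<Sum>c\<in>?W. ?M (\<beta> a) (\<beta> c) * ?\<Phi> c b)"
    by (rule sdet_mult[OF finW, symmetric])
  also have "\<dots> = sdet ?W (\<lambda>a b. \<Sum>c\<in>?W. ?\<Phi> a c * fourier_block c b)"
    by (rule sdet_cong[OF refl]) (rule intertwine)
  also have "\<dots> = sdet ?W ?\<Phi> * sdet ?W fourier_block" by (rule sdet_mult[OF finW])
  finally have "sdet ?W (\<lambda>a c. ?M (\<beta> a) (\<beta> c)) = sdet ?W fourier_block" using nz by (simp add: mult.commute)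
  thus ?thesis unfolding sdet_reindex[OF \<beta> finW] .
qed

text \<open>The factor \<open>1 *\<close> puts the perturbation into the product shape of
  \<open>sdet_rank_one_update\<close>, with column vector constantly 1.\<close>

lemma sdet_fourier_block:
  "sdet dual_verts fourier_block = (\<Prod>\<rho> \<in> characters G.
     (\<Prod>v \<in> verts X - nontriv_verts \<rho>. of_nat (card (D v))) *
     sdet (verts X - nontriv_verts \<rho>) (\<lambda>v u. twisted_laplacian X (char_voltage \<rho>) v u +
       1 * (of_bool (\<rho> = trivial_char) * of_nat (card (rcosets (D u))))))"
proof -
  have "sdet dual_verts fourier_block =
      (\<Prod>\<rho> \<in> characters G. sdet {w \<in> dual_verts. snd w = \<rho>} fourier_block)"
    by (rule sdet_blocks[OF finite_dual_verts finite_characters[OF fin]])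
       (auto simp: dual_verts_def fourier_block_def)
  also have "\<dots> = (\<Prod>\<rho> \<in> characters G.
     (\<Prod>v \<in> verts X - nontriv_verts \<rho>. of_nat (card (D v))) *
     sdet (verts X - nontriv_verts \<rho>) (\<lambda>v u. twisted_laplacian X (char_voltage \<rho>) v u +
       1 * (of_bool (\<rho> = trivial_char) * of_nat (card (rcosets (D u))))))"
  proof (rule prod.cong)
    fix \<rho> assume \<rho>: "\<rho> \<in> characters G"
    have "bij_betw (\<lambda>v. (v, \<rho>)) (verts X - nontriv_verts \<rho>) {w \<in> dual_verts. snd w = \<rho>}"
      using \<rho> by (auto simp: bij_betw_def inj_on_def dual_verts_def nontriv_verts_compl)
    moreover have "finite (verts X - nontriv_verts \<rho>)" using base.finite_verts by simp
    ultimately have "sdet {w \<in> dual_verts. snd w = \<rho>} fourier_block =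
        sdet (verts X - nontriv_verts \<rho>) (\<lambda>v u. fourier_block (v, \<rho>) (u, \<rho>))"
      by (rule sdet_reindex)
    also have "\<dots> = sdet (verts X - nontriv_verts \<rho>) (\<lambda>v u. of_nat (card (D v)) *
      (twisted_laplacian X (char_voltage \<rho>) v u +
       1 * (of_bool (\<rho> = trivial_char) * of_nat (card (rcosets (D u))))))"
      by (rule sdet_cong) (simp_all add: fourier_block_def)
    finally show "sdet {w \<in> dual_verts. snd w = \<rho>} fourier_block =
      (\<Prod>v \<in> verts X - nontriv_verts \<rho>. of_nat (card (D v))) *
      sdet (verts X - nontriv_verts \<rho>) (\<lambda>v u. twisted_laplacian X (char_voltage \<rho>) v u +
       1 * (of_bool (\<rho> = trivial_char) * of_nat (card (rcosets (D u)))))"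
      unfolding sdet_scale_rows .
  qed simp
  finally show ?thesis .
qed

text \<open>Exchanging the products leaves, for each \<open>v\<close>, one factor for every
  character trivial on D(v).\<close>

lemma prod_dilation:
  "(\<Prod>\<rho> \<in> characters G. \<Prod>v \<in> verts X - nontriv_verts \<rho>. (of_nat (card (D v)) :: complex)) =
   (\<Prod>v \<in> verts X. of_nat (card (D v)) ^ (order G div card (D v)))"
proof -
  have "(\<Prod>\<rho> \<in> characters G. \<Prod>v \<in> verts X - nontriv_verts \<rho>. (of_nat (card (D v)) :: complex)) =
      (\<Prod>\<rho> \<in> characters G. \<Prod>v | v \<in> verts X \<and> (\<forall>d \<in> D v. \<rho> d = 1). of_nat (card (D v)))"
    by (simp add: nontriv_verts_compl)
  also have "\<dots> = (\<Prod>v \<in> verts X. \<Prod>\<rho> | \<rho> \<in> characters G \<and> (\<forall>d \<in> D v. \<rho> d = 1). of_nat (card (D v)))"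
    by (rule prod.swap_restrict[OF finite_characters[OF fin] base.finite_verts])
  also have "\<dots> = (\<Prod>v \<in> verts X. of_nat (card (D v)) ^ (order G div card (D v)))"
  proof (rule prod.cong)
    fix v assume v: "v \<in> verts X"
    have "order G div card (D v) = card (rcosets (D v))"
      using card_rcosets[OF v] card_D_pos[OF v] by (metis nonzero_mult_div_cancel_right not_less0)
    thus "(\<Prod>\<rho> | \<rho> \<in> characters G \<and> (\<forall>d \<in> D v. \<rho> d = 1). of_nat (card (D v))) =
      (of_nat (card (D v)) :: complex) ^ (order G div card (D v))"
      using card_dual_fiber[OF v] by simp
  qed simp
  finally show ?thesis .
qed

theorem spanning_trees_voltage_cover:
  assumes ne: "verts Y \<noteq> {}"
  shows "of_nat (order G) * of_nat (card (spanning_trees Y)) =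
    (\<Prod>v \<in> verts X. of_nat (card (D v)) ^ (order G div card (D v))) * of_nat (card (spanning_trees X)) *
    (\<Prod>\<rho> \<in> nontrivial_characters G.
       sdet (verts X - nontriv_verts \<rho>) (twisted_laplacian X (char_voltage \<rho>)))"
proof -
  let ?n = "of_nat (card (verts X)) :: complex" and ?I = "of_nat (card (verts Y)) :: complex"
  let ?N = "of_nat (order G) :: complex"
  let ?P = "\<lambda>\<rho>. \<Prod>v \<in> verts X - nontriv_verts \<rho>. (of_nat (card (D v)) :: complex)"
  let ?S = "\<lambda>\<rho>. sdet (verts X - nontriv_verts \<rho>) (\<lambda>v u. twisted_laplacian X (char_voltage \<rho>) v u +
       1 * (of_bool (\<rho> = trivial_char) * of_nat (card (rcosets (D u)))))"
  obtain y where y: "y \<in> verts Y" using ne by blast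
  then obtain q where q: "q \<in> verts X" by (auto simp: verts_Y)
  have "(\<Sum>i\<in>verts Y. of_nat (card (D (fst i)))) = (\<Sum>v \<in> verts X. of_nat (card (rcosets (D v)) * card (D v)) :: complex)"
    unfolding sum_verts_Y by simp
  also have "\<dots> = ?n * ?N" using card_rcosets by simp
  finally have cover: "sdet (verts Y) (\<lambda>i j. of_int (laplacian_entry Y i j) + of_nat (card (D (fst i))) * 1) =
      ?n * ?N * ?I * of_nat (card (spanning_trees Y))"
    using sdet_rank_one_update[OF cover.finite_verts y cover.laplacian_complex_sums, where a = "\<lambda>i. of_nat (card (D (fst i)))" and b = "\<lambda>_. 1"]
    by (simp add: sdet_of_int cover.matrix_tree[OF y])
  \<comment> \<open>The ones sum to |V(X)| and the fibre sizes |G/D(u)| to |V(cover)|, the same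
    product that the determinant of the cover contains.\<close>
  have triv: "?S trivial_char = ?n * ?I * of_nat (card (spanning_trees X))"
  proof -
    have D1: "trivial_char d = 1" if "v \<in> verts X" "d \<in> D v" for v d
      using subgroup.mem_carrier[OF subgroup_D] that by (simp add: trivial_char_def)
    hence V: "verts X - nontriv_verts trivial_char = verts X" by (auto simp: nontriv_verts_def)
    have tl: "twisted_laplacian X (char_voltage trivial_char) v u = of_int (laplacian_entry X v u)" for v u
      unfolding base.twisted_laplacian_trivial[symmetric] twisted_laplacian_def
      using shift_closed base.flip_closed by (intro sum.cong refl) (simp add: char_voltage_def trivial_char_def)
    have "?S trivial_char = sdet (verts X) (\<lambda>v u. of_int (laplacian_entry X v u) + 1 * of_nat (card (rcosets (D u))))"
      unfolding V tl by simp
    also have "\<dots> = ?n * (\<Sum>u\<in>verts X. of_nat (card (rcosets (D u)))) * of_nat (card (spanning_trees X))"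
      using sdet_rank_one_update[OF base.finite_verts q base.laplacian_complex_sums, where a = "\<lambda>_. 1" and b = "\<lambda>u. of_nat (card (rcosets (D u)))"]
      by (simp add: sdet_of_int base.matrix_tree[OF q])
    also have "(\<Sum>u\<in>verts X. of_nat (card (rcosets (D u)))) = ?I"
      unfolding verts_Y using base.finite_verts finite_rcosets by (simp add: card_SigmaI)
    finally show ?thesis .
  qed
  have "sdet dual_verts fourier_block = (\<Prod>\<rho> \<in> characters G. ?P \<rho>) * (\<Prod>\<rho> \<in> characters G. ?S \<rho>)"
    unfolding sdet_fourier_block prod.distrib ..
  also have "(\<Prod>\<rho> \<in> characters G. ?S \<rho>) = ?S trivial_char * (\<Prod>\<rho> \<in> nontrivial_characters G. ?S \<rho>)"
    using finite_characters[OF fin] characters_split(2) unfolding characters_split(1)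
    by (intro prod.insert) simp_all
  also have "(\<Prod>\<rho> \<in> nontrivial_characters G. ?S \<rho>) =
    (\<Prod>\<rho> \<in> nontrivial_characters G. sdet (verts X - nontriv_verts \<rho>) (twisted_laplacian X (char_voltage \<rho>)))"
    using characters_split(2) by (intro prod.cong sdet_cong) auto
  finally have "(?n * ?I) * (?N * of_nat (card (spanning_trees Y))) = (?n * ?I) *
    ((\<Prod>v \<in> verts X. of_nat (card (D v)) ^ (order G div card (D v))) * of_nat (card (spanning_trees X)) *
    (\<Prod>\<rho> \<in> nontrivial_characters G.
       sdet (verts X - nontriv_verts \<rho>) (twisted_laplacian X (char_voltage \<rho>))))"
    unfolding sdet_fourier[symmetric] cover triv prod_dilation by (simp only: mult_ac)
  moreover have "?n * ?I \<noteq> 0" using y q base.finite_verts cover.finite_verts by auto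
  ultimately show ?thesis by (simp only: mult_cancel_left) blast
qed

end

section \<open>The weight of the matroid\<close>

context voltage_data
begin

context
  fixes \<eta> :: "'h set \<Rightarrow> 'a set"
  assumes \<eta>: "voltage_assignment G X ori D \<eta>"
    and lift: "\<And>e. e \<in> edges X \<Longrightarrow> l e \<in> \<eta> e"
begin

text \<open>\<rho> is trivial on the dilation groups at both ends, hence constant on the coset of
  voltages, with the value taken at the lift.\<close>

lemma half_voltage_value:
  assumes h: "h \<in> halfs X" and \<rho>: "\<rho> \<in> characters G"
    and triv: "rt X h \<notin> nontriv_verts \<rho>" "rt X (flip X h) \<notin> nontriv_verts \<rho>"
  shows "\<rho> ` half_voltage G X ori \<eta> h = {char_voltage \<rho> h}" "half_voltage G X ori \<eta> h \<subseteq> carrier G"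
proof -
  define e where "e = edge_of X h"
  have e: "e \<in> edges X" using h by (simp add: e_def)
  let ?s = "source X ori e" and ?t = "target X ori e"
  have o: "ori e = h \<or> ori e = flip X h" unfolding e_def by (rule base.orientation_cases[OF ori h])
  have st: "?s \<in> verts X - nontriv_verts \<rho>" "?t \<in> verts X - nontriv_verts \<rho>"
    using o h triv base.rt_closed base.flip_closed base.flip_flip by (auto simp: source_def target_def)
  have S: "subgroup (D ?s) G" "subgroup (D ?t) G" using st subgroup_D by auto
  have triv': "\<rho> x = 1" if "x \<in> D ?s <#> D ?t" for x
    using that st charactersD(2)[OF \<rho>] subgroup.mem_carrier[OF S(1)] subgroup.mem_carrier[OF S(2)]
    by (auto simp: set_mult_def nontriv_verts_def)
  let ?K = "D ?s <#> D ?t"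
  have K: "subgroup ?K G" by (rule mult_subgroups[OF S])
  have "\<eta> e \<in> rcosets ?K" using \<eta> e by (simp add: voltage_assignment_def FactGroup_def)
  then obtain a where a: "a \<in> carrier G" "\<eta> e = ?K #> a" by (auto simp: RCOSETS_def)
  have \<eta>e: "\<eta> e = ?K #> l e"
    using repr_independence[OF _ a(1) K, of "l e"] lift[OF e] a(2) by simp
  have le: "l e \<in> carrier G" by (rule l_closed[OF e])
  have val: "\<rho> x = \<rho> (l e)" "x \<in> carrier G" if "x \<in> \<eta> e" for x
    using that triv' charactersD(2)[OF \<rho> _ le] subgroup.mem_carrier[OF K] le by (auto simp: \<eta>e r_coset_def)
  have im: "\<rho> ` \<eta> e = {\<rho> (l e)}" using val lift[OF e] by blast
  have iminv: "\<rho> ` (set_inv (\<eta> e)) = {cnj (\<rho> (l e))}"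
  proof -
    have "\<rho> (inv x) = cnj (\<rho> (l e))" if "x \<in> \<eta> e" for x
      using character_inv_cnj[OF \<rho> val(2)[OF that] fin] val(1)[OF that] by simp
    thus ?thesis using lift[OF e] by (auto simp: SET_INV_def image_UN)
  qed
  have hv: "half_voltage G X ori \<eta> h = (if h = ori e then \<eta> e else set_inv (\<eta> e))"
    by (simp add: half_voltage_def e_def)
  have "char_voltage \<rho> h = (if h = ori e then \<rho> (l e) else cnj (\<rho> (l e)))"
    using o base.flip_neq[OF h] base.edge_of_flip[OF h] character_one[OF \<rho>]
    by (auto simp: char_voltage_def shift_def e_def)
  thus "\<rho> ` half_voltage G X ori \<eta> h = {char_voltage \<rho> h}" using hv im iminv by simp
  show "half_voltage G X ori \<eta> h \<subseteq> carrier G"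
    using val(2) by (auto simp: hv SET_INV_def)
qed

text \<open>The inclusion in the carrier is carried through the induction because \<rho> is known to
  be multiplicative only there.\<close>

lemma walk_voltage_value:
  assumes C: "flip C = flip X" "set c \<subseteq> halfs X" and \<rho>: "\<rho> \<in> characters G"
    and triv: "\<And>h. h \<in> set c \<Longrightarrow> rt X h \<notin> nontriv_verts \<rho> \<and> rt X (flip X h) \<notin> nontriv_verts \<rho>"
  shows "\<rho> ` walk_voltage G C ori \<eta> c = {prod_list (map (char_voltage \<rho>) c)} \<and>
    walk_voltage G C ori \<eta> c \<subseteq> carrier G"
  using C(2) triv
proof (induction c)
  case Nil
  show ?case using character_one[OF \<rho>] by (simp add: walk_voltage_def)
next
  case (Cons h c)
  let ?A = "half_voltage G X ori \<eta> h" and ?B = "walk_voltage G C ori \<eta> c"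
  have IH: "\<rho> ` ?B = {prod_list (map (char_voltage \<rho>) c)}" "?B \<subseteq> carrier G" using Cons by auto
  have A: "\<rho> ` ?A = {char_voltage \<rho> h}" "?A \<subseteq> carrier G"
    using half_voltage_value[OF _ \<rho>, of h] Cons.prems by auto
  have "half_voltage G C ori \<eta> h = ?A" using C(1) by (simp add: half_voltage_def edge_of_def)
  hence W: "walk_voltage G C ori \<eta> (h # c) = ?A <#> ?B" by (simp add: walk_voltage_def)
  have "\<rho> ` (?A <#> ?B) = (\<lambda>(a, b). \<rho> a * \<rho> b) ` (?A \<times> ?B)"
  proof -
    have "\<rho> (a \<otimes> b) = \<rho> a * \<rho> b" if "a \<in> ?A" "b \<in> ?B" for a b
      using that A(2) IH(2) charactersD(2)[OF \<rho>] by blast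
    thus ?thesis by (force simp: set_mult_def)
  qed
  also have "\<dots> = (\<lambda>(x, y). x * y) ` (\<rho> ` ?A \<times> \<rho> ` ?B)" by force
  also have "\<dots> = {prod_list (map (char_voltage \<rho>) (h # c))}" unfolding A IH by simp
  finally have "\<rho> ` (?A <#> ?B) = {prod_list (map (char_voltage \<rho>) (h # c))}" .
  moreover have "?A <#> ?B \<subseteq> carrier G" by (rule set_mult_closed[OF A(2) IH(2)])
  ultimately show ?case unfolding W by blast
qed

text \<open>The determinant expands over all good edge sets; those that are not bases have a
  genus-one component with cycle value 1 and so weigh zero.\<close>

lemma matroid_weight_sdet:
  assumes \<rho>: "\<rho> \<in> characters G"
  shows "of_real (matroid_weight G X ori D \<eta> \<rho>) =
    sdet (verts X - nontriv_verts \<rho>) (twisted_laplacian X (char_voltage \<rho>))"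
proof -
  let ?z = "char_voltage \<rho>" and ?S = "nontriv_verts \<rho>"
  let ?G = "\<lambda>F. F \<subseteq> edges X \<and> (\<forall>C \<in> components (delete_edges X F). good_component ?S C)"
  have types: "genus C = 1 \<and> verts C \<inter> ?S = {} \<Longrightarrow> cycle_value G ori \<eta> \<rho> C = component_value ?z C"
    "unicyclic_type G ori D \<eta> \<rho> C \<longleftrightarrow> genus C = 1 \<and> verts C \<inter> ?S = {} \<and> component_value ?z C \<noteq> 1"
    "tree_type D \<rho> C \<longleftrightarrow> is_tree C \<and> (\<exists>!v. v \<in> verts C \<and> v \<in> ?S)"
    "is_tree C \<Longrightarrow> genus C = 0"
    if F: "F \<subseteq> edges X" and C: "C \<in> components (delete_edges X F)" for F C
  proof -
    interpret Y: hgraph "delete_edges X F" by (rule base.hgraph_delete_edges[OF F])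
    note P = Y.component_props[OF C]
    interpret C: hgraph C by (rule P(1))
    have vC: "v \<in> verts X" if "v \<in> verts C" for v using Y.component_verts[OF C] that by simp
    \<comment> \<open>The image of a dilation group contains 1, so differing from {1} means having a
      value other than 1.\<close>
    have triv_iff: "\<rho> ` D v = {1} \<longleftrightarrow> v \<notin> ?S" if "v \<in> verts C" for v
      using subgroup.one_closed[OF subgroup_D[OF vC[OF that]]] vC[OF that] by (auto simp: nontriv_verts_def)
    show cv: "cycle_value G ori \<eta> \<rho> C = component_value ?z C" if g: "genus C = 1 \<and> verts C \<inter> ?S = {}"
    proof -
      let ?c = "SOME c. is_cycle C c"
      have "card (verts C) \<le> card (edges C)" using g by (auto simp: genus_def)
      hence "is_cycle C ?c" by (intro someI_ex[of "is_cycle C"] C.cycle_exists[OF P(2)])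
      hence c: "set ?c \<subseteq> halfs C" by (simp add: is_cycle_def)
      have "\<rho> ` walk_voltage G C ori \<eta> ?c = {prod_list (map ?z ?c)}"
      proof (rule conjunct1[OF walk_voltage_value[OF _ _ \<rho>]])
        show "flip C = flip X" using P(4) by simp
        show "set ?c \<subseteq> halfs X" using c P(5) by auto
        fix h assume "h \<in> set ?c"
        hence h: "h \<in> halfs C" using c by blast
        hence "rt C h \<in> verts C" "rt C (flip C h) \<in> verts C" using C.rt_closed C.flip_closed by blast+
        thus "rt X h \<notin> ?S \<and> rt X (flip X h) \<notin> ?S" using g P(3,4) by auto
      qed
      thus ?thesis by (simp add: cycle_value_def component_value_def)
    qed
    have "(\<forall>v \<in> verts C. \<rho> ` D v = {1}) \<longleftrightarrow> verts C \<inter> ?S = {}" using triv_iff by blast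
    thus "unicyclic_type G ori D \<eta> \<rho> C \<longleftrightarrow> genus C = 1 \<and> verts C \<inter> ?S = {} \<and> component_value ?z C \<noteq> 1"
      using cv by (auto simp: unicyclic_type_def)
    have "v \<in> verts C \<and> \<rho> ` D v \<noteq> {1} \<longleftrightarrow> v \<in> verts C \<and> v \<in> ?S" for v using triv_iff by blast
    thus "tree_type D \<rho> C \<longleftrightarrow> is_tree C \<and> (\<exists>!v. v \<in> verts C \<and> v \<in> ?S)"
      by (simp add: tree_type_def)
    show "genus C = 0" if "is_tree C" using C.tree_card[OF that] by (simp add: genus_def)
  qed
  have fin2: "finite {F. ?G F}" using base.finite_edges by simp
  have "matroid_weight G X ori D \<eta> \<rho> =
      (\<Sum>F | ?G F. \<Prod>C\<in>components (delete_edges X F). component_wt ?z ?S C)"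
    unfolding matroid_weight_def
  proof (rule sum.mono_neutral_cong_left[OF fin2])
    show "matroid_bases G X ori D \<eta> \<rho> \<subseteq> {F. ?G F}"
      using types(2,3) by (fastforce simp: matroid_bases_def good_component_def)
  next
    show "\<forall>F \<in> {F. ?G F} - matroid_bases G X ori D \<eta> \<rho>.
        (\<Prod>C\<in>components (delete_edges X F). component_wt ?z ?S C) = 0"
    proof
      fix F assume "F \<in> {F. ?G F} - matroid_bases G X ori D \<eta> \<rho>"
      then obtain C where F: "F \<subseteq> edges X" and C: "C \<in> components (delete_edges X F)"
        "good_component ?S C" "\<not> unicyclic_type G ori D \<eta> \<rho> C" "\<not> tree_type D \<rho> C"
        by (auto simp: matroid_bases_def)
      interpret Y: hgraph "delete_edges X F" by (rule base.hgraph_delete_edges[OF F])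
      have "component_wt ?z ?S C = 0"
        using C types(2,3)[OF F C(1)] by (auto simp: good_component_def component_wt_def)
      thus "(\<Prod>C\<in>components (delete_edges X F). component_wt ?z ?S C) = 0"
        using C(1) Y.finite_components by (intro prod_zero) auto
    qed
  next
    fix F assume "F \<in> matroid_bases G X ori D \<eta> \<rho>"
    hence F: "F \<subseteq> edges X" "\<And>C. C \<in> components (delete_edges X F) \<Longrightarrow>
        unicyclic_type G ori D \<eta> \<rho> C \<or> tree_type D \<rho> C"
      by (auto simp: matroid_bases_def)
    show "basis_weight G X ori D \<eta> \<rho> F = (\<Prod>C\<in>components (delete_edges X F). component_wt ?z ?S C)"
      unfolding basis_weight_def
    proof (rule prod.cong)
      fix C assume C: "C \<in> components (delete_edges X F)"
      show "component_weight G ori D \<eta> \<rho> C = component_wt ?z ?S C"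
        using F(2)[OF C] types[OF F(1) C] by (auto simp: component_weight_def component_wt_def)
    qed simp
  qed
  thus ?thesis using base.voltage_matrix_tree[OF ori char_voltage_unit[OF \<rho>]] by simp
qed

end

end

section \<open>Comparison with the voltage cover\<close>

text \<open>Counting through the reduced Laplacian, which an isomorphism merely reindexes, avoids
  transporting trees.\<close>

lemma spanning_trees_iso:
  assumes mor: "hgraph_morphism Y X fV fH"
    and V: "bij_betw fV (verts Y) (verts X)" and H: "bij_betw fH (halfs Y) (halfs X)" and ne: "verts Y \<noteq> {}"
  shows "card (spanning_trees Y) = card (spanning_trees X)"
proof -
  interpret hgraph_morphism Y X fV fH by (rule mor)
  obtain q where q: "q \<in> verts Y" using ne by blast
  have inj: "fV u = fV v \<longleftrightarrow> u = v" if "u \<in> verts Y" "v \<in> verts Y" for u v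
    using V that by (auto simp: bij_betw_def inj_on_def)
  have entry: "laplacian_entry X (fV u) (fV v) = laplacian_entry Y u v" if uv: "u \<in> verts Y" "v \<in> verts Y" for u v
  proof -
    have "laplacian_entry X (fV u) (fV v) = (\<Sum>k \<in> halfs Y. of_bool (rt X (fH k) = fV u) *
        (of_bool (fV u = fV v) - of_bool (rt X (flip X (fH k)) = fV v)))"
      unfolding cod.laplacian_entry_sum by (rule sum.reindex_bij_betw[OF H, symmetric])
    also have "\<dots> = laplacian_entry Y u v"
      unfolding dom.laplacian_entry_sum
    proof (rule sum.cong)
      fix k assume k: "k \<in> halfs Y"
      have "rt X (fH k) = fV (rt Y k)" "rt X (flip X (fH k)) = fV (rt Y (flip Y k))"
        using k rt_commute flip_commute dom.flip_closed by auto
      thus "of_bool (rt X (fH k) = fV u) * (of_bool (fV u = fV v) - of_bool (rt X (flip X (fH k)) = fV v)) =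
          (of_bool (rt Y k = u) * (of_bool (u = v) - of_bool (rt Y (flip Y k) = v)) :: int)"
        using inj uv dom.rt_closed[OF k] dom.rt_closed[OF dom.flip_closed[OF k]] by simp
    qed simp
    finally show ?thesis .
  qed
  have "bij_betw fV (verts Y - {q}) (verts X - {fV q})"
    using V q by (auto simp: bij_betw_def inj_on_def)
  hence "sdet (verts X - {fV q}) (laplacian_entry X) =
      sdet (verts Y - {q}) (\<lambda>u v. laplacian_entry X (fV u) (fV v))"
    using dom.finite_verts by (intro sdet_reindex) auto
  also have "\<dots> = sdet (verts Y - {q}) (laplacian_entry Y)"
    by (rule sdet_cong) (auto simp: entry)
  finally show ?thesis using dom.matrix_tree[OF q] cod.matrix_tree[OF vert_closed[OF q]] by simp
qed

lemma (in hgraph_morphism) connected_image: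
  assumes conn: "connected_hgraph Y" and surj: "verts X \<subseteq> fV ` verts Y"
  shows "connected_hgraph X"
proof -
  have path: "(fV u, fV v) \<in> (adj_rel X)\<^sup>*" if "(u, v) \<in> (adj_rel Y)\<^sup>*" for u v
    using that
  proof (induction rule: rtrancl_induct)
    case (step v w)
    then obtain k where k: "k \<in> halfs Y" "v = rt Y k" "w = rt Y (flip Y k)" by (auto simp: adj_rel_def)
    have "(rt X (fH k), rt X (flip X (fH k))) \<in> adj_rel X" by (rule cod.adjI[OF half_closed[OF k(1)]])
    hence "(fV v, fV w) \<in> adj_rel X"
      using k rt_commute flip_commute dom.flip_closed by simp
    thus ?case using step.IH by simp
  qed simp
  obtain q where q: "q \<in> verts Y" using conn by (auto simp: connected_hgraph_def)
  show ?thesis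
  proof (rule cod.connectedI[OF vert_closed[OF q]])
    fix v assume "v \<in> verts X"
    then obtain w where "w \<in> verts Y" "v = fV w" using surj by blast
    thus "(v, fV q) \<in> (adj_rel X)\<^sup>*" using path[of w q] conn q by (auto simp: connected_hgraph_def)
  qed
qed

text \<open>An intersection of stabilisers; over a vertex outside \<open>X\<close> the fibre is
  empty and the group is all of \<open>G\<close>.\<close>

lemma (in harmonic_galois_cover) subgroup_dilation_group:
  "subgroup (dilation_group G Y pV \<phi>V v) G"
proof -
  have S: "subgroup (stabilizer G \<phi>V w) G" if "w \<in> vert_fiber Y pV v" for w
    using that vert_action.stabilizer_subgroup by (simp add: vert_fiber_def)
  show ?thesis
    unfolding dilation_group_def
    by (rule subgroup.intro)
       (auto intro: subgroup.m_closed[OF S] subgroup.one_closed[OF S] subgroup.m_inv_closed[OF S])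
qed

theorem theorem1p1:
  fixes G :: "('g, 'b) monoid_scheme"
    and Xt :: "('w, 'k) hgraph" and X :: "('v, 'h) hgraph"
    and pV :: "'w \<Rightarrow> 'v" and pH :: "'k \<Rightarrow> 'h" and d :: "'w \<Rightarrow> nat"
    and \<phi>V :: "'g \<Rightarrow> 'w \<Rightarrow> 'w" and \<phi>H :: "'g \<Rightarrow> 'k \<Rightarrow> 'k"
    and ori :: "'h set \<Rightarrow> 'h" and \<eta> :: "'h set \<Rightarrow> 'g set"
    and N :: nat and D :: "'v \<Rightarrow> 'g set"
  assumes finite_G: "finite (carrier G)"
    and N: "N = order G"
    and cover: "harmonic_galois_cover G Xt X pV pH d \<phi>V \<phi>H"
    and conn: "connected_hgraph Xt"
    and D: "D = dilation_group G Xt pV \<phi>V"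
    and ori: "orientation X ori"
    and \<eta>: "voltage_of_cover G Xt X pV pH \<phi>V \<phi>H ori \<eta>"
  shows "card (spanning_trees Xt) = order (Jac Xt) \<and>
         card (spanning_trees X) = order (Jac X) \<and>
         real (order (Jac Xt)) =
           1 / real N * (\<Prod>v \<in> verts X. real (card (D v)) ^ (N div card (D v)))
             * real (order (Jac X))
             * (\<Prod>\<rho> \<in> nontrivial_characters G. matroid_weight G X ori D \<eta> \<rho>)"
proof -
  interpret harmonic_galois_cover G Xt X pV pH d \<phi>V \<phi>H by (rule cover)
  obtain l iV iH where \<eta>': "voltage_assignment G X ori D \<eta>" and lift: "\<And>e. e \<in> edges X \<Longrightarrow> l e \<in> \<eta> e"
    and mor: "hgraph_morphism Xt (voltage_cover G X ori D l) iV iH"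
    and iV: "bij_betw iV (verts Xt) (verts (voltage_cover G X ori D l))"
    and iH: "bij_betw iH (halfs Xt) (halfs (voltage_cover G X ori D l))"
    and fst_iV: "\<And>w. w \<in> verts Xt \<Longrightarrow> fst (iV w) = pV w"
    using \<eta> unfolding voltage_of_cover_def Let_def D[symmetric] by blast
  let ?C = "voltage_cover G X ori D l"
  interpret C: hgraph ?C using mor by (simp add: hgraph_morphism_def)
  have sub: "subgroup (D v) G" for v unfolding D by (rule subgroup_dilation_group)
  have l: "l e \<in> carrier G" if e: "e \<in> edges X" for e
  proof -
    let ?K = "D (source X ori e) <#>\<^bsub>G\<^esub> D (target X ori e)"
    have "\<eta> e \<in> rcosets\<^bsub>G\<^esub> ?K" using \<eta>' e by (simp add: voltage_assignment_def FactGroup_def)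
    hence "\<eta> e \<subseteq> carrier G" using rcosets_part_G[OF mult_subgroups[OF sub sub]] by blast
    thus ?thesis using lift[OF e] by blast
  qed
  interpret V: voltage_data G X ori D l
    by (intro voltage_data.intro voltage_data_axioms.intro comm_group_axioms cod.hgraph_axioms
        C.hgraph_axioms finite_G ori sub l)
  have ne: "verts Xt \<noteq> {}" using conn by (simp add: connected_hgraph_def)
  hence neC: "verts ?C \<noteq> {}" using iV by (auto simp: bij_betw_def)
  \<comment> \<open>Every fibre of the voltage cover contains the coset D(v) itself, so the
    projection is surjective and connectedness descends to \<open>X\<close>.\<close>
  have "verts X \<subseteq> pV ` verts Xt"
  proof
    fix v assume v: "v \<in> verts X"
    hence "(v, D v #>\<^bsub>G\<^esub> \<one>\<^bsub>G\<^esub>) \<in> verts ?C"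
      unfolding V.verts_Y using rcosetsI[OF subgroup.subset[OF sub] one_closed] by simp
    moreover have "verts ?C = iV ` verts Xt" using iV by (simp add: bij_betw_def)
    ultimately obtain w where "w \<in> verts Xt" "iV w = (v, D v #>\<^bsub>G\<^esub> \<one>\<^bsub>G\<^esub>)" by auto
    thus "v \<in> pV ` verts Xt" using fst_iV by force
  qed
  hence connX: "connected_hgraph X" by (rule connected_image[OF conn])
  have Jt: "order (Jac Xt) = card (spanning_trees Xt)" by (rule dom.order_Jac[OF conn])
  have J: "order (Jac X) = card (spanning_trees X)" by (rule cod.order_Jac[OF connX])
  have "card (spanning_trees ?C) = order (Jac Xt)"
    using spanning_trees_iso[OF mor iV iH ne] Jt by simp
  moreover have "sdet (verts X - V.nontriv_verts \<rho>) (twisted_laplacian X (V.char_voltage \<rho>)) =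
      of_real (matroid_weight G X ori D \<eta> \<rho>)" if "\<rho> \<in> nontrivial_characters G" for \<rho>
    using V.matroid_weight_sdet[OF \<eta>' lift] that by (simp add: nontrivial_characters_def)
  \<comment> \<open>The Fourier argument lives over the complex numbers; the quantities here are
    real, so the identity descends.\<close>
  ultimately have "complex_of_real (real N * real (order (Jac Xt))) =
      of_real ((\<Prod>v \<in> verts X. real (card (D v)) ^ (N div card (D v))) * real (order (Jac X)) *
        (\<Prod>\<rho> \<in> nontrivial_characters G. matroid_weight G X ori D \<eta> \<rho>))"
    using V.spanning_trees_voltage_cover[OF neC] J N by simp
  hence eq: "real N * real (order (Jac Xt)) =
      (\<Prod>v \<in> verts X. real (card (D v)) ^ (N div card (D v))) * real (order (Jac X)) *
        (\<Prod>\<rho> \<in> nontrivial_characters G. matroid_weight G X ori D \<eta> \<rho>)"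
    by (simp only: of_real_eq_iff)
  have "N > 0" using finite_G order_gt_0_iff_finite N by blast
  thus ?thesis using eq Jt J by (simp add: field_simps)
qed

end
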